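(* Let $g\in L_1(\mathbb{R})$ and let $h\in C^2(\mathbb{R})\cap L_1(\mathbb{R})$ be such that $h',h''\in L_1(\mathbb{R})$. Assume that $1+(Fg)(y)\neq0$ for every $y\in\mathbb{R}$. Then the problem $$\left\{\begin{array}{l} f(x)-f''(x)+\left(1-\frac{d^2}{dx^2}\right)\big(f \underset{H_1,F}{*}g\big)(x)=\big(h \underset{H_1,F}{*} g\big)(x),\\ \lim\limits_{|x|\to \infty} f(x) =\lim\limits_{|x|\to \infty} f'(x) =0, \end{array}\right.$$ for the unknown function $f$ has a unique solution in $C^2(\mathbb{R})\cap L_1(\mathbb{R})$, represented by $$f(x)=\left(\big(h\underset{H_1,F}{*}\xi\big)\underset{H_1,F}{*}\sqrt{\tfrac{\pi}{2}}\,e^{-|t|}\right)(x),$$ where $\xi\in L_1(\mathbb{R})$ is determined by $(F\xi)(y)=\frac{(Fg)(y)}{1+(Fg)(y)}$, $y\in\mathbb{R}$. Moreover, $$\|f\|_{L_1(\mathbb{R})}\leq 2\sqrt{\frac{2}{\pi}}\,\|h\|_{L_1(\mathbb{R})}\|\xi\|_{L_1(\mathbb{R})}.$$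
   Context: The Fourier transform is $(Ff)(y)=\frac{1}{\sqrt{2\pi}}\int_{\mathbb{R}}e^{-ixy}f(x)\,dx$, $y\in\mathbb{R}$. The Hartley-Fourier generalized convolution is $$\big(f\underset{H_1,F}{*}g\big)(x):=\frac{1}{2\sqrt{2\pi}}\int_{\mathbb{R}} g(y)\,[f(x+y)+f(x-y)+i\,f(-x-y)-i\,f(-x+y)]\,dy,\quad x\in\mathbb{R}.$$ In the representation of $f$, $e^{-|t|}$ stands for the function $t\mapsto e^{-|t|}$ on $\mathbb{R}$. *)

theory Defs
  imports "HOL-Analysis.Analysis"
begin

text \<open>
  All functions are complex-valued functions of a real variable. An element of \<open>L\<^sub>1\<close> is given by a
  Lebesgue-integrable representative, i.e. by \<open>f\<close> with \<open>integrable lebesgue f\<close>.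
\<close>

definition fourier :: "(real \<Rightarrow> complex) \<Rightarrow> real \<Rightarrow> complex" where
  "fourier f y =
     1 / complex_of_real (sqrt (2 * pi)) *
       (LINT x|lebesgue. exp (- (\<i> * complex_of_real (x * y))) * f x)"

definition hf_conv :: "(real \<Rightarrow> complex) \<Rightarrow> (real \<Rightarrow> complex) \<Rightarrow> real \<Rightarrow> complex" where
  "hf_conv f g x =
     1 / (2 * complex_of_real (sqrt (2 * pi))) *
       (LINT y|lebesgue. g y * (f (x + y) + f (x - y) + \<i> * f (- x - y) - \<i> * f (- x + y)))"

definition L1_norm :: "(real \<Rightarrow> complex) \<Rightarrow> real" where
  "L1_norm f = (LINT x|lebesgue. norm (f x))"

text \<open>
  \<^const>\<open>vector_derivative\<close> returns an arbitrary value where the function is not differentiable,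
  so \<open>D\<close> is only used below together with a differentiability condition.
\<close>

definition D :: "(real \<Rightarrow> complex) \<Rightarrow> real \<Rightarrow> complex" where
  "D f x = vector_derivative f (at x)"

definition twice_differentiable :: "(real \<Rightarrow> complex) \<Rightarrow> bool" where
  "twice_differentiable f \<longleftrightarrow>
     (\<forall>x. f differentiable (at x)) \<and> (\<forall>x. D f differentiable (at x))"

definition C2 :: "(real \<Rightarrow> complex) \<Rightarrow> bool" where
  "C2 f \<longleftrightarrow> twice_differentiable f \<and> continuous_on UNIV (D (D f))"

text \<open>
  For \<open>f\<close> in \<open>C\<^sup>2\<close> the convolution with an \<open>L\<^sub>1\<close> function need not be twice differentiable, so being a
  classical solution includes that the left-hand side of the equation makes sense. Continuity of
  the second derivative of the convolution is not demanded, which makes uniqueness stronger.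
\<close>

definition is_solution ::
    "(real \<Rightarrow> complex) \<Rightarrow> (real \<Rightarrow> complex) \<Rightarrow> (real \<Rightarrow> complex) \<Rightarrow> bool" where
  "is_solution g h f \<longleftrightarrow>
     C2 f \<and> integrable lebesgue f \<and>
     twice_differentiable (hf_conv f g) \<and>
     (\<forall>x. f x - D (D f) x + (hf_conv f g x - D (D (hf_conv f g)) x) = hf_conv h g x) \<and>
     (f \<longlongrightarrow> 0) at_infinity \<and> (D f \<longlongrightarrow> 0) at_infinity"

definition is_resolvent :: "(real \<Rightarrow> complex) \<Rightarrow> (real \<Rightarrow> complex) \<Rightarrow> bool" where
  "is_resolvent g \<xi> \<longleftrightarrow>
     integrable lebesgue \<xi> \<and> (\<forall>y. fourier \<xi> y = fourier g y / (1 + fourier g y))"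

end

theory Submission
  imports Defs "HOL-Probability.Characteristic_Functions" "HOL-Probability.Sinc_Integral"
begin

text \<open>
  The map \<open>f \<mapsto> hf_conv f g\<close> becomes multiplication by \<open>fourier g\<close> after a Hartley transform of \<open>f\<close>
  (\<open>hartley_hf_conv\<close>). The problem therefore reads
  \<open>(1 + s\<^sup>2) * hartley f s * (1 + fourier g s) = hartley h s * fourier g s\<close>, and dividing by
  \<open>1 + fourier g\<close> and by \<open>1 + s\<^sup>2\<close> gives the solution: the first division is convolution with \<open>\<xi>\<close>, the
  second is convolution with the Green's function \<open>exp (- \<bar>t\<bar>) / 2\<close> of \<open>1 - d\<^sup>2/dx\<^sup>2\<close>.

  The deep point is that \<open>\<xi>\<close> exists, i.e. that \<open>fourier g / (1 + fourier g)\<close> is again the transform of an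
  integrable function. This is Wiener's lemma (\<open>wiener_inverse\<close>), proved after Newman: \<open>g\<close> is approximated in
  \<open>L\<^sub>1\<close> by a function \<open>p\<close> whose transform is smooth and decays (\<open>L1_approx_smooth_ft\<close>), and
  \<open>1 / (1 + ft g)\<close> is expanded in powers of the small difference over powers of \<open>1 + ft p\<close>. The norms of
  the latter are controlled by two derivatives (\<open>wiener_norm_le_smooth\<close>, which rests on Fourier inversion),
  so they grow geometrically with ratio the supremum of \<open>1 / \<bar>1 + ft p\<bar>\<close> up to polynomial factors, and the
  series converges.

  Uniqueness, of the solution as of \<open>\<xi>\<close>, is injectivity of the Fourier transform on \<open>L\<^sub>1\<close>
  (\<open>ft_eq_0_imp_AE_0\<close>), obtained from Gaussian smoothing. To pass from a solution to the transformed equation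
  one must not differentiate under the convolution: the sum \<open>f + hf_conv f g\<close> is bounded and satisfies an
  ordinary differential equation, hence equals the Green's integral of the right-hand side
  (\<open>bounded_solution_eq_green\<close>), whose transform is known.
\<close>

section \<open>The Fourier transform and convolution on the line\<close>

lemma borel_measurable_cis [measurable]: "cis \<in> borel_measurable borel"
proof -
  have "continuous_on UNIV cis"
    unfolding cis_conv_exp by (intro continuous_intros)
  then show ?thesis by (rule borel_measurable_continuous_onI)
qed

text \<open>
  The Fourier integral without the factor \<open>1 / sqrt (2 * pi)\<close>: it turns convolution into
  multiplication with no constants. It is taken over \<open>lborel\<close> because Fubini's theorem is used on
  \<open>lborel \<Otimes>\<^sub>M lborel\<close>; Lebesgue measurable functions enter through Borel representatives.
\<close>

definition ft :: "(real \<Rightarrow> complex) \<Rightarrow> real \<Rightarrow> complex" where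
  "ft f s = (LINT x|lborel. cis (- (s * x)) * f x)"

definition conv :: "(real \<Rightarrow> complex) \<Rightarrow> (real \<Rightarrow> complex) \<Rightarrow> real \<Rightarrow> complex" where
  "conv f g x = (LINT y|lborel. f (x - y) * g y)"

lemma integrable_cis_mult:
  assumes "integrable lborel f"
  shows "integrable lborel (\<lambda>x. cis (a * x) * f x)"
  by (rule Bochner_Integration.integrable_bound[OF assms])
     (use borel_measurable_integrable[OF assms] in \<open>auto simp: norm_mult\<close>)

lemma integrable_cis_minus_mult:
  assumes "integrable lborel f"
  shows "integrable lborel (\<lambda>x. cis (- (s * x)) * f x)"
  using integrable_cis_mult[OF assms, of "- s"] by simp

lemma norm_ft_le:
  assumes "integrable lborel f"
  shows "norm (ft f s) \<le> (LINT x|lborel. norm (f x))"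
proof -
  have "norm (ft f s) \<le> (LINT x|lborel. norm (cis (- (s * x)) * f x))"
    unfolding ft_def by (rule integral_norm_bound)
  then show ?thesis by (simp add: norm_mult)
qed

lemma ft_add:
  assumes "integrable lborel f" "integrable lborel g"
  shows "ft (\<lambda>x. f x + g x) s = ft f s + ft g s"
  using assms by (simp add: ft_def distrib_left integrable_cis_minus_mult)

lemma ft_diff:
  assumes "integrable lborel f" "integrable lborel g"
  shows "ft (\<lambda>x. f x - g x) s = ft f s - ft g s"
  using assms by (simp add: ft_def right_diff_distrib integrable_cis_minus_mult)

lemma ft_cmult: "ft (\<lambda>x. c * f x) s = c * ft f s"
  unfolding ft_def by (subst integral_mult_right_zero [symmetric]) (simp add: mult_ac)

lemma integral_lborel_reflect_shift:
  fixes f :: "real \<Rightarrow> 'a :: {banach, second_countable_topology}"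
  shows "(LINT y|lborel. f (x - y)) = (LINT y|lborel. f y)"
  using lborel_integral_real_affine[of "-1" f x] by simp

lemma integral_lborel_shift:
  fixes f :: "real \<Rightarrow> 'a :: {banach, second_countable_topology}"
  shows "(LINT y|lborel. f (y - x)) = (LINT y|lborel. f y)"
    and "(LINT y|lborel. f (y + x)) = (LINT y|lborel. f y)"
    and "(LINT y|lborel. f (- y)) = (LINT y|lborel. f y)"
  using lborel_integral_real_affine[of 1 f "-x"] lborel_integral_real_affine[of 1 f "x"]
    lborel_integral_real_affine[of "-1" f 0] by (simp_all add: add.commute)

lemma integrable_lborel_shift:
  fixes f :: "real \<Rightarrow> 'a :: {banach, second_countable_topology}"
  assumes "integrable lborel f"
  shows "integrable lborel (\<lambda>y. f (x - y))" "integrable lborel (\<lambda>y. f (y - x))"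
    "integrable lborel (\<lambda>y. f (y + x))" "integrable lborel (\<lambda>y. f (- y))"
  using lborel_integrable_real_affine[OF assms, of "-1" x]
    lborel_integrable_real_affine[OF assms, of 1 "-x"]
    lborel_integrable_real_affine[OF assms, of 1 "x"]
    lborel_integrable_real_affine[OF assms, of "-1" 0] by (simp_all add: add.commute)

lemma ft_reflect: "ft (\<lambda>x. f (- x)) s = ft f (- s)"
  unfolding ft_def using integral_lborel_shift(3)[of "\<lambda>x. cis (s * x) * f x"] by simp

lemma conv_commute: "conv f g x = conv g f x"
  unfolding conv_def
  using integral_lborel_reflect_shift[of "\<lambda>y. f (x - y) * g y" x] by (simp add: mult.commute)

text \<open>
  The joint integrability that licenses every exchange of integrals for convolutions: integrating
  the absolute value over \<open>x\<close> first gives the norm of \<open>f\<close> times \<open>\<bar>g y\<bar>\<close>.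
\<close>

lemma integrable_pair_shear:
  fixes f g :: "real \<Rightarrow> complex"
  assumes f: "integrable lborel f" and g: "integrable lborel g"
  shows "integrable (lborel \<Otimes>\<^sub>M lborel) (\<lambda>(y, x). f (x - y) * g y)"
proof -
  have [measurable]: "f \<in> borel_measurable borel" "g \<in> borel_measurable borel"
    using f g by (auto dest: borel_measurable_integrable)
  show ?thesis
  proof (rule lborel_pair.Fubini_integrable)
    show "(\<lambda>(y, x). f (x - y) * g y) \<in> borel_measurable (lborel \<Otimes>\<^sub>M lborel)"
      by measurable
    have "(LINT x|lborel. norm (f (x - y) * g y)) = (LINT x|lborel. norm (f x)) * norm (g y)" for y
      using integral_lborel_shift(1)[of "\<lambda>x. norm (f x)" y] by (simp add: norm_mult)
    then show "integrable lborel (\<lambda>y. LINT x|lborel. norm (case (y, x) of (y, x) \<Rightarrow> f (x - y) * g y))"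
      using g by simp
    show "AE y in lborel. integrable lborel (\<lambda>x. case (y, x) of (y, x) \<Rightarrow> f (x - y) * g y)"
      using integrable_lborel_shift[OF f] by simp
  qed
qed

lemma integrable_conv:
  assumes f: "integrable lborel f" and g: "integrable lborel g"
  shows "integrable lborel (conv f g)"
proof -
  have "integrable lborel (\<lambda>x. LINT y|lborel. f (x - y) * g y)"
    using lborel_pair.integrable_snd[of "\<lambda>y x. f (x - y) * g y"] integrable_pair_shear[OF f g]
    by simp
  then show ?thesis by (simp add: conv_def [abs_def])
qed

lemma L1_norm_conv_le:
  assumes f: "integrable lborel f" and g: "integrable lborel g"
  shows "(LINT x|lborel. norm (conv f g x))
    \<le> (LINT x|lborel. norm (f x)) * (LINT x|lborel. norm (g x))"
proof -
  have i: "integrable (lborel \<Otimes>\<^sub>M lborel) (\<lambda>(y, x). norm (f (x - y) * g y))"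
    using integrable_norm[OF integrable_pair_shear[OF f g]] by (simp add: case_prod_unfold)
  have "(LINT x|lborel. norm (conv f g x)) \<le> (LINT x|lborel. LINT y|lborel. norm (f (x - y) * g y))"
  proof (rule integral_mono)
    show "integrable lborel (\<lambda>x. norm (conv f g x))"
      using integrable_conv[OF f g] by simp
    show "integrable lborel (\<lambda>x. LINT y|lborel. norm (f (x - y) * g y))"
      using lborel_pair.integrable_snd[OF i] .
    show "norm (conv f g x) \<le> (LINT y|lborel. norm (f (x - y) * g y))" for x
      unfolding conv_def by (rule integral_norm_bound)
  qed
  also have "\<dots> = (LINT y|lborel. LINT x|lborel. norm (f (x - y) * g y))"
    using lborel_pair.Fubini_integral[OF i] by simp
  also have "\<dots> = (LINT y|lborel. (LINT x|lborel. norm (f x)) * norm (g y))"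
    using integral_lborel_shift(1)[of "\<lambda>x. norm (f x)"] by (simp add: norm_mult)
  finally show ?thesis by simp
qed

lemma cis_mult_shift: "cis (- (s * (x + y))) = cis (- (s * x)) * cis (- (s * y))"
  by (simp add: cis_mult distrib_left)

lemma ft_conv:
  assumes f: "integrable lborel f" and g: "integrable lborel g"
  shows "ft (conv f g) s = ft f s * ft g s"
proof -
  have i: "integrable (lborel \<Otimes>\<^sub>M lborel) (\<lambda>(y, x). cis (- (s * x)) * (f (x - y) * g y))"
  proof (rule Bochner_Integration.integrable_bound[OF integrable_pair_shear[OF f g]])
    have [measurable]: "f \<in> borel_measurable borel" "g \<in> borel_measurable borel"
      using f g by (auto dest: borel_measurable_integrable)
    show "(\<lambda>(y, x). cis (- (s * x)) * (f (x - y) * g y)) \<in> borel_measurable (lborel \<Otimes>\<^sub>M lborel)"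
      by measurable
  qed (auto simp: norm_mult)
  have "ft (conv f g) s = (LINT x|lborel. LINT y|lborel. cis (- (s * x)) * (f (x - y) * g y))"
    by (simp add: ft_def conv_def)
  also have "\<dots> = (LINT y|lborel. LINT x|lborel. cis (- (s * x)) * (f (x - y) * g y))"
    using lborel_pair.Fubini_integral[OF i] by simp
  also have "\<dots> = (LINT y|lborel. ft f s * (cis (- (s * y)) * g y))"
  proof (rule Bochner_Integration.integral_cong)
    fix y
    have "(LINT x|lborel. cis (- (s * x)) * (f (x - y) * g y))
        = (LINT x|lborel. (\<lambda>x. cis (- (s * (x + y))) * (f x * g y)) (x - y))"
      by simp
    also have "\<dots> = (LINT x|lborel. cis (- (s * (x + y))) * (f x * g y))"
      by (rule integral_lborel_shift(1))
    also have "\<dots> = (LINT x|lborel. (cis (- (s * x)) * f x) * (cis (- (s * y)) * g y))"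
      by (simp add: cis_mult_shift mult_ac)
    also have "\<dots> = ft f s * (cis (- (s * y)) * g y)"
      by (simp add: ft_def)
    finally show "(LINT x|lborel. cis (- (s * x)) * (f (x - y) * g y)) = ft f s * (cis (- (s * y)) * g y)" .
  qed simp
  also have "\<dots> = ft f s * ft g s"
    by (simp add: ft_def)
  finally show ?thesis .
qed

lemma L1_dominated_convergence:
  fixes s :: "nat \<Rightarrow> real \<Rightarrow> complex"
  assumes [measurable]: "f \<in> borel_measurable lborel" "\<And>i. s i \<in> borel_measurable lborel"
    and w: "integrable lborel w" and lim: "AE x in lborel. (\<lambda>i. s i x) \<longlonglongrightarrow> f x"
    and bd: "\<And>i. AE x in lborel. norm (s i x) \<le> w x"
  shows "(\<lambda>i. LINT x|lborel. norm (f x - s i x)) \<longlonglongrightarrow> 0"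
proof -
  have "AE x in lborel. \<forall>i. norm (s i x) \<le> w x"
    using bd by (simp add: AE_all_countable)
  then have "AE x in lborel. \<forall>i. norm (f x - s i x) \<le> 2 * w x" using lim
  proof eventually_elim
    case (elim x)
    have "norm (f x) \<le> w x"
      by (rule LIMSEQ_le_const2[OF tendsto_norm[OF elim(2)]]) (use elim(1) in blast)
    moreover have "norm (f x - s i x) \<le> norm (f x) + norm (s i x)" for i
      by (rule norm_triangle_ineq4)
    ultimately show ?case
      using elim(1) by (smt (verit, best))
  qed
  then have b: "AE x in lborel. norm (norm (f x - s i x)) \<le> 2 * w x" for i by auto
  have "AE x in lborel. (\<lambda>i. norm (f x - s i x)) \<longlonglongrightarrow> 0" using lim
  proof eventually_elim
    case (elim x)
    then have "(\<lambda>i. f x - s i x) \<longlonglongrightarrow> f x - f x" by (intro tendsto_intros)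
    then show ?case using tendsto_norm_zero by fastforce
  qed
  then have "(\<lambda>i. LINT x|lborel. norm (f x - s i x)) \<longlonglongrightarrow> (LINT x|(lborel::real measure). 0)"
    by (rule integral_dominated_convergence[where w = "\<lambda>x. 2 * w x", rotated 3]) (use w b in auto)
  then show ?thesis by simp
qed

text \<open>
  Dominated convergence along sequences, which suffices because the parameter is real.
\<close>

lemma continuous_integral:
  fixes k :: "real \<Rightarrow> real \<Rightarrow> complex"
  assumes m: "\<And>s. k s \<in> borel_measurable lborel"
    and c: "\<And>x. continuous_on UNIV (\<lambda>s. k s x)"
    and bd: "\<And>s x. norm (k s x) \<le> w x" and w: "integrable lborel w"
  shows "continuous_on UNIV (\<lambda>s. LINT x|lborel. k s x)"
  unfolding continuous_on_eq_continuous_at[OF open_UNIV] continuous_at_sequentially o_def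
proof (intro ballI allI impI)
  fix s :: real and S :: "nat \<Rightarrow> real"
  assume S: "S \<longlonglongrightarrow> s"
  show "(\<lambda>n. LINT x|lborel. k (S n) x) \<longlonglongrightarrow> (LINT x|lborel. k s x)"
  proof (rule integral_dominated_convergence[where w = w])
    show "AE x in lborel. (\<lambda>n. k (S n) x) \<longlonglongrightarrow> k s x"
      using c S by (auto intro!: AE_I2 continuous_on_tendsto_compose[where f="\<lambda>s. k s _" and s=UNIV])
  qed (use m w bd in auto)
qed

lemma continuous_on_cis_comp [continuous_intros]:
  fixes f :: "'a :: topological_space \<Rightarrow> real"
  assumes "continuous_on A f" shows "continuous_on A (\<lambda>x. cis (f x))"
  unfolding cis_conv_exp using assms by (intro continuous_intros)

lemma continuous_ft:
  assumes f: "integrable lborel f"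
  shows "continuous_on UNIV (ft f)"
  unfolding ft_def
proof (rule continuous_integral[where w = "\<lambda>x. norm (f x)"])
  show "continuous_on UNIV (\<lambda>s. cis (- (s * x)) * f x)" for x
    by (intro continuous_intros)
qed (use integrable_cis_minus_mult[OF f] f in \<open>auto simp: norm_mult\<close>)

lemma continuous_conv:
  assumes f: "continuous_on UNIV f" and b: "\<And>x. norm (f x) \<le> B" and g: "integrable lborel g"
  shows "continuous_on UNIV (conv f g)"
  unfolding conv_def
proof (rule continuous_integral[where w = "\<lambda>x. B * norm (g x)"])
  have [measurable]: "f \<in> borel_measurable borel" "g \<in> borel_measurable borel"
    using f g by (auto dest: borel_measurable_integrable intro: borel_measurable_continuous_onI)
  show "(\<lambda>y. f (x - y) * g y) \<in> borel_measurable lborel" for x by measurable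
  show "continuous_on UNIV (\<lambda>s. f (s - x) * g x)" for x
    by (intro continuous_intros continuous_on_compose2[OF f]) auto
  show "norm (f (s - x) * g x) \<le> B * norm (g x)" for s x
    by (simp add: norm_mult mult_right_mono b)
qed (use g in auto)

lemma norm_conv_le:
  assumes b: "\<And>x. norm (f x) \<le> B" and g: "integrable lborel g"
  shows "norm (conv f g x) \<le> B * (LINT y|lborel. norm (g y))"
proof -
  have "0 \<le> B" using b[of 0] norm_ge_zero order_trans by blast
  have "norm (conv f g x) \<le> (LINT y|lborel. norm (f (x - y) * g y))"
    unfolding conv_def by (rule integral_norm_bound)
  also have "\<dots> \<le> (LINT y|lborel. B * norm (g y))"
    by (rule integral_mono') (use b g \<open>0 \<le> B\<close> in \<open>auto simp: norm_mult mult_right_mono\<close>)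
  finally have "norm (conv f g x) \<le> (LINT y|lborel. B * norm (g y))" .
  then show ?thesis by simp
qed

lemma has_vector_derivative_iff_tendsto_quotient:
  fixes f :: "real \<Rightarrow> complex"
  shows "(f has_vector_derivative d) (at x) \<longleftrightarrow> ((\<lambda>t. (f t - f x) /\<^sub>R (t - x)) \<longlongrightarrow> d) (at x)"
proof -
  have "norm (f t - f x - (t - x) *\<^sub>R d) / norm (t - x) = norm ((f t - f x) /\<^sub>R (t - x) - d)"
    if "t \<noteq> x" for t
  proof -
    have "(f t - f x) /\<^sub>R (t - x) - d = (f t - f x - (t - x) *\<^sub>R d) /\<^sub>R (t - x)"
      using that by (simp add: scaleR_diff_right)
    then show ?thesis by (simp add: divide_inverse mult.commute)
  qed
  then have "(f has_vector_derivative d) (at x) \<longleftrightarrow>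
      ((\<lambda>t. norm ((f t - f x) /\<^sub>R (t - x) - d)) \<longlongrightarrow> 0) (at x)"
    unfolding has_vector_derivative_def has_derivative_iff_norm
    by (auto simp: bounded_linear_scaleR_left eventually_at_filter intro!: filterlim_cong
        intro: iffD1[OF filterlim_cong, rotated -1])
  also have "\<dots> \<longleftrightarrow> ((\<lambda>t. (f t - f x) /\<^sub>R (t - x) - d) \<longlongrightarrow> 0) (at x)"
    by (rule tendsto_norm_zero_iff)
  also have "\<dots> \<longleftrightarrow> ((\<lambda>t. (f t - f x) /\<^sub>R (t - x)) \<longlongrightarrow> d) (at x)"
    by (simp add: LIM_zero_iff)
  finally show ?thesis .
qed

lemma norm_diff_le_of_deriv_bound:
  fixes f :: "real \<Rightarrow> complex"
  assumes d: "\<And>s. (f has_vector_derivative f' s) (at s)" and b: "\<And>s. norm (f' s) \<le> B"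
  shows "norm (f t - f s) \<le> B * \<bar>t - s\<bar>"
proof -
  have "norm (f t - f s) \<le> B * norm (t - s)"
  proof (rule differentiable_bound[of UNIV f "\<lambda>s h. h *\<^sub>R f' s"])
    show "onorm (\<lambda>h. h *\<^sub>R f' s) \<le> B" for s
      using b[of s] by (simp add: onorm_scaleR_left onorm_id)
  qed (use d in \<open>auto simp: has_vector_derivative_def\<close>)
  then show ?thesis by simp
qed

text \<open>
  Differentiation under the integral sign: by the mean value inequality, the difference quotients
  are dominated by the same \<open>w\<close> that dominates the derivative.
\<close>

lemma has_vector_derivative_integral:
  fixes k :: "real \<Rightarrow> real \<Rightarrow> complex"
  assumes i: "\<And>s. integrable lborel (k s)"
    and d: "\<And>s x. ((\<lambda>s. k s x) has_vector_derivative k' s x) (at s)"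
    and m: "\<And>s. k' s \<in> borel_measurable lborel"
    and bd: "\<And>s x. norm (k' s x) \<le> w x" and w: "integrable lborel w"
  shows "((\<lambda>s. LINT x|lborel. k s x) has_vector_derivative (LINT x|lborel. k' s x)) (at s)"
  unfolding has_vector_derivative_iff_tendsto_quotient tendsto_at_iff_sequentially o_def
proof (intro allI impI)
  fix S :: "nat \<Rightarrow> real"
  assume S: "\<forall>n. S n \<in> UNIV - {s}" "S \<longlonglongrightarrow> s"
  have "((LINT x|lborel. k (S n) x) - (LINT x|lborel. k s x)) /\<^sub>R (S n - s)
      = (LINT x|lborel. (k (S n) x - k s x) /\<^sub>R (S n - s))" for n
    using i by (simp add: Bochner_Integration.integral_diff)
  moreover have "(\<lambda>n. LINT x|lborel. (k (S n) x - k s x) /\<^sub>R (S n - s)) \<longlonglongrightarrow> (LINT x|lborel. k' s x)"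
  proof (rule integral_dominated_convergence[where w = w])
    show "AE x in lborel. (\<lambda>n. (k (S n) x - k s x) /\<^sub>R (S n - s)) \<longlonglongrightarrow> k' s x"
      using d[of _ s] S unfolding has_vector_derivative_iff_tendsto_quotient tendsto_at_iff_sequentially o_def
      by (intro AE_I2) auto
    show "AE x in lborel. norm ((k (S n) x - k s x) /\<^sub>R (S n - s)) \<le> w x" for n
    proof (rule AE_I2)
      fix x
      have "norm (k (S n) x - k s x) \<le> w x * \<bar>S n - s\<bar>"
        by (rule norm_diff_le_of_deriv_bound[OF d bd])
      then show "norm ((k (S n) x - k s x) /\<^sub>R (S n - s)) \<le> w x"
        using S(1) by (simp add: pos_divide_le_eq divide_inverse_commute [symmetric])
    qed
    show "(\<lambda>x. (k (S n) x - k s x) /\<^sub>R (S n - s)) \<in> borel_measurable lborel" for n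
      using i by (auto dest: borel_measurable_integrable intro!: borel_measurable_scaleR borel_measurable_diff)
  qed (use m w in auto)
  ultimately show "(\<lambda>n. ((LINT x|lborel. k (S n) x) - (LINT x|lborel. k s x)) /\<^sub>R (S n - s)) \<longlonglongrightarrow> (LINT x|lborel. k' s x)"
    by (simp only:)
qed

text \<open>
  Convolving \<open>F'\<close> with the indicator of \<open>[-1, 0]\<close> gives \<open>F (x + 1) - F x\<close>, whose integral vanishes by
  translation invariance. On the other hand the integral of a convolution is the product of the
  integrals, and the indicator has integral 1. This avoids discussing limits of \<open>F\<close> at infinity.
\<close>

lemma integral_deriv_eq_0:
  fixes F :: "real \<Rightarrow> complex"
  assumes d: "\<And>x. (F has_vector_derivative F' x) (at x)" and c: "continuous_on UNIV F'"
    and F: "integrable lborel F" and F': "integrable lborel F'"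
  shows "(LINT x|lborel. F' x) = 0"
proof -
  define J :: "real \<Rightarrow> complex" where "J = indicator {-1..0}"
  have J: "integrable lborel J" unfolding J_def
    using integrable_of_real[OF integrable_real_indicator[of "{-1..0::real}" lborel], where 'a = complex]
    by (simp add: of_real_indicator)
  have cvJ: "conv F' J x = F (x + 1) - F x" for x
  proof -
    have "conv F' J x = (LINT y|lborel. F' (x - (x - y)) * J (x - y))"
      unfolding conv_def using integral_lborel_reflect_shift[of "\<lambda>y. F' (x - y) * J y" x] by simp
    also have "\<dots> = (LINT y|lborel. indicator {x..x+1} y *\<^sub>R F' y)"
      by (rule Bochner_Integration.integral_cong) (auto simp: J_def indicator_def)
    also have "\<dots> = F (x + 1) - F x"
      by (rule integral_FTC_atLeastAtMost)
         (use d c in \<open>auto intro: has_vector_derivative_at_within continuous_on_subset\<close>)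
    finally show ?thesis .
  qed
  then have "ft (conv F' J) 0 = (LINT x|lborel. F (x + 1) - F x)"
    by (simp add: ft_def)
  also have "\<dots> = 0"
    using F integrable_lborel_shift(3)[OF F, of 1] integral_lborel_shift(2)[of F 1] by simp
  finally have "ft F' 0 * ft J 0 = 0" using ft_conv[OF F' J] by simp
  moreover have "ft J 0 = 1"
  proof -
    have "ft J 0 = (LINT x|lborel. complex_of_real (indicator {-1..0::real} x))"
      unfolding of_real_indicator by (simp add: ft_def J_def)
    also have "\<dots> = 1" by (subst integral_complex_of_real) simp
    finally show ?thesis .
  qed
  ultimately show ?thesis by (simp add: ft_def)
qed

lemma has_vector_derivative_cis:
  "((\<lambda>x. cis (a * x)) has_vector_derivative \<i> * of_real a * cis (a * x)) (at x within A)"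
  by (auto intro!: derivative_eq_intros simp: has_vector_derivative_complex_iff)

text \<open>
  Integration by parts in the form \<open>integral_deriv_eq_0\<close>, applied to \<open>F\<close> times a character.
\<close>

lemma ft_deriv:
  fixes F :: "real \<Rightarrow> complex"
  assumes d: "\<And>x. (F has_vector_derivative F' x) (at x)" and c: "continuous_on UNIV F'"
    and F: "integrable lborel F" and F': "integrable lborel F'"
  shows "ft F' s = \<i> * of_real s * ft F s"
proof -
  have cF: "continuous_on UNIV F"
    using d by (meson continuous_at_imp_continuous_on has_vector_derivative_continuous)
  have "(LINT x|lborel. cis (- (s * x)) * F' x - \<i> * of_real s * (cis (- (s * x)) * F x)) = 0"
  proof (rule integral_deriv_eq_0)
    show "((\<lambda>x. cis (- (s * x)) * F x) has_vector_derivative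
        cis (- (s * x)) * F' x - \<i> * of_real s * (cis (- (s * x)) * F x)) (at x)" for x
      using has_vector_derivative_mult[OF has_vector_derivative_cis[of "-s" x UNIV] d[of x]]
      by (simp add: algebra_simps)
    show "continuous_on UNIV (\<lambda>x. cis (- (s * x)) * F' x - \<i> * of_real s * (cis (- (s * x)) * F x))"
      by (intro continuous_intros c cF)
  qed (use integrable_cis_minus_mult[OF F] integrable_cis_minus_mult[OF F'] F in simp_all)
  then show ?thesis
    using integrable_cis_minus_mult[OF F] integrable_cis_minus_mult[OF F']
    by (simp add: ft_def)
qed

section \<open>Gaussian smoothing and Fourier inversion\<close>

definition gauss :: "real \<Rightarrow> real \<Rightarrow> complex" where
  "gauss \<sigma> x = of_real (normal_density 0 \<sigma> x)"

lemma integrable_gauss: "\<sigma> > 0 \<Longrightarrow> integrable lborel (gauss \<sigma>)"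
  unfolding gauss_def by (intro integrable_of_real integrable_normal_density)

lemma normal_density_scale:
  "\<sigma> > 0 \<Longrightarrow> normal_density 0 \<sigma> (\<sigma> * x) = std_normal_density x / \<sigma>"
  by (simp add: normal_density_def real_sqrt_mult power_mult_distrib)

lemma gauss_scale:
  assumes "\<sigma> > 0"
  shows "\<bar>\<sigma>\<bar> *\<^sub>R (a * gauss \<sigma> (\<sigma> * x)) = std_normal_density x *\<^sub>R a"
  using assms unfolding gauss_def normal_density_scale[OF assms]
  by (simp add: scaleR_conv_of_real)

lemma ft_gauss:
  assumes "\<sigma> > 0"
  shows "ft (gauss \<sigma>) s = of_real (exp (- (\<sigma> * s)\<^sup>2 / 2))"
proof -
  have "char std_normal_distribution (- (\<sigma> * s))
      = (LINT x|lborel. std_normal_density x *\<^sub>R cis (- (\<sigma> * s) * x))"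
    unfolding char_def cis_conv_exp by (subst integral_density) auto
  then have *: "(LINT x|lborel. std_normal_density x *\<^sub>R cis (- (\<sigma> * s) * x))
      = of_real (exp (- (\<sigma> * s)\<^sup>2 / 2))"
    by (simp add: char_std_normal_distribution)
  have "ft (gauss \<sigma>) s = \<bar>\<sigma>\<bar> *\<^sub>R (LINT x|lborel. cis (- (s * (\<sigma> * x))) * gauss \<sigma> (\<sigma> * x))"
    unfolding ft_def using assms lborel_integral_real_affine[of \<sigma> "\<lambda>x. cis (- (s * x)) * gauss \<sigma> x" 0] by simp
  also have "\<dots> = (LINT x|lborel. std_normal_density x *\<^sub>R cis (- (\<sigma> * s) * x))"
    unfolding integral_scaleR_right [symmetric] gauss_scale[OF assms] by (simp add: mult_ac)
  finally show ?thesis using * by simp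
qed

text \<open>
  The transform of a Gaussian is a Gaussian of inverse width, so the weight
  \<open>exp (- (\<sigma> s)\<^sup>2 / 2)\<close> is a multiple of \<open>gauss (1 / \<sigma>)\<close> and \<open>ft_gauss\<close> applies to it.
\<close>

lemma integral_cis_exp_square:
  assumes "\<sigma> > 0"
  shows "(LINT s|lborel. cis (s * w) * of_real (exp (- (\<sigma> * s)\<^sup>2 / 2))) = 2 * pi * gauss \<sigma> w"
proof -
  have "exp (- (\<sigma> * s)\<^sup>2 / 2) = sqrt (2 * pi) / \<sigma> * normal_density 0 (1 / \<sigma>) s" for s
    using assms by (simp add: normal_density_def power_mult_distrib real_sqrt_divide field_simps)
  then have "(LINT s|lborel. cis (s * w) * of_real (exp (- (\<sigma> * s)\<^sup>2 / 2)))
      = (LINT s|lborel. of_real (sqrt (2 * pi) / \<sigma>) * (cis (- (- w * s)) * gauss (1 / \<sigma>) s))"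
    by (intro Bochner_Integration.integral_cong) (auto simp: gauss_def mult_ac)
  also have "\<dots> = of_real (sqrt (2 * pi) / \<sigma>) * ft (gauss (1 / \<sigma>)) (- w)"
    unfolding ft_def by simp
  also have "ft (gauss (1 / \<sigma>)) (- w) = of_real (exp (- (1 / \<sigma> * - w)\<^sup>2 / 2))"
    using assms by (subst ft_gauss) auto
  also have "of_real (sqrt (2 * pi) / \<sigma>) * \<dots> = 2 * pi * gauss \<sigma> w"
  proof -
    have "sqrt (2 * pi) * sqrt (2 * pi) = 2 * pi" by simp
    then have "sqrt (2 * pi) / \<sigma> * exp (- (1 / \<sigma> * - w)\<^sup>2 / 2) = 2 * pi * normal_density 0 \<sigma> w"
      using assms by (simp add: normal_density_def power_mult_distrib real_sqrt_mult field_simps)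
    then show ?thesis unfolding gauss_def of_real_mult [symmetric] by simp
  qed
  finally show ?thesis .
qed

lemma integrable_exp_square:
  assumes "\<sigma> > 0"
  shows "integrable lborel (\<lambda>s. complex_of_real (exp (- (\<sigma> * s)\<^sup>2 / 2)))"
proof -
  have "exp (- (\<sigma> * s)\<^sup>2 / 2) = sqrt (2 * pi) / \<sigma> * normal_density 0 (1 / \<sigma>) s" for s
    using assms by (simp add: normal_density_def power_mult_distrib real_sqrt_divide field_simps)
  then have "(\<lambda>s. complex_of_real (exp (- (\<sigma> * s)\<^sup>2 / 2))) = (\<lambda>s. of_real (sqrt (2 * pi) / \<sigma>) * gauss (1 / \<sigma>) s)"
    by (simp add: gauss_def fun_eq_iff)
  then show ?thesis using integrable_gauss[of "1 / \<sigma>"] assms by simp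
qed

text \<open>
  Fourier inversion with a Gaussian weight. The weight makes the double integral absolutely
  convergent, so this is Fubini's theorem and holds for every integrable \<open>f\<close>; both the inversion
  theorem and the injectivity of the transform come out of it.
\<close>

lemma conv_gauss_eq:
  assumes f: "integrable lborel f" and \<sigma>: "\<sigma> > 0"
  shows "2 * pi * conv (gauss \<sigma>) f x
      = (LINT s|lborel. cis (s * x) * ft f s * of_real (exp (- (\<sigma> * s)\<^sup>2 / 2)))"
proof -
  have [measurable]: "f \<in> borel_measurable borel" using f by (auto dest: borel_measurable_integrable)
  let ?e = "\<lambda>s. complex_of_real (exp (- (\<sigma> * s)\<^sup>2 / 2))"
  have "integrable (lborel \<Otimes>\<^sub>M lborel) (\<lambda>(y, s). cis (s * (x - y)) * ?e s * f y)"
  proof (rule lborel_pair.Fubini_integrable)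
    show "(\<lambda>(y, s). cis (s * (x - y)) * ?e s * f y) \<in> borel_measurable (lborel \<Otimes>\<^sub>M lborel)"
      by measurable
    show "integrable lborel (\<lambda>y. LINT s|lborel. norm (case (y, s) of (y, s) \<Rightarrow> cis (s * (x - y)) * ?e s * f y))"
      using f by (simp add: norm_mult)
    show "AE y in lborel. integrable lborel (\<lambda>s. case (y, s) of (y, s) \<Rightarrow> cis (s * (x - y)) * ?e s * f y)"
      using integrable_cis_mult[OF integrable_exp_square[OF \<sigma>]]
      by (auto simp: mult.commute[of "_ :: real" "x - _"] intro!: AE_I2)
  qed
  note I = lborel_pair.Fubini_integral[OF this]
  have "2 * pi * conv (gauss \<sigma>) f x = (LINT y|lborel. (2 * pi * gauss \<sigma> (x - y)) * f y)"
    unfolding conv_def by (subst integral_mult_right_zero [symmetric]) (simp add: mult_ac)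
  also have "\<dots> = (LINT y|lborel. LINT s|lborel. cis (s * (x - y)) * ?e s * f y)"
    unfolding integral_cis_exp_square[OF \<sigma>, symmetric] by simp
  also have "\<dots> = (LINT s|lborel. LINT y|lborel. cis (s * (x - y)) * ?e s * f y)"
    using I by simp
  also have "\<dots> = (LINT s|lborel. cis (s * x) * ft f s * ?e s)"
  proof (rule Bochner_Integration.integral_cong)
    fix s
    have "cis (s * (x - y)) * ?e s * f y = cis (s * x) * ?e s * (cis (- (s * y)) * f y)" for y
      using cis_mult_shift[of "-s" x "- y"] by (simp add: mult_ac)
    then have "(LINT y|lborel. cis (s * (x - y)) * ?e s * f y)
        = cis (s * x) * ?e s * (LINT y|lborel. cis (- (s * y)) * f y)"
      by (simp only: integral_mult_right_zero)
    then show "(LINT y|lborel. cis (s * (x - y)) * ?e s * f y) = cis (s * x) * ft f s * ?e s"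
      by (simp only: ft_def mult_ac)
  qed simp
  finally show ?thesis .
qed

lemma conv_gauss_scale:
  assumes \<sigma>: "\<sigma> > 0"
  shows "conv (gauss \<sigma>) f x = (LINT z|lborel. std_normal_density z *\<^sub>R f (x - \<sigma> * z))"
proof -
  have "conv (gauss \<sigma>) f x = (LINT y|lborel. f (x - y) * gauss \<sigma> y)"
    by (subst conv_commute) (simp add: conv_def)
  also have "\<dots> = \<bar>\<sigma>\<bar> *\<^sub>R (LINT z|lborel. f (x - \<sigma> * z) * gauss \<sigma> (\<sigma> * z))"
    using lborel_integral_real_affine[of \<sigma> "\<lambda>y. f (x - y) * gauss \<sigma> y" 0] \<sigma> by simp
  also have "\<dots> = (LINT z|lborel. std_normal_density z *\<^sub>R f (x - \<sigma> * z))"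
    unfolding integral_scaleR_right [symmetric] gauss_scale[OF \<sigma>] ..
  finally show ?thesis .
qed

lemma conv_gauss_tendsto:
  assumes f: "continuous_on UNIV f" and b: "\<And>x. norm (f x) \<le> B"
  shows "(\<lambda>n. conv (gauss (1 / real (Suc n))) f x) \<longlonglongrightarrow> f x"
proof -
  have [measurable]: "f \<in> borel_measurable borel" using f by (rule borel_measurable_continuous_onI)
  have "(\<lambda>n. LINT z|lborel. std_normal_density z *\<^sub>R f (x - 1 / real (Suc n) * z))
      \<longlonglongrightarrow> (LINT z|lborel. std_normal_density z *\<^sub>R f x)"
  proof (rule integral_dominated_convergence[where w = "\<lambda>z. B * std_normal_density z"])
    have "(\<lambda>n. f (x - 1 / real (Suc n) * z)) \<longlonglongrightarrow> f x" for z
    proof (rule continuous_on_tendsto_compose[OF f])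
      have "(\<lambda>n. x - 1 / real (Suc n) * z) \<longlonglongrightarrow> x - 0 * z"
        by (intro tendsto_intros LIMSEQ_inverse_real_of_nat[unfolded inverse_eq_divide])
      then show "(\<lambda>n. x - 1 / real (Suc n) * z) \<longlonglongrightarrow> x" by simp
    qed auto
    then show "AE z in lborel. (\<lambda>n. std_normal_density z *\<^sub>R f (x - 1 / real (Suc n) * z))
        \<longlonglongrightarrow> std_normal_density z *\<^sub>R f x"
      by (intro AE_I2 tendsto_intros)
    show "AE z in lborel. norm (std_normal_density z *\<^sub>R f (x - 1 / real (Suc n) * z)) \<le> B * std_normal_density z" for n
      using b by (auto simp: mult.commute[of B] intro!: mult_left_mono)
    show "(\<lambda>z. std_normal_density z *\<^sub>R f x) \<in> borel_measurable lborel" by measurable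
    show "(\<lambda>z. std_normal_density z *\<^sub>R f (x - 1 / real (Suc n) * z)) \<in> borel_measurable lborel" for n
      by measurable
  qed auto
  moreover have "(LINT z|lborel. std_normal_density z *\<^sub>R f x) = f x"
    by (subst integral_scaleR_left) auto
  ultimately show ?thesis by (simp add: conv_gauss_scale)
qed

text \<open>
  The limit \<open>\<sigma> \<rightarrow> 0\<close> in \<open>conv_gauss_eq\<close>: the smoothed function converges to \<open>f\<close> by continuity and
  boundedness, the weighted integral converges by domination with \<open>ft f\<close>.
\<close>

theorem fourier_inversion:
  fixes f :: "real \<Rightarrow> complex"
  assumes f: "continuous_on UNIV f" "\<And>x. norm (f x) \<le> B" "integrable lborel f"
    and F: "integrable lborel (ft f)"
  shows "2 * pi * f x = ft (ft f) (- x)"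
proof (rule LIMSEQ_unique)
  have [measurable]: "ft f \<in> borel_measurable borel" using F by (auto dest: borel_measurable_integrable)
  let ?s = "\<lambda>n. 1 / real (Suc n)"
  show "(\<lambda>n. 2 * pi * conv (gauss (?s n)) f x) \<longlonglongrightarrow> 2 * pi * f x"
    by (intro tendsto_intros conv_gauss_tendsto[OF f(1,2)])
  have "(\<lambda>n. LINT s|lborel. cis (s * x) * ft f s * of_real (exp (- (?s n * s)\<^sup>2 / 2))) \<longlonglongrightarrow> (LINT s|lborel. cis (s * x) * ft f s)"
  proof (rule integral_dominated_convergence[where w = "\<lambda>s. norm (ft f s)"])
    show "AE s in lborel. (\<lambda>n. cis (s * x) * ft f s * of_real (exp (- (?s n * s)\<^sup>2 / 2))) \<longlonglongrightarrow> cis (s * x) * ft f s"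
    proof (rule AE_I2)
      fix s
      have "(\<lambda>n. cis (s * x) * ft f s * of_real (exp (- (?s n * s)\<^sup>2 / 2))) \<longlonglongrightarrow> cis (s * x) * ft f s * of_real (exp (- (0 * s)\<^sup>2 / 2))"
        by (intro tendsto_intros LIMSEQ_inverse_real_of_nat[unfolded inverse_eq_divide]) auto
      then show "(\<lambda>n. cis (s * x) * ft f s * of_real (exp (- (?s n * s)\<^sup>2 / 2))) \<longlonglongrightarrow> cis (s * x) * ft f s" by simp
    qed
    show "AE s in lborel. norm (cis (s * x) * ft f s * of_real (exp (- (?s n * s)\<^sup>2 / 2))) \<le> norm (ft f s)" for n
      by (rule AE_I2) (simp add: norm_mult mult_left_le)
    show "(\<lambda>s. cis (s * x) * ft f s * of_real (exp (- (?s n * s)\<^sup>2 / 2))) \<in> borel_measurable lborel" for n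
      by measurable
  qed (use F in auto)
  then show "(\<lambda>n. 2 * pi * conv (gauss (?s n)) f x) \<longlonglongrightarrow> ft (ft f) (- x)"
    using conv_gauss_eq[OF f(3)] by (simp add: ft_def [of "ft f"] mult.commute[of _ x])
qed

section \<open>The algebra of Fourier transforms\<close>

text \<open>
  The Banach algebra of Fourier transforms of integrable functions, with the norm transported from
  \<open>L\<^sub>1\<close>. Stating membership and norm bound in one relation lets algebra be done with functions of
  the frequency alone.
\<close>

definition wiener_norm_le :: "(real \<Rightarrow> complex) \<Rightarrow> real \<Rightarrow> bool" where
  "wiener_norm_le \<Phi> c \<longleftrightarrow>
     (\<exists>f. integrable lborel f \<and> ft f = \<Phi> \<and> (LINT x|lborel. norm (f x)) \<le> c)"

lemma wiener_norm_leI: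
  "integrable lborel f \<Longrightarrow> ft f = \<Phi> \<Longrightarrow> (LINT x|lborel. norm (f x)) \<le> c \<Longrightarrow> wiener_norm_le \<Phi> c"
  unfolding wiener_norm_le_def by blast

lemma wiener_norm_le_mono: "wiener_norm_le \<Phi> c \<Longrightarrow> c \<le> d \<Longrightarrow> wiener_norm_le \<Phi> d"
  unfolding wiener_norm_le_def using order_trans by blast

lemma wiener_norm_le_cmult:
  assumes "wiener_norm_le \<Phi> c"
  shows "wiener_norm_le (\<lambda>s. a * \<Phi> s) (norm a * c)"
proof -
  obtain f where f: "integrable lborel f" "ft f = \<Phi>" "(LINT x|lborel. norm (f x)) \<le> c"
    using assms by (auto simp: wiener_norm_le_def)
  show ?thesis
    by (rule wiener_norm_leI[of "\<lambda>x. a * f x"])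
       (use f in \<open>auto simp: ft_cmult fun_eq_iff norm_mult mult_left_mono\<close>)
qed

lemma wiener_norm_le_add:
  assumes "wiener_norm_le \<Phi> c" "wiener_norm_le \<Psi> d"
  shows "wiener_norm_le (\<lambda>s. \<Phi> s + \<Psi> s) (c + d)"
proof -
  obtain f where f: "integrable lborel f" "ft f = \<Phi>" "(LINT x|lborel. norm (f x)) \<le> c"
    using assms by (auto simp: wiener_norm_le_def)
  obtain g where g: "integrable lborel g" "ft g = \<Psi>" "(LINT x|lborel. norm (g x)) \<le> d"
    using assms by (auto simp: wiener_norm_le_def)
  show ?thesis
  proof (rule wiener_norm_leI[of "\<lambda>x. f x + g x"])
    have "(LINT x|lborel. norm (f x + g x)) \<le> (LINT x|lborel. norm (f x) + norm (g x))"
      by (rule integral_mono) (use f g in \<open>auto intro: norm_triangle_ineq\<close>)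
    then show "(LINT x|lborel. norm (f x + g x)) \<le> c + d"
      using f g by simp
  qed (use f g in \<open>auto simp: ft_add fun_eq_iff\<close>)
qed

lemma wiener_norm_le_mult:
  assumes "wiener_norm_le \<Phi> c" "wiener_norm_le \<Psi> d"
  shows "wiener_norm_le (\<lambda>s. \<Phi> s * \<Psi> s) (c * d)"
proof -
  obtain f where f: "integrable lborel f" "ft f = \<Phi>" "(LINT x|lborel. norm (f x)) \<le> c"
    using assms by (auto simp: wiener_norm_le_def)
  obtain g where g: "integrable lborel g" "ft g = \<Psi>" "(LINT x|lborel. norm (g x)) \<le> d"
    using assms by (auto simp: wiener_norm_le_def)
  have "0 \<le> c"
    by (rule order_trans[OF _ f(3)]) simp
  then have "(LINT x|lborel. norm (f x)) * (LINT x|lborel. norm (g x)) \<le> c * d"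
    using f(3) g(3) by (intro mult_mono) auto
  then show ?thesis
    using L1_norm_conv_le[OF f(1) g(1)]
    by (intro wiener_norm_leI[of "conv f g"]) (use f g in \<open>auto simp: ft_conv fun_eq_iff integrable_conv\<close>)
qed

lemma wiener_norm_le_power:
  assumes "wiener_norm_le \<Phi> c"
  shows "wiener_norm_le (\<lambda>s. \<Phi> s ^ Suc n) (c ^ Suc n)"
  by (induction n) (use assms wiener_norm_le_mult[OF assms] in auto)

text \<open>
  Completeness of the algebra, for absolutely convergent series: the preimages can be summed
  pointwise almost everywhere, and the sum may be integrated term by term.
\<close>

lemma wiener_norm_le_suminf:
  assumes w: "\<And>n. wiener_norm_le (\<Phi> n) (c n)" and c: "summable c"
  shows "wiener_norm_le (\<lambda>s. \<Sum>n. \<Phi> n s) (suminf c)"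
proof -
  have "\<forall>n. \<exists>f. integrable lborel f \<and> ft f = \<Phi> n \<and> (LINT x|lborel. norm (f x)) \<le> c n"
    using w by (simp add: wiener_norm_le_def)
  then obtain f where f: "\<And>n. integrable lborel (f n)" "\<And>n. ft (f n) = \<Phi> n"
    "\<And>n. (LINT x|lborel. norm (f n x)) \<le> c n"
    by metis
  have nn: "0 \<le> (LINT x|lborel. norm (f n x))" for n by simp
  have sm: "summable (\<lambda>n. LINT x|lborel. norm (f n x))"
    by (rule summable_comparison_test'[OF c, of 0]) (use f(3) nn in auto)
  define N where "N x = (\<Sum>n. ennreal (norm (f n x)))" for x
  have [measurable]: "f n \<in> borel_measurable borel" for n using f(1)[of n] by (auto dest: borel_measurable_integrable)
  have "(\<integral>\<^sup>+x. N x \<partial>lborel) = (\<Sum>n. \<integral>\<^sup>+x. norm (f n x) \<partial>lborel)"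
    unfolding N_def by (rule nn_integral_suminf) measurable
  also have "\<dots> = (\<Sum>n. ennreal (LINT x|lborel. norm (f n x)))"
    using f(1) by (intro suminf_cong nn_integral_eq_integral) auto
  also have "\<dots> < \<infinity>"
    using ennreal_suminf_neq_top[OF sm nn] by (simp add: top.not_eq_extremum)
  finally have "AE x in lborel. N x \<noteq> \<infinity>"
    by (intro nn_integral_noteq_infinite) (auto simp: N_def)
  then have ae: "AE x in lborel. summable (\<lambda>n. norm (f n x))"
    by eventually_elim (auto simp: N_def intro: summable_suminf_not_top)
  show ?thesis
  proof (rule wiener_norm_leI)
    show "integrable lborel (\<lambda>x. \<Sum>n. f n x)"
      by (rule integrable_suminf[OF f(1) ae sm])
    show "ft (\<lambda>x. \<Sum>n. f n x) = (\<lambda>s. \<Sum>n. \<Phi> n s)"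
    proof
      fix s
      have *: "AE x in lborel. summable (\<lambda>n. norm (cis (- (s * x)) * f n x))"
        using ae by (simp add: norm_mult)
      have **: "summable (\<lambda>n. LINT x|lborel. norm (cis (- (s * x)) * f n x))"
        using sm by (simp add: norm_mult)
      have "(LINT x|lborel. (\<Sum>n. cis (- (s * x)) * f n x)) = (\<Sum>n. \<Phi> n s)"
        using integral_suminf[OF integrable_cis_minus_mult[OF f(1)] * **]
        by (simp add: f(2)[symmetric] ft_def)
      moreover have "(LINT x|lborel. (\<Sum>n. cis (- (s * x)) * f n x)) = ft (\<lambda>x. \<Sum>n. f n x) s"
        unfolding ft_def
      proof (rule integral_cong_AE)
        show "AE x in lborel. (\<Sum>n. cis (- (s * x)) * f n x) = cis (- (s * x)) * (\<Sum>n. f n x)"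
          using ae by eventually_elim (simp add: suminf_mult summable_norm_cancel)
      qed measurable
      ultimately show "ft (\<lambda>x. \<Sum>n. f n x) s = (\<Sum>n. \<Phi> n s)" by simp
    qed
    have "(LINT x|lborel. norm (\<Sum>n. f n x)) \<le> (LINT x|lborel. (\<Sum>n. norm (f n x)))"
    proof (rule integral_mono_AE)
      show "integrable lborel (\<lambda>x. norm (\<Sum>n. f n x))"
        using integrable_suminf[OF f(1) ae sm] by simp
      show "integrable lborel (\<lambda>x. \<Sum>n. norm (f n x))"
        by (rule integrable_suminf) (use f(1) ae sm in auto)
      show "AE x in lborel. norm (\<Sum>n. f n x) \<le> (\<Sum>n. norm (f n x))"
        using ae by eventually_elim (rule summable_norm)
    qed
    also have "\<dots> = (\<Sum>n. LINT x|lborel. norm (f n x))"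
      by (rule integral_suminf) (use f(1) ae sm in auto)
    also have "\<dots> \<le> suminf c"
      by (rule suminf_le) (use f(3) sm c in auto)
    finally show "(LINT x|lborel. norm (\<Sum>n. f n x)) \<le> suminf c" .
  qed
qed

lemma integrable_inverse_1_plus_square_lborel: "integrable lborel (\<lambda>x::real. inverse (1 + x\<^sup>2))"
  and integral_inverse_1_plus_square_lborel: "(LINT x|lborel. inverse (1 + x\<^sup>2)) = pi"
  using integrable_inverse_1_plus_square LBINT_inverse_1_plus_square
  by (auto simp: set_integrable_def interval_lebesgue_integral_def set_lebesgue_integral_def)

text \<open>
  Two derivatives of \<open>\<Phi>\<close> give the bound \<open>A / (1 + s\<^sup>2)\<close> for its transform, which is therefore
  integrable; by inversion \<open>\<Phi>\<close> is the transform of the reflected transform over \<open>2 * pi\<close>. The constant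
  1/2 is the integral \<open>pi\<close> of \<open>1 / (1 + s\<^sup>2)\<close> divided by \<open>2 * pi\<close>.
\<close>

lemma wiener_norm_le_smooth:
  assumes d1: "\<And>x. (\<Phi> has_vector_derivative \<Phi>' x) (at x)"
    and d2: "\<And>x. (\<Phi>' has_vector_derivative \<Phi>'' x) (at x)"
    and c: "continuous_on UNIV \<Phi>''" and b: "\<And>x. norm (\<Phi> x) \<le> B"
    and i: "integrable lborel \<Phi>" "integrable lborel \<Phi>'" "integrable lborel \<Phi>''"
  shows "wiener_norm_le \<Phi> (((LINT x|lborel. norm (\<Phi> x)) + (LINT x|lborel. norm (\<Phi>'' x))) / 2)"
proof -
  define A where "A = (LINT x|lborel. norm (\<Phi> x)) + (LINT x|lborel. norm (\<Phi>'' x))"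
  have cont: "continuous_on UNIV \<Phi>" "continuous_on UNIV \<Phi>'"
    using d1 d2 by (meson continuous_at_imp_continuous_on has_vector_derivative_continuous)+
  have bd: "norm (ft \<Phi> s) \<le> A * inverse (1 + s\<^sup>2)" for s
  proof -
    have "ft \<Phi>'' s = \<i> * of_real s * (\<i> * of_real s * ft \<Phi> s)"
      using ft_deriv[OF d2 c i(2,3)] ft_deriv[OF d1 cont(2) i(1,2)] by simp
    also have "\<dots> = - of_real (s\<^sup>2) * ft \<Phi> s" by (simp add: power2_eq_square algebra_simps)
    finally have "of_real (1 + s\<^sup>2) * ft \<Phi> s = ft \<Phi> s - ft \<Phi>'' s"
      by (simp add: algebra_simps)
    then have "norm (of_real (1 + s\<^sup>2) * ft \<Phi> s) \<le> norm (ft \<Phi> s) + norm (ft \<Phi>'' s)"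
      by (metis norm_triangle_ineq4)
    also have "\<dots> \<le> A" unfolding A_def by (intro add_mono norm_ft_le i)
    finally have "norm (of_real (1 + s\<^sup>2) * ft \<Phi> s) \<le> A" .
    moreover have "norm (complex_of_real (1 + s\<^sup>2)) = 1 + s\<^sup>2"
      by (subst norm_of_real) simp
    moreover have "1 + s\<^sup>2 > 0" by (rule add_pos_nonneg) auto
    ultimately show ?thesis by (simp only: norm_mult) (simp add: field_simps)
  qed
  have iA: "integrable lborel (\<lambda>s. A * inverse (1 + s\<^sup>2))"
    using integrable_inverse_1_plus_square_lborel by (rule integrable_mult_right)
  have iF: "integrable lborel (ft \<Phi>)"
  proof (rule Bochner_Integration.integrable_bound[OF iA])
    show "ft \<Phi> \<in> borel_measurable lborel"
      using continuous_ft[OF i(1)] borel_measurable_continuous_onI by auto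
    show "AE s in lborel. norm (ft \<Phi> s) \<le> norm (A * inverse (1 + s\<^sup>2))"
    proof (rule AE_I2)
      show "norm (ft \<Phi> s) \<le> norm (A * inverse (1 + s\<^sup>2))" for s
        using order_trans[OF bd[of s] abs_ge_self] by (simp only: real_norm_def)
    qed
  qed
  define f where "f x = 1 / (2 * pi) * ft \<Phi> (- x)" for x
  have "ft f s = \<Phi> s" for s
  proof -
    have "ft f s = 1 / (2 * pi) * ft (ft \<Phi>) (- s)"
      unfolding f_def by (simp only: ft_cmult ft_reflect)
    then show ?thesis
      using fourier_inversion[OF cont(1) b i(1) iF, of s, symmetric] by simp
  qed
  moreover have "integrable lborel f"
    unfolding f_def by (intro integrable_mult_right integrable_lborel_shift(4) iF)
  moreover have "(LINT x|lborel. norm (f x)) \<le> A / 2"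
  proof -
    have "(LINT x|lborel. norm (ft \<Phi> x)) \<le> (LINT x|lborel. A * inverse (1 + x\<^sup>2))"
      by (rule integral_mono) (use iF iA bd in auto)
    also have "\<dots> = A * pi"
      using integral_inverse_1_plus_square_lborel by simp
    finally have "(LINT x|lborel. norm (ft \<Phi> x)) \<le> A * pi" .
    moreover have "(LINT x|lborel. norm (f x)) = 1 / (2 * pi) * (LINT x|lborel. norm (ft \<Phi> x))"
      using integral_lborel_shift(3)[of "\<lambda>x. norm (ft \<Phi> x)"] by (simp add: f_def norm_mult norm_divide)
    ultimately have "pi * (2 * (LINT x|lborel. norm (f x))) \<le> pi * A"
      by (simp add: field_simps)
    then show ?thesis by simp
  qed
  ultimately show ?thesis
    by (intro wiener_norm_leI[of f]) (auto simp: A_def)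
qed

section \<open>Density of smooth functions and injectivity of the transform\<close>

lemma integrable_compact_support:
  fixes c :: "real \<Rightarrow> complex"
  assumes c: "continuous_on UNIV c" and R: "\<And>x. \<bar>x\<bar> > R \<Longrightarrow> c x = 0"
  shows "integrable lborel c"
proof -
  have "integrable lborel (\<lambda>x. indicator {-R..R} x *\<^sub>R c x)"
    by (rule borel_integrable_compact) (auto intro: continuous_on_subset[OF c])
  moreover have "(\<lambda>x. indicator {-R..R} x *\<^sub>R c x) = c"
    using R by (auto simp: fun_eq_iff indicator_def abs_real_def)
  ultimately show ?thesis by simp
qed

lemma integrable_cmult_indicator_Icc:
  "integrable lborel (\<lambda>x. C * indicator {a..b::real} x :: real)"
  by (intro integrable_mult_right integrable_real_indicator) (auto simp: emeasure_lborel_Icc_eq)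

lemma bounded_of_bounded_outside:
  fixes c :: "real \<Rightarrow> complex"
  assumes c: "continuous_on UNIV c" and R: "\<And>x. \<bar>x\<bar> > R \<Longrightarrow> norm (c x) \<le> B"
  obtains M where "\<And>x. norm (c x) \<le> M"
proof -
  have "compact (c ` {-R..R})"
    by (intro compact_continuous_image continuous_on_subset[OF c]) auto
  then obtain M where M: "\<forall>y \<in> c ` {-R..R}. norm y \<le> M"
    using compact_imp_bounded bounded_iff by metis
  have "norm (c x) \<le> max M B" for x
  proof (cases "\<bar>x\<bar> > R")
    case True
    then show ?thesis using R[OF True] by simp
  next
    case False
    then have "norm (c x) \<le> M" using M by (auto simp: abs_real_def split: if_splits)
    then show ?thesis by simp
  qed
  then show ?thesis using that by blast
qed

lemma bounded_compact_support:
  fixes c :: "real \<Rightarrow> complex"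
  assumes c: "continuous_on UNIV c" and R: "\<And>x. \<bar>x\<bar> > R \<Longrightarrow> c x = 0"
  obtains M where "\<And>x. norm (c x) \<le> M"
proof -
  have "norm (c x) \<le> 0" if "\<bar>x\<bar> > R" for x using R[OF that] by simp
  from bounded_of_bounded_outside[OF c this] show ?thesis using that by blast
qed

lemma tendsto_0_imp_ex_less:
  fixes a :: "nat \<Rightarrow> real"
  assumes "a \<longlonglongrightarrow> 0" "e > 0"
  obtains n where "a n < e"
  using eventually_happens[OF order_tendstoD(2)[OF assms]] by auto

text \<open>
  A measurable function is almost everywhere a limit of continuous functions. To have this limit
  in \<open>L\<^sub>1\<close>, the approximants are truncated in size and cut off in space by continuous operations; the
  same operations applied to \<open>f\<close> change it little.
\<close>

lemma L1_approx_continuous: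
  fixes f :: "real \<Rightarrow> complex"
  assumes f: "integrable lborel f" and e: "e > 0"
  obtains c R where "continuous_on UNIV c" "\<And>x. \<bar>x\<bar> > R \<Longrightarrow> c x = 0"
    "(LINT x|lborel. norm (f x - c x)) < e"
proof -
  \<comment> \<open>Truncation in size to the disc of radius \<open>r\<close>, and a cutoff in space that is 1 on \<open>[-r, r]\<close>.\<close>
  define tr where "tr r z = (r / max r (norm z)) *\<^sub>R (z :: complex)" for r :: real and z
  define co where "co r x = max 0 (min 1 (r + 1 - \<bar>x\<bar>))" for r x :: real
  have tr_cont: "continuous_on UNIV (tr r)" if "r > 0" for r
    unfolding tr_def using that by (intro continuous_intros) (auto simp: max_def)
  have co_cont: "continuous_on UNIV (co r)" for r
    unfolding co_def by (intro continuous_intros)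
  have tr_le: "norm (tr r z) \<le> r" "norm (tr r z) \<le> norm z" if "r > 0" for r z
    using that by (auto simp: tr_def max_def field_simps split: if_splits)
  have co_le: "0 \<le> co r x" "co r x \<le> 1" for r x by (auto simp: co_def)
  have [measurable]: "f \<in> borel_measurable borel" using f by (auto dest: borel_measurable_integrable)
  have co_m [measurable]: "co r \<in> borel_measurable borel" for r
    by (rule borel_measurable_continuous_onI[OF co_cont])
  have tr_m: "tr (real (Suc n)) \<in> borel_measurable borel" for n
    by (rule borel_measurable_continuous_onI[OF tr_cont]) simp
  note [measurable] = tr_m
  define F where "F n x = co (real (Suc n)) x *\<^sub>R tr (real (Suc n)) (f x)" for n x
  have tF: "(\<lambda>n. LINT x|lborel. norm (f x - F n x)) \<longlonglongrightarrow> 0"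
  proof (rule L1_dominated_convergence[where w = "\<lambda>x. norm (f x)"])
    show "AE x in lborel. (\<lambda>n. F n x) \<longlonglongrightarrow> f x"
    proof (rule AE_I2, rule tendsto_eventually)
      fix x
      obtain N :: nat where N: "max \<bar>x\<bar> (norm (f x)) \<le> real N" using real_arch_simple by blast
      have "F n x = f x" if "n \<ge> N" for n
        using that N by (auto simp: F_def co_def tr_def)
      then show "eventually (\<lambda>n. F n x = f x) sequentially"
        unfolding eventually_sequentially by blast
    qed
    show "AE x in lborel. norm (F n x) \<le> norm (f x)" for n
    proof (rule AE_I2)
      fix x
      have "norm (F n x) \<le> 1 * norm (tr (real (Suc n)) (f x))"
        unfolding F_def norm_scaleR using co_le[of "real (Suc n)" x] by (intro mult_right_mono) auto
      then show "norm (F n x) \<le> norm (f x)" using tr_le(2)[of "real (Suc n)" "f x"] by simp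
    qed
    show "F n \<in> borel_measurable lborel" for n unfolding F_def by measurable
  qed (use f in auto)
  have e2: "e / 2 > 0" using e by simp
  obtain n where n: "(LINT x|lborel. norm (f x - F n x)) < e / 2"
    by (rule tendsto_0_imp_ex_less[OF tF e2])
  define r where "r = real (Suc n)"
  have r: "r > 0" by (simp add: r_def)
  \<comment> \<open>The function \<open>F n\<close> is bounded with bounded support, so its continuous analogues \<open>G k\<close> converge in \<open>L\<^sub>1\<close> by domination.\<close>
  have "f \<in> borel_measurable lebesgue" by (rule measurable_completion) simp
  then have "f measurable_on UNIV" by (rule lebesgue_measurable_imp_measurable_on) simp
  then obtain N g where N: "negligible N" and g: "\<And>k. continuous_on UNIV (g k)"
    and lim: "\<And>x. x \<notin> N \<Longrightarrow> (\<lambda>k. g k x) \<longlonglongrightarrow> f x"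
    unfolding measurable_on_def by auto
  define G where "G k x = co r x *\<^sub>R tr r (g k x)" for k x
  have G_cont: "continuous_on UNIV (G k)" for k
    unfolding G_def using r
    by (intro continuous_intros co_cont continuous_on_compose2[OF tr_cont g]) auto
  have G_supp: "G k x = 0" if "\<bar>x\<bar> > r + 1" for k x
    using that by (simp add: G_def co_def)
  have F_m: "F n \<in> borel_measurable lborel" unfolding F_def by measurable
  have F_int: "integrable lborel (F n)"
  proof (rule Bochner_Integration.integrable_bound[OF f F_m], rule AE_I2)
    fix x
    have "norm (F n x) \<le> 1 * norm (tr (real (Suc n)) (f x))"
      unfolding F_def norm_scaleR using co_le[of "real (Suc n)" x] by (intro mult_right_mono) auto
    then show "norm (F n x) \<le> norm (f x)" using tr_le(2)[of "real (Suc n)" "f x"] by simp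
  qed
  have tG: "(\<lambda>k. LINT x|lborel. norm (F n x - G k x)) \<longlonglongrightarrow> 0"
  proof (rule L1_dominated_convergence[where w = "\<lambda>x. r * indicator {-(r+1)..r+1} x"])
    have "AE x in lborel. x \<notin> N"
      using N by (simp add: negligible_iff_null_sets null_sets_completion_iff AE_not_in
          AE_completion_iff[of _ lborel, symmetric])
    then show "AE x in lborel. (\<lambda>k. G k x) \<longlonglongrightarrow> F n x"
    proof eventually_elim
      case (elim x)
      then show ?case
        unfolding G_def F_def r_def [symmetric]
        by (intro tendsto_intros continuous_on_tendsto_compose[OF tr_cont[OF r] lim]) auto
    qed
    show "AE x in lborel. norm (G k x) \<le> r * indicator {-(r+1)..r+1} x" for k
    proof (rule AE_I2)
      fix x
      have "norm (G k x) \<le> 1 * r"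
        unfolding G_def norm_scaleR using co_le[of r x] tr_le(1)[OF r] by (intro mult_mono) auto
      then show "norm (G k x) \<le> r * indicator {-(r+1)..r+1} x"
        using G_supp[of x k] by (auto simp: indicator_def abs_real_def)
    qed
    show "G k \<in> borel_measurable lborel" for k
      using borel_measurable_continuous_onI[OF G_cont] by simp
    show "integrable lborel (\<lambda>x. r * indicator {-(r+1)..r+1} x)"
      by (rule integrable_cmult_indicator_Icc)
  qed (use F_m in auto)
  obtain k where k: "(LINT x|lborel. norm (F n x - G k x)) < e / 2"
    by (rule tendsto_0_imp_ex_less[OF tG e2])
  have G_int: "integrable lborel (G k)"
    by (rule integrable_compact_support[OF G_cont G_supp])
  have "(LINT x|lborel. norm (f x - G k x)) \<le> (LINT x|lborel. norm (f x - F n x) + norm (F n x - G k x))"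
    by (rule integral_mono) (use f F_int G_int dist_triangle[of "f _" "G k _" "F n _", unfolded dist_norm] in auto)
  also have "\<dots> = (LINT x|lborel. norm (f x - F n x)) + (LINT x|lborel. norm (F n x - G k x))"
    using f F_int G_int by simp
  also have "\<dots> < e" using n k by simp
  finally show ?thesis using that G_cont G_supp by blast
qed

lemma L1_translation_tendsto_0:
  fixes c :: "real \<Rightarrow> complex"
  assumes c: "continuous_on UNIV c" and R: "\<And>x. \<bar>x\<bar> > R \<Longrightarrow> c x = 0"
    and t: "t \<longlonglongrightarrow> 0" "\<And>n. \<bar>t n\<bar> \<le> T"
  shows "(\<lambda>n. LINT x|lborel. norm (c x - c (x - t n))) \<longlonglongrightarrow> 0"
proof -
  have [measurable]: "c \<in> borel_measurable borel" using c by (rule borel_measurable_continuous_onI)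
  obtain M where M: "\<And>x. norm (c x) \<le> M" using bounded_compact_support[OF c R] by blast
  have cM: "norm (c x) \<le> \<bar>M\<bar>" for x using M[of x] by simp
  show ?thesis
  proof (rule L1_dominated_convergence[where w = "\<lambda>x. \<bar>M\<bar> * indicator {-(R+T)..R+T} x"])
    show "AE x in lborel. norm (c (x - t n)) \<le> \<bar>M\<bar> * indicator {-(R+T)..R+T} x" for n
    proof (rule AE_I2)
      fix x
      show "norm (c (x - t n)) \<le> \<bar>M\<bar> * indicator {-(R+T)..R+T} x"
      proof (cases "x \<in> {-(R+T)..R+T}")
        case False
        then have "\<bar>x - t n\<bar> > R" using t(2)[of n] by (auto simp: abs_real_def split: if_splits)
        then show ?thesis using False R by simp
      qed (use cM in simp)
    qed
    show "AE x in lborel. (\<lambda>n. c (x - t n)) \<longlonglongrightarrow> c x"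
    proof (rule AE_I2)
      fix x
      have "(\<lambda>n. x - t n) \<longlonglongrightarrow> x - 0" by (intro tendsto_intros t)
      then show "(\<lambda>n. c (x - t n)) \<longlonglongrightarrow> c x"
        by (intro continuous_on_tendsto_compose[OF c]) auto
    qed
    show "integrable lborel (\<lambda>x. \<bar>M\<bar> * indicator {-(R+T)..R+T} x)"
      by (rule integrable_cmult_indicator_Icc)
  qed auto
qed

text \<open>
  The smoothing error is an average, with the standard normal density as weight, of the \<open>L\<^sub>1\<close>
  distances \<open>\<omega> (\<sigma> z)\<close> between \<open>c\<close> and its translates. These are bounded and tend to 0 with \<open>\<sigma>\<close>.
\<close>

lemma L1_gauss_tendsto_0:
  fixes c :: "real \<Rightarrow> complex"
  assumes c: "continuous_on UNIV c" and R: "\<And>x. \<bar>x\<bar> > R \<Longrightarrow> c x = 0"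
  shows "(\<lambda>n. LINT x|lborel. norm (c x - conv (gauss (1 / real (Suc n))) c x)) \<longlonglongrightarrow> 0"
proof -
  have [measurable]: "c \<in> borel_measurable borel" using c by (rule borel_measurable_continuous_onI)
  have ci: "integrable lborel c" by (rule integrable_compact_support[OF c R])
  define \<omega> where "\<omega> t = (LINT x|lborel. norm (c x - c (x - t)))" for t
  define C where "C = (LINT x|lborel. norm (c x))"
  have [measurable]: "\<omega> \<in> borel_measurable borel" unfolding \<omega>_def by measurable
  have \<omega>0: "0 \<le> \<omega> t" for t by (simp add: \<omega>_def)
  have \<omega>: "\<omega> t \<le> 2 * C" for t
  proof -
    have "\<omega> t \<le> (LINT x|lborel. norm (c x) + norm (c (x - t)))"
      unfolding \<omega>_def using ci integrable_lborel_shift(2)[OF ci]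
      by (intro integral_mono) (auto intro: norm_triangle_ineq4)
    also have "\<dots> = 2 * C"
      using ci integrable_lborel_shift(2)[OF ci, of t] integral_lborel_shift(1)[of "\<lambda>x. norm (c x)" t]
      by (simp add: C_def)
    finally show ?thesis .
  qed
  let ?s = "\<lambda>n. 1 / real (Suc n)"
  let ?\<phi> = std_normal_density
  have bound: "(LINT x|lborel. norm (c x - conv (gauss (?s n)) c x)) \<le> (LINT z|lborel. ?\<phi> z * \<omega> (?s n * z))" for n
  proof -
    have int\<omega>: "integrable lborel (\<lambda>z. ?\<phi> z * \<omega> (?s n * z))"
    proof (rule Bochner_Integration.integrable_bound)
      show "integrable lborel (\<lambda>z. 2 * C * ?\<phi> z)" by simp
      show "AE z in lborel. norm (?\<phi> z * \<omega> (?s n * z)) \<le> norm (2 * C * ?\<phi> z)"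
      proof (rule AE_I2)
        fix z
        have "?\<phi> z * \<omega> (?s n * z) \<le> ?\<phi> z * (2 * C)" by (intro mult_left_mono \<omega>) simp
        moreover have "0 \<le> ?\<phi> z * \<omega> (?s n * z)" using \<omega>0 by simp
        ultimately show "norm (?\<phi> z * \<omega> (?s n * z)) \<le> norm (2 * C * ?\<phi> z)"
          by (simp add: mult.commute)
      qed
    qed measurable
    have int2: "integrable (lborel \<Otimes>\<^sub>M lborel) (\<lambda>(z, x). ?\<phi> z * norm (c x - c (x - ?s n * z)))"
    proof (rule lborel_pair.Fubini_integrable)
      show "integrable lborel (\<lambda>z. LINT x|lborel. norm (case (z, x) of (z, x) \<Rightarrow> ?\<phi> z * norm (c x - c (x - ?s n * z))))"
        using int\<omega> by (simp add: \<omega>_def abs_mult)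
      show "AE z in lborel. integrable lborel (\<lambda>x. case (z, x) of (z, x) \<Rightarrow> ?\<phi> z * norm (c x - c (x - ?s n * z)))"
        using ci integrable_lborel_shift(2)[OF ci] by (intro AE_I2) auto
    qed measurable
    have s0: "0 < ?s n" by simp
    have "(LINT x|lborel. norm (c x - conv (gauss (?s n)) c x))
        \<le> (LINT x|lborel. LINT z|lborel. ?\<phi> z * norm (c x - c (x - ?s n * z)))"
    proof (rule integral_mono)
      show "integrable lborel (\<lambda>x. norm (c x - conv (gauss (?s n)) c x))"
        using ci integrable_conv[OF integrable_gauss[OF s0] ci] by simp
      show "integrable lborel (\<lambda>x. LINT z|lborel. ?\<phi> z * norm (c x - c (x - ?s n * z)))"
        using lborel_pair.integrable_snd[OF int2] .
      fix x
      obtain B where B: "\<And>y. norm (c y) \<le> B" using bounded_compact_support[OF c R] by blast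
      have i1: "integrable lborel (\<lambda>z. ?\<phi> z *\<^sub>R c (x - ?s n * z))"
      proof (rule Bochner_Integration.integrable_bound)
        show "integrable lborel (\<lambda>z. B * ?\<phi> z)" by simp
        show "AE z in lborel. norm (?\<phi> z *\<^sub>R c (x - ?s n * z)) \<le> norm (B * ?\<phi> z)"
        proof (rule AE_I2)
          fix z
          have "norm (?\<phi> z *\<^sub>R c (x - ?s n * z)) = norm (c (x - ?s n * z)) * ?\<phi> z" by simp
          also have "\<dots> \<le> B * ?\<phi> z" by (intro mult_right_mono B) simp
          also have "\<dots> \<le> norm (B * ?\<phi> z)" by simp
          finally show "norm (?\<phi> z *\<^sub>R c (x - ?s n * z)) \<le> norm (B * ?\<phi> z)" .
        qed
      qed measurable
      have "c x - conv (gauss (?s n)) c x = (LINT z|lborel. ?\<phi> z *\<^sub>R c x) - (LINT z|lborel. ?\<phi> z *\<^sub>R c (x - ?s n * z))"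
        by (subst integral_scaleR_left) (auto simp: conv_gauss_scale)
      also have "\<dots> = (LINT z|lborel. ?\<phi> z *\<^sub>R (c x - c (x - ?s n * z)))"
        using i1 by (simp add: scaleR_diff_right)
      finally have "norm (c x - conv (gauss (?s n)) c x) \<le> (LINT z|lborel. norm (?\<phi> z *\<^sub>R (c x - c (x - ?s n * z))))"
        by (simp only: integral_norm_bound)
      then show "norm (c x - conv (gauss (?s n)) c x) \<le> (LINT z|lborel. ?\<phi> z * norm (c x - c (x - ?s n * z)))"
        by simp
    qed
    also have "\<dots> = (LINT z|lborel. LINT x|lborel. ?\<phi> z * norm (c x - c (x - ?s n * z)))"
      using lborel_pair.Fubini_integral[OF int2] by simp
    also have "\<dots> = (LINT z|lborel. ?\<phi> z * \<omega> (?s n * z))"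
      by (simp add: \<omega>_def)
    finally show ?thesis .
  qed
  have "(\<lambda>n. LINT z|lborel. ?\<phi> z * \<omega> (?s n * z)) \<longlonglongrightarrow> (LINT z|(lborel :: real measure). 0)"
  proof (rule integral_dominated_convergence[where w = "\<lambda>z. 2 * C * ?\<phi> z"])
    show "AE z in lborel. (\<lambda>n. ?\<phi> z * \<omega> (?s n * z)) \<longlonglongrightarrow> 0"
    proof (rule AE_I2)
      fix z
      have "(\<lambda>n. ?s n * z) \<longlonglongrightarrow> 0 * z"
        by (intro tendsto_intros LIMSEQ_inverse_real_of_nat[unfolded inverse_eq_divide])
      then have "(\<lambda>n. \<omega> (?s n * z)) \<longlonglongrightarrow> 0"
        unfolding \<omega>_def by (intro L1_translation_tendsto_0[OF c R, where T = "\<bar>z\<bar>"])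
          (auto simp: abs_mult divide_simps mult_le_cancel_left1)
      then show "(\<lambda>n. ?\<phi> z * \<omega> (?s n * z)) \<longlonglongrightarrow> 0" by (rule tendsto_mult_right_zero)
    qed
    show "AE z in lborel. norm (?\<phi> z * \<omega> (?s n * z)) \<le> 2 * C * ?\<phi> z" for n
    proof (rule AE_I2)
      fix z
      have "?\<phi> z * \<omega> (?s n * z) \<le> ?\<phi> z * (2 * C)" by (intro mult_left_mono \<omega>) simp
      then show "norm (?\<phi> z * \<omega> (?s n * z)) \<le> 2 * C * ?\<phi> z"
        using \<omega>0[of "?s n * z"] by (simp add: mult_ac abs_mult)
    qed
  qed auto
  then have "(\<lambda>n. LINT z|lborel. ?\<phi> z * \<omega> (?s n * z)) \<longlonglongrightarrow> 0" by simp
  then show ?thesis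
    by (rule tendsto_sandwich[OF _ _ tendsto_const, rotated 2]) (use bound in auto)
qed

lemma L1_approx_gauss:
  fixes f :: "real \<Rightarrow> complex"
  assumes f: "integrable lborel f" and e: "e > 0"
  obtains c R \<sigma> where "continuous_on UNIV c" "\<And>x. \<bar>x\<bar> > R \<Longrightarrow> c x = 0" "\<sigma> > 0"
    "(LINT x|lborel. norm (f x - c x)) < e" "(LINT x|lborel. norm (f x - conv (gauss \<sigma>) c x)) < e"
proof -
  have e2: "e / 2 > 0" using e by simp
  obtain c R where c: "continuous_on UNIV c" "\<And>x. \<bar>x\<bar> > R \<Longrightarrow> c x = 0"
    and fc: "(LINT x|lborel. norm (f x - c x)) < e / 2"
    by (rule L1_approx_continuous[OF f e2]) (rule that)
  have ci: "integrable lborel c" by (rule integrable_compact_support[OF c])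
  obtain n where n: "(LINT x|lborel. norm (c x - conv (gauss (1 / real (Suc n))) c x)) < e / 2"
    by (rule tendsto_0_imp_ex_less[OF L1_gauss_tendsto_0[OF c] e2])
  let ?g = "conv (gauss (1 / real (Suc n))) c"
  have gi: "integrable lborel ?g" by (rule integrable_conv[OF integrable_gauss ci]) simp
  have "(LINT x|lborel. norm (f x - ?g x)) \<le> (LINT x|lborel. norm (f x - c x) + norm (c x - ?g x))"
    by (rule integral_mono) (use f ci gi dist_triangle[of "f _" "?g _" "c _", unfolded dist_norm] in auto)
  also have "\<dots> = (LINT x|lborel. norm (f x - c x)) + (LINT x|lborel. norm (c x - ?g x))"
    using f ci gi by simp
  also have "\<dots> < e" using fc n by simp
  finally have g: "(LINT x|lborel. norm (f x - ?g x)) < e" .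
  show ?thesis
  proof (rule that)
    show "1 / real (Suc n) > 0" by simp
    show "(LINT x|lborel. norm (f x - c x)) < e" using fc e by linarith
  qed (fact c g)+
qed

lemma integrable_bounded_mult:
  fixes f g :: "real \<Rightarrow> complex"
  assumes [measurable]: "f \<in> borel_measurable borel" and b: "\<And>x. norm (f x) \<le> B"
    and g: "integrable lborel g"
  shows "integrable lborel (\<lambda>y. f (x - y) * g y)"
proof (rule Bochner_Integration.integrable_bound)
  have [measurable]: "g \<in> borel_measurable borel" using g by (auto dest: borel_measurable_integrable)
  show "(\<lambda>y. f (x - y) * g y) \<in> borel_measurable lborel" by measurable
  show "integrable lborel (\<lambda>y. B * norm (g y))" using g by simp
  show "AE y in lborel. norm (f (x - y) * g y) \<le> norm (B * norm (g y))"
  proof (rule AE_I2)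
    fix y
    have "norm (f (x - y) * g y) \<le> B * norm (g y)" by (simp add: norm_mult mult_right_mono b)
    then show "norm (f (x - y) * g y) \<le> norm (B * norm (g y))"
      unfolding real_norm_def by (rule order_trans[OF _ abs_ge_self])
  qed
qed

lemma norm_gauss_le:
  "norm (gauss \<sigma> x) \<le> 1 / sqrt (2 * pi * \<sigma>\<^sup>2)"
proof -
  have "norm (gauss \<sigma> x) = 1 / sqrt (2 * pi * \<sigma>\<^sup>2) * exp (- (x\<^sup>2 / (2 * \<sigma>\<^sup>2)))"
    unfolding gauss_def norm_of_real by (simp add: normal_density_def)
  also have "\<dots> \<le> 1 / sqrt (2 * pi * \<sigma>\<^sup>2) * 1"
    by (intro mult_left_mono) auto
  finally show ?thesis by simp
qed

text \<open>
  If the transform of \<open>f\<close> vanishes, so does every Gaussian smoothing of \<open>f\<close>, by \<open>conv_gauss_eq\<close>. But \<open>f\<close> is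
  close in \<open>L\<^sub>1\<close> to a function that is hardly changed by a suitable smoothing, and smoothing does not
  increase the \<open>L\<^sub>1\<close> norm; hence \<open>f\<close> has norm 0.
\<close>

theorem ft_eq_0_imp_AE_0:
  assumes f: "integrable lborel f" and z: "\<And>s. ft f s = 0"
  shows "AE x in lborel. f x = 0"
proof -
  have "(LINT x|lborel. norm (f x)) \<le> e" if "e > 0" for e
  proof -
    have e2: "e / 2 > 0" using that by simp
    obtain c R \<sigma> where c: "continuous_on UNIV c" "\<And>x. \<bar>x\<bar> > R \<Longrightarrow> c x = 0" "\<sigma> > 0"
      and fc: "(LINT x|lborel. norm (f x - c x)) < e / 2"
      and fg: "(LINT x|lborel. norm (f x - conv (gauss \<sigma>) c x)) < e / 2"
      by (rule L1_approx_gauss[OF f e2]) (rule that)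
    have ci: "integrable lborel c" by (rule integrable_compact_support[OF c(1,2)])
    have gi: "integrable lborel (gauss \<sigma>)" by (rule integrable_gauss[OF c(3)])
    have fci: "integrable lborel (\<lambda>x. f x - c x)" using f ci by simp
    have gci: "integrable lborel (conv (gauss \<sigma>) c)" by (rule integrable_conv[OF gi ci])
    have g_meas: "gauss \<sigma> \<in> borel_measurable borel" using gi by (auto dest: borel_measurable_integrable)
    note ib = integrable_bounded_mult[OF g_meas norm_gauss_le]
    have "conv (gauss \<sigma>) f x = 0" for x
      using conv_gauss_eq[OF f c(3), of x] by (simp add: z)
    moreover have "conv (gauss \<sigma>) (\<lambda>x. f x - c x) x = conv (gauss \<sigma>) f x - conv (gauss \<sigma>) c x" for x
      unfolding conv_def using ib[OF f] ib[OF ci] by (simp add: right_diff_distrib)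
    ultimately have eq: "norm (conv (gauss \<sigma>) (\<lambda>x. f x - c x) x) = norm (conv (gauss \<sigma>) c x)" for x
      by simp
    have "(LINT x|lborel. norm (gauss \<sigma> x)) = 1"
      using c(3) by (simp add: gauss_def)
    then have "(LINT x|lborel. norm (conv (gauss \<sigma>) c x)) < e / 2"
      using L1_norm_conv_le[OF gi fci] fc by (simp add: eq)
    moreover have "(LINT x|lborel. norm (f x)) \<le> (LINT x|lborel. norm (f x - conv (gauss \<sigma>) c x) + norm (conv (gauss \<sigma>) c x))"
    proof (rule integral_mono)
      show "norm (f x) \<le> norm (f x - conv (gauss \<sigma>) c x) + norm (conv (gauss \<sigma>) c x)" for x
        using norm_triangle_ineq[of "f x - conv (gauss \<sigma>) c x" "conv (gauss \<sigma>) c x"] by simp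
    qed (use f gci in auto)
    moreover have "\<dots> = (LINT x|lborel. norm (f x - conv (gauss \<sigma>) c x)) + (LINT x|lborel. norm (conv (gauss \<sigma>) c x))"
      using f gci by simp
    ultimately show ?thesis using fg by linarith
  qed
  then have "(LINT x|lborel. norm (f x)) \<le> 0" by (rule field_le_epsilon[of _ 0, simplified])
  then have "(LINT x|lborel. norm (f x)) = 0" by (simp add: antisym)
  then show ?thesis using f by (simp add: integral_nonneg_eq_0_iff_AE)
qed

lemma has_vector_derivative_ft:
  assumes c: "integrable lborel c" and xc: "integrable lborel (\<lambda>x. of_real x * c x)"
  shows "(ft c has_vector_derivative ft (\<lambda>x. - (\<i> * (of_real x * c x))) s) (at s)"
  unfolding ft_def
proof (rule has_vector_derivative_integral[where w = "\<lambda>x. norm (of_real x * c x)"])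
  show "integrable lborel (\<lambda>x. cis (- (s * x)) * c x)" for s
    by (rule integrable_cis_minus_mult[OF c])
  show "((\<lambda>s. cis (- (s * x)) * c x) has_vector_derivative cis (- (s * x)) * - (\<i> * (of_real x * c x))) (at s)" for s x
    using has_vector_derivative_mult_left[OF has_vector_derivative_cis[of "- x" s UNIV], of "c x"]
    by (simp add: mult_ac)
  show "(\<lambda>x. cis (- (s * x)) * - (\<i> * (of_real x * c x))) \<in> borel_measurable lborel" for s
    using integrable_cis_minus_mult[OF integrable_mult_right[OF xc, of "-\<i>"], of s]
    by (auto dest: borel_measurable_integrable)
qed (use integrable_norm[OF xc] in \<open>auto simp: norm_mult\<close>)

text \<open>
  With \<open>u = (\<sigma> s)\<^sup>2 / 2\<close> and \<open>s\<^sup>2 = a u\<close> this compares \<open>(1 + a u)\<^sup>2\<close> with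
  \<open>exp u \<ge> 1 + u + u\<^sup>2 / 2\<close>.
\<close>

lemma exp_square_decay:
  fixes \<sigma> :: real
  assumes "\<sigma> > 0"
  defines "a \<equiv> 2 / \<sigma>\<^sup>2"
  shows "exp (- (\<sigma> * s)\<^sup>2 / 2) * (1 + s\<^sup>2) \<le> (1 + 2 * a + 2 * a\<^sup>2) / (1 + s\<^sup>2)"
proof -
  define u where "u = (\<sigma> * s)\<^sup>2 / 2"
  have a: "a \<ge> 0" and u: "u \<ge> 0" by (simp_all add: a_def u_def)
  have s2: "s\<^sup>2 = a * u" using assms(1) by (simp add: a_def u_def power_mult_distrib)
  have "(1 + a * u)\<^sup>2 \<le> (1 + 2 * a + 2 * a\<^sup>2) * (1 + u + u\<^sup>2 / 2)"
  proof -
    have "(1 + 2 * a + 2 * a\<^sup>2) * (1 + u + u\<^sup>2 / 2) - (1 + a * u)\<^sup>2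
        = u + u\<^sup>2 / 2 + 2 * a + a * u\<^sup>2 + 2 * a\<^sup>2 + 2 * a\<^sup>2 * u"
      by (simp add: power2_eq_square algebra_simps)
    moreover have "\<dots> \<ge> 0" using a u by (intro add_nonneg_nonneg mult_nonneg_nonneg) auto
    ultimately show ?thesis by linarith
  qed
  also have "\<dots> \<le> (1 + 2 * a + 2 * a\<^sup>2) * exp u"
    using a by (intro mult_left_mono exp_lower_Taylor_quadratic u add_nonneg_nonneg) auto
  finally have le: "(1 + s\<^sup>2)\<^sup>2 \<le> (1 + 2 * a + 2 * a\<^sup>2) * exp u" unfolding s2 .
  have "1 + s\<^sup>2 > 0" by (rule add_pos_nonneg) auto
  then have "exp (- u) * (1 + s\<^sup>2) \<le> (1 + 2 * a + 2 * a\<^sup>2) / (1 + s\<^sup>2)"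
    using le by (simp add: exp_minus field_simps power2_eq_square)
  then show ?thesis by (simp add: u_def)
qed

text \<open>
  The dense class on which the reciprocal can be estimated by calculus. For \<open>c\<close> continuous with
  compact support, \<open>ft c\<close> has bounded derivatives of all orders, and smoothing \<open>c\<close> by a Gaussian
  multiplies \<open>ft c\<close> by a Gaussian, which supplies the decay.
\<close>

lemma L1_approx_smooth_ft:
  assumes g: "integrable lborel g" and e: "e > 0"
  obtains p P' P'' K where "integrable lborel p" "(LINT x|lborel. norm (g x - p x)) < e"
    "\<And>s. (ft p has_vector_derivative P' s) (at s)"
    "\<And>s. (P' has_vector_derivative P'' s) (at s)" "continuous_on UNIV P''" "K \<ge> 0"
    "\<And>s. norm (ft p s) \<le> K / (1 + s\<^sup>2)" "\<And>s. norm (P' s) \<le> K / (1 + s\<^sup>2)"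
    "\<And>s. norm (P'' s) \<le> K / (1 + s\<^sup>2)"
proof -
  obtain c R \<sigma> where c: "continuous_on UNIV c" "\<And>x. \<bar>x\<bar> > R \<Longrightarrow> c x = 0" "\<sigma> > 0"
    and gc: "(LINT x|lborel. norm (g x - conv (gauss \<sigma>) c x)) < e"
    by (rule L1_approx_gauss[OF g e]) (rule that)
  define c1 where "c1 x = - (\<i> * (of_real x * c x))" for x :: real
  define c2 where "c2 x = - (\<i> * (of_real x * c1 x))" for x :: real
  have ci: "integrable lborel c" by (rule integrable_compact_support[OF c(1,2)])
  have c1i: "integrable lborel c1" "integrable lborel (\<lambda>x. of_real x * c x)"
    by (rule integrable_compact_support[where R = R]; use c in \<open>auto simp: c1_def intro!: continuous_intros\<close>)+
  have c2i: "integrable lborel c2" "integrable lborel (\<lambda>x. of_real x * c1 x)"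
    by (rule integrable_compact_support[where R = R]; use c in \<open>auto simp: c2_def c1_def intro!: continuous_intros\<close>)+
  have gi: "integrable lborel (gauss \<sigma>)" by (rule integrable_gauss[OF c(3)])
  have dC: "(ft c has_vector_derivative ft c1 s) (at s)" for s
    using has_vector_derivative_ft[OF ci c1i(2)] by (simp add: c1_def [abs_def])
  have dC1: "(ft c1 has_vector_derivative ft c2 s) (at s)" for s
    using has_vector_derivative_ft[OF c1i(1) c2i(2)] by (simp add: c2_def [abs_def])
  define E where "E s = exp (- (\<sigma> * s)\<^sup>2 / 2)" for s
  define E1 where "E1 s = - \<sigma>\<^sup>2 * s * E s" for s
  define E2 where "E2 s = (\<sigma>^4 * s\<^sup>2 - \<sigma>\<^sup>2) * E s" for s
  have dE: "(E has_real_derivative E1 s) (at s)" for s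
    unfolding E_def [abs_def] E1_def
    by (auto intro!: derivative_eq_intros simp: power2_eq_square)
  have dE1: "(E1 has_real_derivative E2 s) (at s)" for s
    unfolding E1_def [abs_def] E2_def
    by (rule derivative_eq_intros dE refl | simp add: E1_def power2_eq_square power4_eq_xxxx algebra_simps)+
  define p where "p = conv (gauss \<sigma>) c"
  define P' where "P' s = E s *\<^sub>R ft c1 s + E1 s *\<^sub>R ft c s" for s
  define P'' where "P'' s = (E s *\<^sub>R ft c2 s + E1 s *\<^sub>R ft c1 s) + (E1 s *\<^sub>R ft c1 s + E2 s *\<^sub>R ft c s)" for s
  have p: "ft p = (\<lambda>s. E s *\<^sub>R ft c s)"
    unfolding p_def ft_conv[OF gi ci] ft_gauss[OF c(3)]
    by (simp add: fun_eq_iff ft_conv[OF gi ci] ft_gauss[OF c(3)] E_def scaleR_conv_of_real)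
  have d1: "(ft p has_vector_derivative P' s) (at s)" for s
    unfolding p P'_def using has_vector_derivative_scaleR[OF dE dC] .
  have d2: "(P' has_vector_derivative P'' s) (at s)" for s
    unfolding P'_def [abs_def] P''_def
    using has_vector_derivative_scaleR[OF dE dC1]
      has_vector_derivative_scaleR[OF dE1 dC]
    by (rule has_vector_derivative_add)
  have cont: "continuous_on UNIV P''"
    unfolding P''_def E_def E1_def E2_def
    by (intro continuous_intros continuous_ft ci c1i c2i) auto
  \<comment> \<open>One constant dominates the Gaussian factor and its first two derivatives.\<close>
  define L where "L = (1 + \<sigma>\<^sup>2 + \<sigma>^4) * (1 + 2 * (2 / \<sigma>\<^sup>2) + 2 * (2 / \<sigma>\<^sup>2)\<^sup>2)"
  have E_bound: "k * E s \<le> L / (1 + s\<^sup>2)" if k: "k \<le> (1 + \<sigma>\<^sup>2 + \<sigma>^4) * (1 + s\<^sup>2)" for k s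
  proof -
    have "k * E s \<le> (1 + \<sigma>\<^sup>2 + \<sigma>^4) * (1 + s\<^sup>2) * E s"
      using k by (intro mult_right_mono) (auto simp: E_def)
    also have "\<dots> \<le> (1 + \<sigma>\<^sup>2 + \<sigma>^4) * ((1 + 2 * (2 / \<sigma>\<^sup>2) + 2 * (2 / \<sigma>\<^sup>2)\<^sup>2) / (1 + s\<^sup>2))"
      using mult_left_mono[OF exp_square_decay[OF c(3), of s], of "1 + \<sigma>\<^sup>2 + \<sigma>^4"]
      by (simp add: E_def mult_ac)
    finally show ?thesis by (simp add: L_def)
  qed
  have s2: "\<bar>s\<bar> \<le> 1 + s\<^sup>2" for s :: real
    using sum_squares_bound[of "\<bar>s\<bar>" 1] by (simp add: power2_eq_square)
  have bE: "\<bar>E s\<bar> \<le> L / (1 + s\<^sup>2)" for s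
  proof -
    have "1 * E s \<le> L / (1 + s\<^sup>2)"
      by (rule E_bound) (auto simp: algebra_simps intro!: add_nonneg_nonneg)
    then show ?thesis by (simp add: E_def)
  qed
  have bE1: "\<bar>E1 s\<bar> \<le> L / (1 + s\<^sup>2)" for s
  proof -
    have "(\<sigma>\<^sup>2 * \<bar>s\<bar>) * E s \<le> L / (1 + s\<^sup>2)"
      by (rule E_bound, rule mult_mono) (use s2 in auto)
    then show ?thesis by (simp add: E1_def E_def abs_mult)
  qed
  have bE2: "\<bar>E2 s\<bar> \<le> L / (1 + s\<^sup>2)" for s
  proof -
    have "\<bar>\<sigma>^4 * s\<^sup>2 - \<sigma>\<^sup>2\<bar> \<le> \<sigma>^4 * s\<^sup>2 + \<sigma>\<^sup>2"
      by (rule order_trans[OF abs_triangle_ineq4]) simp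
    also have "\<dots> \<le> (1 + \<sigma>\<^sup>2 + \<sigma>^4) * (1 + s\<^sup>2)"
      by (auto simp: algebra_simps intro!: add_nonneg_nonneg)
    finally have "\<bar>\<sigma>^4 * s\<^sup>2 - \<sigma>\<^sup>2\<bar> * E s \<le> L / (1 + s\<^sup>2)" by (rule E_bound)
    then show ?thesis by (simp add: E2_def E_def abs_mult)
  qed
  define B where "B = (LINT x|lborel. norm (c x)) + (LINT x|lborel. norm (c1 x)) + (LINT x|lborel. norm (c2 x))"
  have n0: "0 \<le> (LINT x|lborel. norm (c x))" "0 \<le> (LINT x|lborel. norm (c1 x))" "0 \<le> (LINT x|lborel. norm (c2 x))"
    by simp_all
  have B: "norm (ft c s) \<le> B" "norm (ft c1 s) \<le> B" "norm (ft c2 s) \<le> B" for s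
    using norm_ft_le[OF ci, of s] norm_ft_le[OF c1i(1), of s] norm_ft_le[OF c2i(1), of s] n0
    unfolding B_def by linarith+
  have B0: "0 \<le> B" unfolding B_def using n0 by linarith
  have L0: "0 \<le> L" by (simp add: L_def)
  have pr: "norm (x *\<^sub>R z) \<le> L * B / (1 + s\<^sup>2)" if "\<bar>x\<bar> \<le> L / (1 + s\<^sup>2)" "norm z \<le> B" for x s :: real and z :: complex
  proof -
    have "\<bar>x\<bar> * norm z \<le> L / (1 + s\<^sup>2) * B"
      using that L0 by (intro mult_mono) auto
    then show ?thesis by simp
  qed
  have mono: "t * (L * B / (1 + s\<^sup>2)) \<le> 4 * L * B / (1 + s\<^sup>2)" if "t \<le> 4" for t s :: real
    using mult_right_mono[OF that, of "L * B / (1 + s\<^sup>2)"] L0 B0 by simp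
  show ?thesis
  \<comment> \<open>The factor 4 counts the products of bounded terms in \<open>P''\<close>.\<close>
  proof (rule that[of p P' P'' "4 * L * B"])
    show "integrable lborel p" unfolding p_def by (rule integrable_conv[OF gi ci])
    show "(LINT x|lborel. norm (g x - p x)) < e" using gc by (simp add: p_def)
    show "0 \<le> 4 * L * B" using L0 B0 by simp
    show "norm (ft p s) \<le> 4 * L * B / (1 + s\<^sup>2)" for s
      using pr[OF bE B(1), of s s] mono[of 1 s] unfolding p by simp
    show "norm (P' s) \<le> 4 * L * B / (1 + s\<^sup>2)" for s
    proof -
      have "norm (P' s) \<le> L * B / (1 + s\<^sup>2) + L * B / (1 + s\<^sup>2)"
        unfolding P'_def by (intro norm_triangle_mono pr bE bE1 B)
      then show ?thesis using mono[of 2 s] by (simp add: mult_ac)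
    qed
    show "norm (P'' s) \<le> 4 * L * B / (1 + s\<^sup>2)" for s
    proof -
      have "norm (P'' s) \<le> (L * B / (1 + s\<^sup>2) + L * B / (1 + s\<^sup>2)) + (L * B / (1 + s\<^sup>2) + L * B / (1 + s\<^sup>2))"
        unfolding P''_def by (intro norm_triangle_mono pr bE bE1 bE2 B)
      then show ?thesis by (simp add: mult_ac)
    qed
  qed (fact d1 d2 cont)+
qed

section \<open>Wiener's lemma\<close>

lemma wiener_norm_le_smooth_decay:
  assumes d1: "\<And>x. (\<Phi> has_vector_derivative \<Phi>' x) (at x)"
    and d2: "\<And>x. (\<Phi>' has_vector_derivative \<Phi>'' x) (at x)"
    and c: "continuous_on UNIV \<Phi>''"
    and b: "\<And>s. norm (\<Phi> s) \<le> Y / (1 + s\<^sup>2)" "\<And>s. norm (\<Phi>' s) \<le> Y / (1 + s\<^sup>2)"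
      "\<And>s. norm (\<Phi>'' s) \<le> Y / (1 + s\<^sup>2)"
  shows "wiener_norm_le \<Phi> (pi * Y)"
proof -
  have cont: "continuous_on UNIV \<Phi>" "continuous_on UNIV \<Phi>'"
    using d1 d2 by (meson continuous_at_imp_continuous_on has_vector_derivative_continuous)+
  have iY: "integrable lborel (\<lambda>s::real. Y / (1 + s\<^sup>2))"
    using integrable_mult_right[OF integrable_inverse_1_plus_square_lborel, of Y] by (simp add: divide_inverse)
  have Y: "(LINT s|lborel. Y / (1 + s\<^sup>2)) = pi * Y"
    using integral_inverse_1_plus_square_lborel by (simp add: divide_inverse)
  have int: "integrable lborel F \<and> (LINT s|lborel. norm (F s)) \<le> pi * Y"
    if F: "continuous_on UNIV F" "\<And>s. norm (F s) \<le> Y / (1 + s\<^sup>2)" for F :: "real \<Rightarrow> complex"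
  proof
    show *: "integrable lborel F"
    proof (rule Bochner_Integration.integrable_bound[OF iY])
      show "F \<in> borel_measurable lborel" using borel_measurable_continuous_onI[OF F(1)] by simp
      show "AE s in lborel. norm (F s) \<le> norm (Y / (1 + s\<^sup>2))"
        unfolding real_norm_def using F(2) by (intro AE_I2 order_trans[OF _ abs_ge_self])
    qed
    have "(LINT s|lborel. norm (F s)) \<le> (LINT s|lborel. Y / (1 + s\<^sup>2))"
      by (rule integral_mono) (use * iY F(2) in auto)
    then show "(LINT s|lborel. norm (F s)) \<le> pi * Y" using Y by simp
  qed
  have Y0: "0 \<le> Y" using order_trans[OF norm_ge_zero b(1)[of 0]] by simp
  have "norm (\<Phi> s) \<le> Y" for s
  proof -
    have "Y / (1 + s\<^sup>2) \<le> Y / 1" using Y0 by (intro divide_left_mono) (auto intro: add_pos_nonneg)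
    then show ?thesis using b(1)[of s] by simp
  qed
  note * = wiener_norm_le_smooth[OF d1 d2 c this]
  show ?thesis
    by (rule wiener_norm_le_mono[OF *])
       (use int[OF cont(1) b(1)] int[OF cont(2) b(2)] int[OF c b(3)] in auto)
qed

lemma has_field_derivative_inverse_power:
  fixes z :: complex
  assumes "z \<noteq> 0"
  shows "((\<lambda>z. inverse z ^ m) has_field_derivative (- of_nat m * inverse z ^ Suc m)) (at z)"
proof (cases m)
  case (Suc k)
  have "((\<lambda>z. inverse z) has_field_derivative - (inverse z * inverse z)) (at z)"
    using DERIV_inverse[OF assms] by (simp add: power2_eq_square)
  from DERIV_power[OF this, of m]
  have "((\<lambda>z. inverse z ^ m) has_field_derivative of_nat m * (- (inverse z * inverse z) * inverse z ^ k)) (at z)"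
    using Suc by simp
  moreover have "of_nat m * (- (inverse z * inverse z) * inverse z ^ k) = - of_nat m * inverse z ^ Suc m"
    using Suc by (simp only: power_Suc mult_ac mult_minus_left mult_minus_right)
  ultimately show ?thesis by (simp only:)
qed auto

lemma norm_power_minus_1_le:
  fixes w :: complex
  assumes "norm w \<le> M" "1 \<le> M"
  shows "norm (w ^ n - 1) \<le> real n * M ^ n * norm (w - 1)"
proof (induction n)
  case (Suc n)
  have "w ^ Suc n - 1 = w * (w ^ n - 1) + (w - 1)" by (simp add: algebra_simps)
  then have "norm (w ^ Suc n - 1) \<le> norm (w * (w ^ n - 1)) + norm (w - 1)"
    by (metis norm_triangle_ineq)
  moreover have "norm (w * (w ^ n - 1)) \<le> M * (real n * M ^ n * norm (w - 1))"
    unfolding norm_mult using assms Suc by (intro mult_mono) auto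
  moreover have "norm (w - 1) \<le> M ^ Suc n * norm (w - 1)"
    using assms one_le_power[of M "Suc n"] mult_right_mono[of 1 "M ^ Suc n" "norm (w - 1)"] by simp
  moreover have "M * (real n * M ^ n * norm (w - 1)) + M ^ Suc n * norm (w - 1)
      = real (Suc n) * M ^ Suc n * norm (w - 1)"
    by (simp add: algebra_simps)
  ultimately show ?case by linarith
qed auto

text \<open>
  The estimate behind Newman's argument: in the algebra norm, the powers of \<open>1 / (1 + p)\<close> grow no
  faster than those of the sup norm bound \<open>1 / \<delta>\<close>, up to a factor polynomial in \<open>n\<close>, since only two derivatives are
  taken. The constant 1 is subtracted because it is not the transform of an integrable function.
\<close>

lemma wiener_norm_le_inverse_power:
  assumes d1: "\<And>s. (p has_vector_derivative p' s) (at s)"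
    and d2: "\<And>s. (p' has_vector_derivative p'' s) (at s)"
    and c: "continuous_on UNIV p''"
    and b: "\<And>s. norm (p s) \<le> K / (1 + s\<^sup>2)" "\<And>s. norm (p' s) \<le> K / (1 + s\<^sup>2)"
      "\<And>s. norm (p'' s) \<le> K / (1 + s\<^sup>2)"
    and \<delta>: "0 < \<delta>" "\<delta> \<le> 1" "\<And>s. \<delta> \<le> norm (1 + p s)"
  shows "wiener_norm_le (\<lambda>s. inverse (1 + p s) ^ Suc n - 1)
    (pi * ((K + K\<^sup>2) * ((real n + 1) * (real n + 2) * (1 / \<delta>) ^ (n + 3))))"
proof -
  define M where "M = 1 / \<delta>"
  have M: "M \<ge> 1" using \<delta> by (simp add: M_def)
  define w where "w s = inverse (1 + p s)" for s
  have nz: "1 + p s \<noteq> 0" for s using \<delta>(1) \<delta>(3)[of s] by auto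
  have w: "norm (w s) \<le> M" for s
    using \<delta>(1) \<delta>(3)[of s] by (simp add: w_def M_def norm_inverse divide_inverse le_imp_inverse_le)
  have K0: "0 \<le> K" using order_trans[OF norm_ge_zero b(1)[of 0]] by simp
  define X where "X = (real n + 1) * (real n + 2) * M ^ (n + 3)"
  have X0: "0 \<le> X" using M by (simp add: X_def)
  have cont: "continuous_on UNIV p" "continuous_on UNIV p'"
    using d1 d2 by (meson continuous_at_imp_continuous_on has_vector_derivative_continuous)+
  have dw: "((\<lambda>s. w s ^ m) has_vector_derivative p' s * (- of_nat m * w s ^ Suc m)) (at s)" for m s
  proof -
    have "((\<lambda>s. 1 + p s) has_vector_derivative p' s) (at s)"
      using has_vector_derivative_add[OF has_vector_derivative_const d1[of s], of 1] by simp
    from field_vector_diff_chain_at[OF this has_field_derivative_inverse_power[OF nz[of s], of m]]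
    show ?thesis by (simp add: o_def w_def)
  qed
  have pow: "real (Suc n) * M ^ Suc n * M \<le> X" "(real n + 1) * (real n + 2) * M ^ (n + 3) \<le> X"
    "real (Suc n) * M ^ Suc (Suc n) \<le> X"
  proof -
    have "real (Suc n) * 1 * M ^ (n + 2) \<le> (real n + 1) * (real n + 2) * M ^ (n + 3)"
      using M by (intro mult_mono power_increasing) auto
    then show "real (Suc n) * M ^ Suc (Suc n) \<le> X" by (simp add: X_def)
    then show "real (Suc n) * M ^ Suc n * M \<le> X" by (simp add: mult_ac)
  qed (simp add: X_def)
  have KK: "x * y \<le> X * (K + K\<^sup>2) / (1 + s\<^sup>2)" if "0 \<le> y" "x \<le> X" "y \<le> K / (1 + s\<^sup>2)" for x y s
  proof -
    have "x * y \<le> X * (K / (1 + s\<^sup>2))" using that X0 by (intro mult_mono) auto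
    also have "\<dots> = X * K / (1 + s\<^sup>2)" by simp
    also have "\<dots> \<le> X * (K + K\<^sup>2) / (1 + s\<^sup>2)"
      using X0 by (intro divide_right_mono mult_left_mono) auto
    finally show ?thesis .
  qed
  have wn: "norm (w s ^ m) \<le> M ^ m" for s m unfolding norm_power by (intro power_mono w) simp
  have "wiener_norm_le (\<lambda>s. w s ^ Suc n - 1) (pi * (X * (K + K\<^sup>2)))"
  proof (rule wiener_norm_le_smooth_decay)
    let ?r1 = "\<lambda>s. p' s * (- of_nat (Suc n) * w s ^ Suc (Suc n))"
    let ?r2 = "\<lambda>s. p' s * (- of_nat (Suc n) * (p' s * (- of_nat (Suc (Suc n)) * w s ^ Suc (Suc (Suc n)))))
      + p'' s * (- of_nat (Suc n) * w s ^ Suc (Suc n))"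
    show "((\<lambda>s. w s ^ Suc n - 1) has_vector_derivative ?r1 s) (at s)" for s
      using has_vector_derivative_diff[OF dw[of "Suc n" s] has_vector_derivative_const[of 1 "at s"]]
      by (simp only: diff_zero)
    show "(?r1 has_vector_derivative ?r2 s) (at s)" for s
      by (rule has_vector_derivative_mult[OF d2 has_vector_derivative_mult_right[OF dw]])
    show "continuous_on UNIV ?r2"
      unfolding w_def using nz by (intro continuous_intros cont c) auto
    show "norm (w s ^ Suc n - 1) \<le> X * (K + K\<^sup>2) / (1 + s\<^sup>2)" for s
    proof -
      have "w s - 1 = - (w s * p s)" using nz[of s] by (simp add: w_def field_simps)
      then have "norm (w s - 1) \<le> M * norm (p s)" using w[of s] by (simp add: norm_mult mult_right_mono)
      then have "real (Suc n) * M ^ Suc n * norm (w s - 1) \<le> real (Suc n) * M ^ Suc n * (M * norm (p s))"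
        using M by (intro mult_left_mono) auto
      with norm_power_minus_1_le[OF w[of s] M, of "Suc n"]
      have "norm (w s ^ Suc n - 1) \<le> (real (Suc n) * M ^ Suc n * M) * norm (p s)"
        by (simp only: mult.assoc)
      then show ?thesis using KK[OF norm_ge_zero pow(1) b(1)] by (rule order_trans)
    qed
    have r1: "norm (a * (- of_nat (Suc n) * w s ^ Suc (Suc n))) \<le> (real (Suc n) * M ^ Suc (Suc n)) * norm a" for s a
    proof -
      have "norm (a * (- of_nat (Suc n) * w s ^ Suc (Suc n))) = real (Suc n) * norm (w s ^ Suc (Suc n)) * norm a"
        unfolding norm_mult norm_minus_cancel norm_of_nat by (simp only: mult_ac)
      also have "\<dots> \<le> (real (Suc n) * M ^ Suc (Suc n)) * norm a"
        by (intro mult_right_mono mult_left_mono wn) auto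
      finally show ?thesis .
    qed
    show "norm (?r1 s) \<le> X * (K + K\<^sup>2) / (1 + s\<^sup>2)" for s
      using r1[of "p' s" s] KK[OF norm_ge_zero pow(3) b(2)] by (rule order_trans)
    show "norm (?r2 s) \<le> X * (K + K\<^sup>2) / (1 + s\<^sup>2)" for s
    proof -
      let ?A = "p' s * (- of_nat (Suc n) * (p' s * (- of_nat (Suc (Suc n)) * w s ^ Suc (Suc (Suc n)))))"
      have "norm ?A = (norm (p' s) * norm (p' s)) * (real (Suc n) * real (Suc (Suc n)) * norm (w s ^ Suc (Suc (Suc n))))"
        unfolding norm_mult norm_minus_cancel norm_of_nat by (simp only: mult_ac)
      also have "\<dots> \<le> (K / (1 + s\<^sup>2) * K) * (real (Suc n) * real (Suc (Suc n)) * M ^ Suc (Suc (Suc n)))"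
      proof (intro mult_mono mult_left_mono wn b)
        have "K / (1 + s\<^sup>2) \<le> K / 1" using K0 by (intro divide_left_mono) (auto intro: add_pos_nonneg)
        then show "norm (p' s) \<le> K" using b(2)[of s] by simp
      qed (use K0 in auto)
      also have "\<dots> = X * K\<^sup>2 / (1 + s\<^sup>2)"
        by (simp add: X_def power2_eq_square mult_ac add_ac numeral_3_eq_3)
      finally have A: "norm ?A \<le> X * K\<^sup>2 / (1 + s\<^sup>2)" .
      have B: "norm (p'' s * (- of_nat (Suc n) * w s ^ Suc (Suc n))) \<le> X * (K / (1 + s\<^sup>2))"
        by (rule order_trans[OF r1 mult_mono[OF pow(3) b(3)]]) (use X0 in auto)
      have "norm (?r2 s) \<le> X * K\<^sup>2 / (1 + s\<^sup>2) + X * (K / (1 + s\<^sup>2))"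
        by (rule norm_triangle_mono[OF A B])
      also have "\<dots> = X * (K + K\<^sup>2) / (1 + s\<^sup>2)"
        by (simp add: distrib_left add_divide_distrib)
      finally show ?thesis .
    qed
  qed
  then show ?thesis by (simp add: w_def X_def M_def mult_ac)
qed

text \<open>
  The transform of \<open>g\<close> is within 1/4 of a function that decays, so \<open>1 + ft g\<close> stays away from 0 outside
  a bounded interval; inside, compactness gives a positive minimum.
\<close>

lemma one_plus_ft_bounded_below:
  assumes g: "integrable lborel g" and nz: "\<And>s. 1 + ft g s \<noteq> 0"
  obtains \<delta> where "0 < \<delta>" "\<delta> \<le> 1" "\<And>s. 2 * \<delta> \<le> norm (1 + ft g s)"
proof -
  obtain p P' P'' K where p: "integrable lborel p" "(LINT x|lborel. norm (g x - p x)) < 1 / 4"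
    and K: "K \<ge> 0" "\<And>s. norm (ft p s) \<le> K / (1 + s\<^sup>2)"
    by (rule L1_approx_smooth_ft[OF g, of "1/4"]) (simp, rule that)
  \<comment> \<open>For \<open>\<bar>s\<bar> > R\<close> one has \<open>s\<^sup>2 \<ge> \<bar>s\<bar> \<ge> 4 * K\<close>, so that \<open>ft p\<close> is at most 1/4 there.\<close>
  define R where "R = 4 * K + 1"
  have far: "1 / 2 \<le> norm (1 + ft g s)" if "\<bar>s\<bar> > R" for s
  proof -
    have "\<bar>s\<bar> * 1 \<le> \<bar>s\<bar> * \<bar>s\<bar>" using that K by (intro mult_left_mono) (auto simp: R_def)
    then have "4 * K \<le> 1 + s\<^sup>2" using that by (simp add: R_def power2_eq_square)
    then have "K / (1 + s\<^sup>2) \<le> 1 / 4" by (simp add: divide_simps add_pos_nonneg add_nonneg_eq_0_iff)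
    then have "norm (ft p s) \<le> 1 / 4" by (rule order_trans[OF K(2)[of s]])
    moreover have "norm (ft g s - ft p s) \<le> 1 / 4"
      using norm_ft_le[of "\<lambda>x. g x - p x" s] g p by (simp add: ft_diff)
    ultimately have "norm (ft g s) \<le> 1 / 2"
      using norm_triangle_ineq[of "ft g s - ft p s" "ft p s"] by simp
    then show ?thesis using norm_diff_ineq[of 1 "ft g s"] by simp
  qed
  have "continuous_on {-R..R} (\<lambda>s. norm (1 + ft g s))"
    by (intro continuous_intros continuous_on_subset[OF continuous_ft[OF g]]) auto
  moreover have "{-R..R} \<noteq> {}" using K by (simp add: R_def)
  ultimately have "\<exists>s0\<in>{-R..R}. \<forall>s\<in>{-R..R}. norm (1 + ft g s0) \<le> norm (1 + ft g s)"
    by (intro continuous_attains_inf) auto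
  then obtain s0 where s0: "\<And>s. s \<in> {-R..R} \<Longrightarrow> norm (1 + ft g s0) \<le> norm (1 + ft g s)"
    by blast
  define \<delta> where "\<delta> = min (1 / 4) (norm (1 + ft g s0) / 2)"
  show ?thesis
  proof (rule that)
    show "0 < \<delta>" using nz by (simp add: \<delta>_def)
    show "\<delta> \<le> 1" by (simp add: \<delta>_def)
    show "2 * \<delta> \<le> norm (1 + ft g s)" for s
    proof (cases "\<bar>s\<bar> > R")
      case True
      then show ?thesis using far[OF True] by (simp add: \<delta>_def)
    next
      case False
      then show ?thesis using s0[of s] by (auto simp: \<delta>_def abs_real_def split: if_splits)
    qed
  qed
qed

text \<open>
  Wiener's lemma on the line, by Newman's proof. Write \<open>1 + ft g = P + Q\<close> with \<open>P = 1 + ft p\<close> smooth, \<open>\<bar>P\<bar> \<ge> \<delta>\<close>,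
  and \<open>Q\<close> of algebra norm below \<open>\<delta> / 2\<close>. Then \<open>1 / (P + Q)\<close> is the sum of \<open>(- Q) ^ n / P ^ (n + 1)\<close>, and this
  series converges in the algebra because the norms of the \<open>n\<close>-th powers are at most
  \<open>(\<delta> / 2) ^ n\<close> and, up to a polynomial in \<open>n\<close>, \<open>(1 / \<delta>) ^ n\<close>.
\<close>

theorem wiener_inverse:
  assumes g: "integrable lborel g" and nz: "\<And>s. 1 + ft g s \<noteq> 0"
  obtains \<xi> where "integrable lborel \<xi>" "\<And>s. ft \<xi> s = ft g s / (1 + ft g s)"
proof -
  obtain \<delta> where \<delta>: "0 < \<delta>" "\<delta> \<le> 1" "\<And>s. 2 * \<delta> \<le> norm (1 + ft g s)"
    by (rule one_plus_ft_bounded_below[OF g nz]) (rule that)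
  have \<delta>2: "\<delta> / 2 > 0" using \<delta> by simp
  obtain p P' P'' K where p: "integrable lborel p" "(LINT x|lborel. norm (g x - p x)) < \<delta> / 2"
    and P: "\<And>s. (ft p has_vector_derivative P' s) (at s)"
    "\<And>s. (P' has_vector_derivative P'' s) (at s)" "continuous_on UNIV P''" "K \<ge> 0"
    "\<And>s. norm (ft p s) \<le> K / (1 + s\<^sup>2)" "\<And>s. norm (P' s) \<le> K / (1 + s\<^sup>2)"
    "\<And>s. norm (P'' s) \<le> K / (1 + s\<^sup>2)"
    by (rule L1_approx_smooth_ft[OF g \<delta>2]) (rule that)
  define Q where "Q s = ft g s - ft p s" for s
  define w where "w s = inverse (1 + ft p s)" for s
  have gp: "integrable lborel (\<lambda>x. g x - p x)" using g p by simp
  have Qft: "ft (\<lambda>x. g x - p x) = Q" using g p by (simp add: fun_eq_iff ft_diff Q_def)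
  have Q: "norm (Q s) \<le> \<delta> / 2" for s
    using norm_ft_le[OF gp, of s] p(2) by (simp add: Qft)
  have Plow: "\<delta> \<le> norm (1 + ft p s)" for s
  proof -
    have "norm (1 + ft g s) \<le> norm (1 + ft p s) + norm (Q s)"
      using norm_triangle_ineq[of "1 + ft p s" "Q s"] by (simp add: Q_def)
    then show ?thesis using \<delta>(1) \<delta>(3)[of s] Q[of s] by linarith
  qed
  have Pnz: "1 + ft p s \<noteq> 0" for s using Plow[of s] \<delta>(1) by auto
  have QA: "wiener_norm_le (\<lambda>s. - 1 * Q s) (\<delta> / 2)"
    using wiener_norm_le_cmult[OF wiener_norm_leI[OF gp Qft order_refl], of "-1"]
    by (rule wiener_norm_le_mono) (use p(2) in simp)
  define C where "C = pi * (K + K\<^sup>2) * (1 / \<delta>) ^ 3"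
  have C0: "0 \<le> C" using P(4) \<delta>(1) by (simp add: C_def)
  define c where "c n = (1 / 2) ^ n * (1 + C * ((real n + 1) * (real n + 2)))" for n :: nat
  \<comment> \<open>The constant 1 is split off from the term \<open>n = 0\<close>, the only one that does not belong to the algebra.\<close>
  define a where "a n s = (- 1 * Q s) ^ n * w s ^ Suc n - (if n = 0 then 1 else 0)" for n s
  have r: "wiener_norm_le (\<lambda>s. w s ^ Suc n - 1) (C * ((real n + 1) * (real n + 2)) * (1 / \<delta>) ^ n)" for n
    using wiener_norm_le_inverse_power[OF P(1,2,3,5,6,7) \<delta>(1,2) Plow, of n]
    by (simp add: w_def C_def power_add mult_ac)
  have aA: "wiener_norm_le (a n) (c n)" for n
  proof (cases n)
    case 0
    have "wiener_norm_le (a n) (C * ((real n + 1) * (real n + 2)) * (1 / \<delta>) ^ n)"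
      using r[of 0] 0 by (simp add: a_def [abs_def])
    then show ?thesis by (rule wiener_norm_le_mono) (simp add: c_def 0)
  next
    case (Suc m)
    have qn: "wiener_norm_le (\<lambda>s. (- 1 * Q s) ^ n) ((\<delta> / 2) ^ n)"
      using wiener_norm_le_power[OF QA, of m] Suc by simp
    have "a n = (\<lambda>s. (- 1 * Q s) ^ n + (- 1 * Q s) ^ n * (w s ^ Suc n - 1))"
      using Suc by (simp add: a_def [abs_def] fun_eq_iff algebra_simps)
    moreover have "wiener_norm_le (\<lambda>s. (- 1 * Q s) ^ n + (- 1 * Q s) ^ n * (w s ^ Suc n - 1))
        ((\<delta> / 2) ^ n + (\<delta> / 2) ^ n * (C * ((real n + 1) * (real n + 2)) * (1 / \<delta>) ^ n))"
      by (intro wiener_norm_le_add wiener_norm_le_mult qn r)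
    ultimately have "wiener_norm_le (a n) ((\<delta> / 2) ^ n + (\<delta> / 2) ^ n * (C * ((real n + 1) * (real n + 2)) * (1 / \<delta>) ^ n))"
      by simp
    then show ?thesis
    proof (rule wiener_norm_le_mono)
      have "(\<delta> / 2) ^ n * (1 / \<delta>) ^ n = (1 / 2) ^ n"
        using \<delta>(1) by (simp add: power_mult_distrib [symmetric])
      then have "(\<delta> / 2) ^ n * (C * ((real n + 1) * (real n + 2)) * (1 / \<delta>) ^ n)
          = (1 / 2) ^ n * (C * ((real n + 1) * (real n + 2)))"
        by (metis mult.assoc mult.commute)
      moreover have "(\<delta> / 2) ^ n \<le> (1 / 2) ^ n" using \<delta> by (intro power_mono) auto
      ultimately show "(\<delta> / 2) ^ n + (\<delta> / 2) ^ n * (C * ((real n + 1) * (real n + 2)) * (1 / \<delta>) ^ n) \<le> c n"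
        by (simp add: c_def distrib_left)
    qed
  qed
  \<comment> \<open>Successive terms have ratio \<open>(n + 3) / (2 * (n + 1))\<close>, which is at most 3/4 from \<open>n = 3\<close> on.\<close>
  have "summable (\<lambda>n. (1 / 2) ^ n * ((real n + 1) * (real n + 2)))"
  proof (rule summable_ratio_test[of "3 / 4" 3])
    fix n :: nat assume "3 \<le> n"
    then have "2 * (real n + 3) \<le> 3 * (real n + 1)" by simp
    then have "(1 / 2) ^ n * (real n + 2) * (2 * (real n + 3)) \<le> (1 / 2) ^ n * (real n + 2) * (3 * (real n + 1))"
      by (rule mult_left_mono) simp
    then show "norm ((1 / 2) ^ Suc n * ((real (Suc n) + 1) * (real (Suc n) + 2)))
        \<le> 3 / 4 * norm ((1 / 2) ^ n * ((real n + 1) * (real n + 2)))"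
      by (simp add: abs_mult algebra_simps)
  qed simp
  then have "summable (\<lambda>n. (1 / 2) ^ n + C * ((1 / 2) ^ n * ((real n + 1) * (real n + 2))))"
    by (intro summable_add summable_mult summable_geometric) auto
  then have cs: "summable c" by (simp add: c_def [abs_def] algebra_simps)
  have sum: "(\<Sum>n. a n s) = - (ft g s / (1 + ft g s))" for s
  proof -
    have "norm (w s) \<le> 1 / \<delta>"
      using \<delta>(1) Plow[of s] by (simp add: w_def norm_inverse divide_inverse le_imp_inverse_le)
    then have "norm (- 1 * Q s * w s) \<le> \<delta> / 2 * (1 / \<delta>)"
      unfolding norm_mult using Q[of s] \<delta>(1) by (intro mult_mono) auto
    then have lt: "norm (- 1 * Q s * w s) < 1" using \<delta>(1) by simp
    have "(\<lambda>n. w s * (- 1 * Q s * w s) ^ n - (if n = 0 then 1 else 0)) sums (w s * (1 / (1 - (- 1 * Q s * w s))) - 1)"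
      by (intro sums_diff sums_mult geometric_sums lt sums_single[of 0 "\<lambda>_. 1"])
    moreover have "w s * (- 1 * Q s * w s) ^ n = (- 1 * Q s) ^ n * w s ^ Suc n" for n
      by (simp only: power_mult_distrib power_Suc mult_ac)
    ultimately have "(\<lambda>n. a n s) sums (w s * (1 / (1 - (- 1 * Q s * w s))) - 1)"
      unfolding a_def by (simp only:)
    then have "(\<Sum>n. a n s) = w s * (1 / (1 - (- 1 * Q s * w s))) - 1"
      by (rule sums_unique [symmetric])
    also have "1 - (- 1 * Q s * w s) = (1 + ft g s) * w s"
      using Pnz[of s] by (simp add: w_def Q_def field_simps)
    also have "w s * (1 / ((1 + ft g s) * w s)) - 1 = - (ft g s / (1 + ft g s))"
      using Pnz[of s] nz[of s] by (simp add: w_def field_simps)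
    finally show ?thesis .
  qed
  have "wiener_norm_le (\<lambda>s. - 1 * (\<Sum>n. a n s)) (norm (- 1 :: complex) * suminf c)"
    by (rule wiener_norm_le_cmult[OF wiener_norm_le_suminf[OF aA cs]])
  then obtain \<xi> where "integrable lborel \<xi>" "ft \<xi> = (\<lambda>s. - 1 * (\<Sum>n. a n s))"
    unfolding wiener_norm_le_def by blast
  then show ?thesis by (intro that[of \<xi>]) (auto simp: sum)
qed

section \<open>Bounded solutions of \<open>w - w'' = v\<close>\<close>

lemma conv_tendsto_0_at_infinity:
  assumes [measurable]: "k \<in> borel_measurable borel" and b: "\<And>x. norm (k x) \<le> B"
    and k: "(k \<longlongrightarrow> 0) at_infinity" and v: "integrable lborel v"
  shows "(conv k v \<longlongrightarrow> 0) at_infinity"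
proof -
  have [measurable]: "v \<in> borel_measurable borel" using v by (auto dest: borel_measurable_integrable)
  have top: "((\<lambda>x. LINT y|lborel. k (t * x - y) * v y) \<longlongrightarrow> (LINT y|(lborel::real measure). 0)) at_top" if t: "t = 1 \<or> t = -1" for t
  proof (rule integral_dominated_convergence_at_top[where w = "\<lambda>y. B * norm (v y)"])
    show "\<forall>\<^sub>F x in at_top. AE y in lborel. norm (k (t * x - y) * v y) \<le> B * norm (v y)"
      by (intro always_eventually allI AE_I2) (simp add: norm_mult mult_right_mono b)
    show "AE y in lborel. ((\<lambda>x. k (t * x - y) * v y) \<longlongrightarrow> 0) at_top"
    proof (rule AE_I2)
      fix y
      have "filterlim (\<lambda>x::real. t * x - y) at_infinity at_top"
        unfolding filterlim_at_infinity[OF order_refl]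
      proof (intro allI impI)
        fix r :: real
        show "\<forall>\<^sub>F x in at_top. r \<le> norm (t * x - y)"
          using eventually_ge_at_top[of "\<bar>r\<bar> + \<bar>y\<bar>"] by eventually_elim (use t in auto)
      qed
      then have "((\<lambda>x. k (t * x - y)) \<longlongrightarrow> 0) at_top" by (rule filterlim_compose[OF k])
      then show "((\<lambda>x. k (t * x - y) * v y) \<longlongrightarrow> 0) at_top" by (rule tendsto_mult_left_zero)
    qed
  qed (use v in auto)
  have "((\<lambda>x. conv k v x) \<longlongrightarrow> 0) at_top" using top[of 1] by (simp add: conv_def)
  moreover have "((\<lambda>x. conv k v x) \<longlongrightarrow> 0) at_bot"
    unfolding filterlim_at_bot_mirror using top[of "-1"] by (simp add: conv_def)
  ultimately show ?thesis by (simp add: at_infinity_eq_at_top_bot filterlim_sup)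
qed

text \<open>
  The Green's function \<open>exp (- \<bar>y\<bar>) / 2\<close> is split at its kink into \<open>exp_right\<close> and \<open>exp_left\<close>, whose convolutions
  with \<open>u\<close> satisfy first-order equations.
\<close>

definition exp_right :: "real \<Rightarrow> complex" where
  "exp_right y = of_real (exp (- y) * indicator {0..} y)"

definition exp_left :: "real \<Rightarrow> complex" where
  "exp_left y = exp_right (- y)"

lemma exp_right_measurable [measurable]: "exp_right \<in> borel_measurable borel"
  unfolding exp_right_def by measurable

lemma exp_left_measurable [measurable]: "exp_left \<in> borel_measurable borel"
  unfolding exp_left_def by measurable

lemma exp_right_le: "norm (exp_right y) \<le> 1"
  unfolding exp_right_def norm_of_real by (auto simp: indicator_def)

lemma exp_left_le: "norm (exp_left y) \<le> 1"
  unfolding exp_left_def by (rule exp_right_le)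

lemma exp_right_integrable: "integrable lborel exp_right" and exp_right_L1: "(LINT y|lborel. norm (exp_right y)) = 1"
proof -
  have *: "has_bochner_integral lborel (\<lambda>x. exp (-x) * indicator {0 ..} x::real) 1"
    using has_bochner_integral_I0i_power_exp_m'[of 0] by simp
  show "integrable lborel exp_right"
    unfolding exp_right_def using * by (intro integrable_of_real) (rule integrable.intros)
  have "norm (exp_right y) = exp (-y) * indicator {0 ..} y" for y
    unfolding exp_right_def norm_of_real by simp
  then show "(LINT y|lborel. norm (exp_right y)) = 1"
    using has_bochner_integral_integral_eq[OF *] by simp
qed

lemma exp_left_integrable: "integrable lborel exp_left" and exp_left_L1: "(LINT y|lborel. norm (exp_left y)) = 1"
  using integrable_lborel_shift(4)[OF exp_right_integrable] integral_lborel_shift(3)[of "\<lambda>y. norm (exp_right y)"] exp_right_L1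
  by (simp_all add: exp_left_def [abs_def])

lemma exp_right_tendsto_0: "(exp_right \<longlongrightarrow> 0) at_infinity"
proof -
  have "((\<lambda>x. complex_of_real (exp (- x))) \<longlongrightarrow> of_real 0) at_top"
    by (intro tendsto_of_real filterlim_compose[OF exp_at_bot filterlim_uminus_at_bot_at_top])
  moreover have "eventually (\<lambda>x. complex_of_real (exp (- x)) = exp_right x) at_top"
    using eventually_ge_at_top[of 0] by eventually_elim (simp add: exp_right_def)
  ultimately have "(exp_right \<longlongrightarrow> 0) at_top" using filterlim_cong by force
  moreover have "eventually (\<lambda>x. exp_right x = 0) at_bot"
    using eventually_le_at_bot[of "-1"] by eventually_elim (simp add: exp_right_def)
  then have "(exp_right \<longlongrightarrow> 0) at_bot" by (rule tendsto_eventually)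
  ultimately show ?thesis by (simp add: at_infinity_eq_at_top_bot filterlim_sup)
qed

lemma at_infinity_mirror: "filterlim f F at_infinity \<Longrightarrow> filterlim (\<lambda>x::real. f (- x)) F at_infinity"
  by (erule filterlim_compose) (simp add: filterlim_at_infinity[OF order_refl] eventually_at_infinity, metis norm_minus_cancel)

lemma exp_left_tendsto_0: "(exp_left \<longlongrightarrow> 0) at_infinity"
  unfolding exp_left_def [abs_def] by (rule at_infinity_mirror[OF exp_right_tendsto_0])

lemma has_vector_derivative_integral_atMost:
  fixes k :: "real \<Rightarrow> complex"
  assumes c: "continuous_on UNIV k" and i: "\<And>x. integrable lborel (\<lambda>y. indicator {..x} y *\<^sub>R k y)"
  shows "((\<lambda>x. LINT y|lborel. indicator {..x} y *\<^sub>R k y) has_vector_derivative k x) (at x)"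
proof -
  let ?A = "\<lambda>x. LINT y|lborel. indicator {..x} y *\<^sub>R k y"
  define a where "a = x - 1"
  define C where "C = (LINT y|lborel. indicator {..<a} y *\<^sub>R k y)"
  have km: "k \<in> borel_measurable borel" using c by (rule borel_measurable_continuous_onI)
  note [measurable] = km
  have i0: "integrable lborel (\<lambda>y. indicator {..<a} y *\<^sub>R k y)"
    by (rule Bochner_Integration.integrable_bound[OF i[of a]]) (auto simp: indicator_def)
  have eq: "C + integral {a..u} k = ?A u" if "u \<in> {a<..<x+1}" for u
  proof -
    have s: "set_integrable lborel {a..u} k"
      by (rule borel_integrable_atLeastAtMost', rule continuous_on_subset[OF c]) auto
    have "?A u = (LINT y|lborel. indicator {..<a} y *\<^sub>R k y + indicator {a..u} y *\<^sub>R k y)"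
      using that by (intro Bochner_Integration.integral_cong) (auto simp: indicator_def)
    also have "\<dots> = C + integral {a..u} k"
      using i0 s set_borel_integral_eq_integral(2)[OF s]
      by (simp add: C_def set_integrable_def set_lebesgue_integral_def)
    finally show ?thesis by simp
  qed
  have "((\<lambda>u. integral {a..u} k) has_vector_derivative k x) (at x within {a..x+1})"
    by (rule integral_has_vector_derivative) (auto simp: a_def intro: continuous_on_subset[OF c])
  then have "((\<lambda>u. integral {a..u} k) has_vector_derivative k x) (at x)"
    by (simp add: at_within_Icc_at a_def)
  then have "((\<lambda>u. C + integral {a..u} k) has_vector_derivative k x) (at x)"
    using has_vector_derivative_add[OF has_vector_derivative_const[of C]] by fastforce
  then show ?thesis
    by (rule has_vector_derivative_transform_within_open[of _ _ _ "{a<..<x+1}"])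
       (auto simp: a_def eq[unfolded a_def])
qed

text \<open>
  The convolution equals \<open>exp (- x)\<close> times the integral of \<open>exp y * u y\<close> over \<open>y \<le> x\<close>.
\<close>

lemma has_vector_derivative_conv_exp_right:
  assumes c: "continuous_on UNIV u" and u: "integrable lborel u"
  shows "(conv exp_right u has_vector_derivative (u x - conv exp_right u x)) (at x)"
proof -
  let ?k = "\<lambda>y. exp y *\<^sub>R u y"
  have ck: "continuous_on UNIV ?k" by (intro continuous_intros c)
  have [measurable]: "u \<in> borel_measurable borel" using u by (auto dest: borel_measurable_integrable)
  have ik: "integrable lborel (\<lambda>y. indicator {..x} y *\<^sub>R ?k y)" for x
  proof (rule Bochner_Integration.integrable_bound)
    show "integrable lborel (\<lambda>y. exp x * norm (u y))" using u by simp
  qed (auto simp: indicator_def mult_right_mono)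
  have eq: "conv exp_right u x = exp (- x) *\<^sub>R (LINT y|lborel. indicator {..x} y *\<^sub>R ?k y)" for x
    unfolding conv_def integral_scaleR_right [symmetric]
    by (rule Bochner_Integration.integral_cong)
       (auto simp: exp_right_def indicator_def scaleR_conv_of_real exp_diff exp_minus field_simps)
  have d: "((\<lambda>x. exp (- x)) has_real_derivative - exp (- x)) (at x)"
    by (auto intro!: derivative_eq_intros)
  from has_vector_derivative_scaleR[OF d has_vector_derivative_integral_atMost[OF ck ik, of x]]
  show ?thesis
    unfolding eq [abs_def] by (simp add: exp_minus)
qed

lemma conv_exp_left_eq: "conv exp_left u x = conv exp_right (\<lambda>y. u (- y)) (- x)"
  unfolding conv_def exp_left_def using integral_lborel_shift(3)[of "\<lambda>y. exp_right (- (x - y)) * u y"] by simp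

lemma continuous_reflect: "continuous_on UNIV f \<Longrightarrow> continuous_on UNIV (\<lambda>x::real. f (- x))"
  by (rule continuous_on_compose2[of UNIV f]) (auto intro: continuous_intros)

lemma has_vector_derivative_reflect:
  assumes "(f has_vector_derivative d) (at (- x))"
  shows "((\<lambda>x::real. f (- x)) has_vector_derivative - d) (at x)"
proof -
  have "((\<lambda>x::real. - x) has_vector_derivative - 1) (at x)"
    by (auto intro!: derivative_eq_intros)
  from vector_diff_chain_at[OF this assms] show ?thesis by (simp add: o_def)
qed

lemma has_vector_derivative_conv_exp_left:
  assumes c: "continuous_on UNIV u" and u: "integrable lborel u"
  shows "(conv exp_left u has_vector_derivative (conv exp_left u x - u x)) (at x)"
  unfolding conv_exp_left_eq [abs_def]
  using has_vector_derivative_reflect[OF has_vector_derivative_conv_exp_right[OF continuous_reflect[OF c] integrable_lborel_shift(4)[OF u], of "- x"]]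
  by simp

text \<open>
  The convolution of \<open>u\<close> with \<open>exp (- \<bar>y\<bar>) / 2\<close>; \<open>green' u\<close> below is its derivative.
\<close>

definition green :: "(real \<Rightarrow> complex) \<Rightarrow> real \<Rightarrow> complex" where
  "green u x = (conv exp_right u x + conv exp_left u x) / 2"

definition green' :: "(real \<Rightarrow> complex) \<Rightarrow> real \<Rightarrow> complex" where
  "green' u x = (conv exp_left u x - conv exp_right u x) / 2"

lemma
  assumes c: "continuous_on UNIV u" and u: "integrable lborel u"
  shows has_vector_derivative_green: "(green u has_vector_derivative green' u x) (at x)"
    and has_vector_derivative_green': "(green' u has_vector_derivative green u x - u x) (at x)"
proof -
  note d = has_vector_derivative_conv_exp_right[OF c u, of x] has_vector_derivative_conv_exp_left[OF c u, of x]
  have "((\<lambda>x. (conv exp_right u x + conv exp_left u x) / 2) has_vector_derivative ((u x - conv exp_right u x) + (conv exp_left u x - u x)) / 2) (at x)"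
    by (intro has_vector_derivative_divide has_vector_derivative_add d)
  then show "(green u has_vector_derivative green' u x) (at x)"
    by (simp add: green_def [abs_def] green'_def)
  have "((\<lambda>x. (conv exp_left u x - conv exp_right u x) / 2) has_vector_derivative ((conv exp_left u x - u x) - (u x - conv exp_right u x)) / 2) (at x)"
    by (intro has_vector_derivative_divide has_vector_derivative_diff d)
  then show "(green' u has_vector_derivative green u x - u x) (at x)"
    by (simp add: green_def green'_def [abs_def] field_simps)
qed

lemma
  assumes u: "integrable lborel u"
  shows integrable_green: "integrable lborel (green u)"
    and integrable_green': "integrable lborel (green' u)"
  unfolding green_def [abs_def] green'_def [abs_def]
  using integrable_conv[OF exp_right_integrable u] integrable_conv[OF exp_left_integrable u] by auto

lemma
  assumes u: "integrable lborel u"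
  shows green_tendsto_0: "(green u \<longlongrightarrow> 0) at_infinity"
    and green'_tendsto_0: "(green' u \<longlongrightarrow> 0) at_infinity"
proof -
  note t = conv_tendsto_0_at_infinity[OF exp_right_measurable exp_right_le exp_right_tendsto_0 u]
    conv_tendsto_0_at_infinity[OF exp_left_measurable exp_left_le exp_left_tendsto_0 u]
  have "((\<lambda>x. (conv exp_right u x + conv exp_left u x) / 2) \<longlongrightarrow> (0 + 0) / 2) at_infinity"
    by (intro tendsto_intros t) simp
  then show "(green u \<longlongrightarrow> 0) at_infinity" by (simp add: green_def [abs_def])
  have "((\<lambda>x. (conv exp_left u x - conv exp_right u x) / 2) \<longlongrightarrow> (0 - 0) / 2) at_infinity"
    by (intro tendsto_intros t) simp
  then show "(green' u \<longlongrightarrow> 0) at_infinity" by (simp add: green'_def [abs_def])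
qed

lemma L1_norm_green_le:
  assumes u: "integrable lborel u"
  shows "(LINT x|lborel. norm (green u x)) \<le> (LINT x|lborel. norm (u x))"
proof -
  note i = integrable_conv[OF exp_right_integrable u] integrable_conv[OF exp_left_integrable u]
  have "(LINT x|lborel. norm (green u x)) \<le> (LINT x|lborel. (norm (conv exp_right u x) + norm (conv exp_left u x)) / 2)"
  proof (rule integral_mono)
    show "norm (green u x) \<le> (norm (conv exp_right u x) + norm (conv exp_left u x)) / 2" for x
      using norm_triangle_ineq[of "conv exp_right u x" "conv exp_left u x"] by (simp add: green_def norm_divide)
  qed (use i integrable_green[OF u] in auto)
  also have "\<dots> = ((LINT x|lborel. norm (conv exp_right u x)) + (LINT x|lborel. norm (conv exp_left u x))) / 2"
    using i by simp
  finally show ?thesis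
    using L1_norm_conv_le[OF exp_right_integrable u] L1_norm_conv_le[OF exp_left_integrable u] exp_right_L1 exp_left_L1 by simp
qed

lemma norm_green_le:
  assumes u: "integrable lborel u"
  shows "norm (green u x) \<le> (LINT x|lborel. norm (u x))" "norm (green' u x) \<le> (LINT x|lborel. norm (u x))"
  using norm_conv_le[where f = exp_right and B = 1, OF exp_right_le u, of x] norm_conv_le[where f = exp_left and B = 1, OF exp_left_le u, of x]
    norm_triangle_ineq[of "conv exp_right u x" "conv exp_left u x"] norm_triangle_ineq4[of "conv exp_left u x" "conv exp_right u x"]
  by (simp_all add: green_def green'_def norm_divide)

text \<open>
  The transform of the equation \<open>green u - (green u)'' = u\<close>.
\<close>

lemma ft_green:
  assumes c: "continuous_on UNIV u" and u: "integrable lborel u"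
  shows "of_real (1 + s\<^sup>2) * ft (green u) s = ft u s"
proof -
  note d = has_vector_derivative_green[OF c u] has_vector_derivative_green'[OF c u]
  have cont: "continuous_on UNIV (green u)" "continuous_on UNIV (green' u)"
    using d by (meson continuous_at_imp_continuous_on has_vector_derivative_continuous)+
  note i = integrable_green[OF u] integrable_green'[OF u]
  have "ft (\<lambda>x. green u x - u x) s = \<i> * of_real s * (\<i> * of_real s * ft (green u) s)"
    using ft_deriv[OF d(1) cont(2) i, of s] ft_deriv[OF d(2) _ i(2), of s] i u cont c
    by (simp add: continuous_on_diff)
  then have "ft (green u) s - ft u s = - of_real (s\<^sup>2) * ft (green u) s"
    using i u by (simp add: ft_diff power2_eq_square algebra_simps)
  then show ?thesis by (simp add: algebra_simps)
qed

text \<open>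
  For \<open>t = 1\<close> and \<open>t = -1\<close>, \<open>exp (- t x) * (w' x + t * w x)\<close> is constant, so \<open>w\<close> is a combination of \<open>exp x\<close> and
  \<open>exp (- x)\<close>; boundedness at both ends makes both coefficients 0.
\<close>

lemma bounded_solution_ode_eq_0:
  fixes w :: "real \<Rightarrow> complex"
  assumes d1: "\<And>x. (w has_vector_derivative w' x) (at x)"
    and d2: "\<And>x. (w' has_vector_derivative w x) (at x)"
    and b: "\<And>x. norm (w x) \<le> B"
  shows "w x = 0"
proof -
  have de: "((\<lambda>x. exp (t * x)) has_real_derivative t * exp (t * x)) (at x)" for t x :: real
    by (auto intro!: derivative_eq_intros)
  have key: "exp (- t * x) *\<^sub>R (w' x + t *\<^sub>R w x) = w' 0 + t *\<^sub>R w 0" if t: "t * t = 1" for t x :: real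
  proof -
    have "((\<lambda>x. exp (- t * x) *\<^sub>R (w' x + t *\<^sub>R w x)) has_vector_derivative
        exp (- t * x) *\<^sub>R (w x + t *\<^sub>R w' x) + (- t * exp (- t * x)) *\<^sub>R (w' x + t *\<^sub>R w x)) (at x)" for x
      by (intro has_vector_derivative_scaleR de has_vector_derivative_add d1 d2
          has_vector_derivative_scaleR[OF DERIV_const, simplified])
    moreover have "exp (- t * x) *\<^sub>R (w x + t *\<^sub>R w' x) + (- t * exp (- t * x)) *\<^sub>R (w' x + t *\<^sub>R w x) = 0" for x
      using t by (simp add: scaleR_add_right mult_ac)
    ultimately have "((\<lambda>x. exp (- t * x) *\<^sub>R (w' x + t *\<^sub>R w x)) has_vector_derivative 0) (at x)" for x
      by metis
    then obtain K where "\<And>x. exp (- t * x) *\<^sub>R (w' x + t *\<^sub>R w x) = K"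
      using has_vector_derivative_zero_constant[of UNIV "\<lambda>x. exp (- t * x) *\<^sub>R (w' x + t *\<^sub>R w x)"] by auto
    from this[of x] this[of 0] show ?thesis by simp
  qed
  define a where "a = w' 0 + w 0"
  define b' where "b' = w' 0 - w 0"
  have ka: "w' x + w x = exp x *\<^sub>R a" for x
  proof -
    have "exp x *\<^sub>R (exp (- x) *\<^sub>R (w' x + w x)) = exp x *\<^sub>R a"
      using key[of 1 x] by (simp add: a_def)
    then show ?thesis by (simp add: exp_minus)
  qed
  have kb: "w' x - w x = exp (- x) *\<^sub>R b'" for x
  proof -
    have "exp (- x) *\<^sub>R (exp x *\<^sub>R (w' x - w x)) = exp (- x) *\<^sub>R b'"
      using key[of "-1" x] by (simp add: b'_def)
    then show ?thesis by (simp add: exp_minus)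
  qed
  have w: "2 * w x = exp x *\<^sub>R a - exp (- x) *\<^sub>R b'" for x
    using ka[of x] kb[of x] by (simp add: algebra_simps flip: ka kb)
  have e0: "((\<lambda>x::real. exp (- x)) \<longlongrightarrow> 0) at_top"
    by (rule filterlim_compose[OF exp_at_bot filterlim_uminus_at_bot_at_top])
  have lim: "((\<lambda>x. exp (- x) * (2 * B) + exp (- x) * (exp (- x) * C)) \<longlongrightarrow> 0) at_top" for C :: real
    using tendsto_add[OF tendsto_mult[OF e0 tendsto_const[of "2*B"]]
        tendsto_mult[OF e0 tendsto_mult[OF e0 tendsto_const[of C]]]] by simp
  have z: "z = 0" if "\<And>x. norm (z :: complex) \<le> exp (- x) * (2 * B) + exp (- x) * (exp (- x) * C)" for z C
  proof -
    have "norm z \<le> 0"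
      by (rule tendsto_lowerbound[OF lim[of C]]) (use that in auto)
    then show ?thesis by simp
  qed
  have "a = 0"
  proof (rule z)
    fix x
    have "exp x *\<^sub>R a = 2 * w x + exp (- x) *\<^sub>R b'" using w[of x] by simp
    then have "norm (exp x *\<^sub>R a) \<le> norm (2 * w x) + norm (exp (- x) *\<^sub>R b')"
      by (simp only: norm_triangle_ineq)
    also have "\<dots> \<le> 2 * B + exp (- x) * norm b'" using b[of x] by (simp add: norm_mult)
    finally have "exp (- x) * norm (exp x *\<^sub>R a) \<le> exp (- x) * (2 * B + exp (- x) * norm b')"
      by (rule mult_left_mono) simp
    moreover have "exp (- x) * norm (exp x *\<^sub>R a) = norm a"
      by (simp add: mult.assoc [symmetric] exp_add [symmetric])
    ultimately show "norm a \<le> exp (- x) * (2 * B) + exp (- x) * (exp (- x) * norm b')"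
      by (simp only: distrib_left)
  qed
  moreover have "b' = 0"
  proof (rule z)
    fix x
    have "exp x *\<^sub>R b' = exp (- x) *\<^sub>R a - 2 * w (- x)" using w[of "- x"] by simp
    then have "norm (exp x *\<^sub>R b') \<le> norm (exp (- x) *\<^sub>R a) + norm (2 * w (- x))"
      by (simp only: norm_triangle_ineq4)
    also have "\<dots> \<le> 2 * B + exp (- x) * norm a" using b[of "- x"] by (simp add: norm_mult)
    finally have "exp (- x) * norm (exp x *\<^sub>R b') \<le> exp (- x) * (2 * B + exp (- x) * norm a)"
      by (rule mult_left_mono) simp
    moreover have "exp (- x) * norm (exp x *\<^sub>R b') = norm b'"
      by (simp add: mult.assoc [symmetric] exp_add [symmetric])
    ultimately show "norm b' \<le> exp (- x) * (2 * B) + exp (- x) * (exp (- x) * norm a)"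
      by (simp only: distrib_left)
  qed
  ultimately show ?thesis using w[of x] by simp
qed

lemma bounded_solution_eq_green:
  assumes d1: "\<And>x. (w has_vector_derivative w' x) (at x)"
    and d2: "\<And>x. (w' has_vector_derivative w'' x) (at x)"
    and eq: "\<And>x. w x - w'' x = v x"
    and b: "\<And>x. norm (w x) \<le> B" and c: "continuous_on UNIV v" and v: "integrable lborel v"
  shows "w x = green v x"
proof -
  have "w x - green v x = 0"
  proof (rule bounded_solution_ode_eq_0)
    show "((\<lambda>x. w x - green v x) has_vector_derivative w' x - green' v x) (at x)" for x
      by (intro has_vector_derivative_diff d1 has_vector_derivative_green c v)
    have "((\<lambda>x. w' x - green' v x) has_vector_derivative w'' x - (green v x - v x)) (at x)" for x
      by (intro has_vector_derivative_diff d2 has_vector_derivative_green' c v)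
    moreover have "w'' x - (green v x - v x) = w x - green v x" for x
      using eq[of x] by (simp add: algebra_simps)
    ultimately show "((\<lambda>x. w' x - green' v x) has_vector_derivative w x - green v x) (at x)" for x by metis
    show "norm (w x - green v x) \<le> B + (LINT x|lborel. norm (v x))" for x
      by (rule order_trans[OF norm_triangle_ineq4 add_mono[OF b norm_green_le(1)[OF v]]])
  qed
  then show ?thesis by simp
qed

section \<open>The Hartley-Fourier convolution\<close>

lemma integrable_lebesgue_borel_representative:
  fixes f :: "real \<Rightarrow> complex"
  assumes f: "integrable lebesgue f"
  obtains f0 where "integrable lborel f0" "AE x in lebesgue. f x = f0 x"
proof -
  have "(\<lambda>x. Re (f x)) \<in> borel_measurable (completion lborel)" "(\<lambda>x. Im (f x)) \<in> borel_measurable (completion lborel)"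
    using f by (auto dest!: borel_measurable_integrable)
  then obtain u v where uv [measurable]: "u \<in> borel_measurable lborel" "v \<in> borel_measurable lborel"
    and ae: "AE x in lborel. Re (f x) = u x" "AE x in lborel. Im (f x) = v x"
    using completion_ex_borel_measurable_real by metis
  define f0 where "f0 x = Complex (u x) (v x)" for x
  have "f0 = (\<lambda>x. of_real (u x) + \<i> * of_real (v x))" by (simp add: f0_def fun_eq_iff Complex_eq)
  then have m: "f0 \<in> borel_measurable lborel" by simp
  have "AE x in lborel. f x = f0 x"
    using ae by eventually_elim (simp add: f0_def complex_eq_iff)
  then have ae0: "AE x in lebesgue. f x = f0 x" by (rule AE_completion)
  have "integrable lebesgue f0"
    by (rule integrable_cong_AE_imp[OF f _ ae0]) (use m in \<open>simp add: measurable_completion\<close>)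
  then have "integrable lborel f0" using m by (simp add: integrable_completion)
  then show ?thesis using ae0 that by blast
qed

lemma integrable_lborel_imp_lebesgue:
  fixes f :: "real \<Rightarrow> complex"
  assumes "integrable lborel f" shows "integrable lebesgue f"
  using assms by (subst integrable_completion) (auto dest: borel_measurable_integrable)

lemma continuous_integrable_lborel:
  fixes f :: "real \<Rightarrow> complex"
  assumes c: "continuous_on UNIV f" and "integrable lebesgue f"
  shows "integrable lborel f"
  using assms borel_measurable_continuous_onI[OF c] by (simp add: integrable_completion)

lemma fourier_eq_ft:
  assumes f: "integrable lborel f"
  shows "fourier f s = ft f s / sqrt (2 * pi)"
proof -
  have [measurable]: "f \<in> borel_measurable borel" using f by (auto dest: borel_measurable_integrable)
  have "(LINT x|lebesgue. exp (- (\<i> * complex_of_real (x * s))) * f x)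
      = (LINT x|lborel. exp (- (\<i> * complex_of_real (x * s))) * f x)"
    by (rule integral_completion) measurable
  then show ?thesis by (simp add: fourier_def ft_def cis_conv_exp mult_ac)
qed

lemma fourier_cong_AE:
  assumes f: "integrable lebesgue f" and g: "integrable lebesgue g" and ae: "AE x in lebesgue. f x = g x"
  shows "fourier f s = fourier g s"
proof -
  have m: "(\<lambda>x. exp (- (\<i> * complex_of_real (x * s)))) \<in> borel_measurable lebesgue"
    by (rule measurable_completion) measurable
  have "(LINT x|lebesgue. exp (- (\<i> * complex_of_real (x * s))) * f x)
      = (LINT x|lebesgue. exp (- (\<i> * complex_of_real (x * s))) * g x)"
    by (rule integral_cong_AE)
       (use m f g ae in \<open>auto dest: borel_measurable_integrable\<close>)
  then show ?thesis by (simp add: fourier_def)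
qed

lemma L1_norm_eq_lborel:
  assumes f: "integrable lborel f"
  shows "L1_norm f = (LINT x|lborel. norm (f x))"
proof -
  have [measurable]: "f \<in> borel_measurable borel" using f by (auto dest: borel_measurable_integrable)
  show ?thesis unfolding L1_norm_def by (rule integral_completion) measurable
qed

lemma L1_norm_cong_AE:
  assumes "integrable lebesgue f" "integrable lebesgue g" "AE x in lebesgue. f x = g x"
  shows "L1_norm f = L1_norm g"
  unfolding L1_norm_def using assms by (intro integral_cong_AE) (auto dest: borel_measurable_integrable)

definition \<kappa> :: complex where "\<kappa> = 1 / (2 * complex_of_real (sqrt (2 * pi)))"

lemma norm_\<kappa>: "4 * norm \<kappa> = sqrt (2 / pi)"
proof -
  have "sqrt (2 / pi) * sqrt (2 * pi) = 2"
    by (simp add: real_sqrt_mult [symmetric])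
  moreover have "sqrt (2 * pi) \<noteq> 0" by simp
  ultimately have "sqrt (2 / pi) = 2 / sqrt (2 * pi)" by (simp only: eq_divide_eq) simp
  moreover have "norm \<kappa> = 1 / (2 * sqrt (2 * pi))"
    unfolding \<kappa>_def norm_divide norm_mult norm_of_real by simp
  ultimately show ?thesis by simp
qed

lemma hf_conv_eq_conv:
  assumes c: "continuous_on UNIV f" and b: "\<And>x. norm (f x) \<le> B" and g: "integrable lborel g"
  shows "hf_conv f g x = \<kappa> * ((conv f (\<lambda>y. g (- y)) x + conv f g x)
    + \<i> * (conv (\<lambda>y. f (- y)) (\<lambda>y. g (- y)) x - conv (\<lambda>y. f (- y)) g x))"
proof -
  have [measurable]: "f \<in> borel_measurable borel" "g \<in> borel_measurable borel"
    using g c by (auto dest: borel_measurable_integrable intro: borel_measurable_continuous_onI)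
  have I: "integrable lborel (\<lambda>y. f (a + t * y) * g y)" for a t
  proof (rule Bochner_Integration.integrable_bound)
    show "integrable lborel (\<lambda>y. B * norm (g y))" using g by simp
    show "AE y in lborel. norm (f (a + t * y) * g y) \<le> norm (B * norm (g y))"
    proof (rule AE_I2)
      fix y
      have "norm (f (a + t * y) * g y) \<le> B * norm (g y)" by (simp add: norm_mult mult_right_mono b)
      then show "norm (f (a + t * y) * g y) \<le> norm (B * norm (g y))"
        unfolding real_norm_def by (rule order_trans[OF _ abs_ge_self])
    qed
  qed measurable
  have e: "(LINT y|lborel. f (x + y) * g y) = conv f (\<lambda>y. g (- y)) x"
    "(LINT y|lborel. f (- x - y) * g y) = conv (\<lambda>y. f (- y)) (\<lambda>y. g (- y)) x"
    "(LINT y|lborel. f (- x + y) * g y) = conv (\<lambda>y. f (- y)) g x"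
    "(LINT y|lborel. f (x - y) * g y) = conv f g x"
    unfolding conv_def
    using integral_lborel_shift(3)[of "\<lambda>y. f (x + y) * g y"] integral_lborel_shift(3)[of "\<lambda>y. f (- x - y) * g y"]
    by simp_all
  have "(LINT y|lebesgue. g y * (f (x + y) + f (x - y) + \<i> * f (- x - y) - \<i> * f (- x + y)))
      = (LINT y|lborel. g y * (f (x + y) + f (x - y) + \<i> * f (- x - y) - \<i> * f (- x + y)))"
    by (rule integral_completion) measurable
  also have "\<dots> = (LINT y|lborel. f (x + y) * g y + f (x - y) * g y + \<i> * (f (- x - y) * g y) - \<i> * (f (- x + y) * g y))"
    by (simp add: algebra_simps)
  also have "\<dots> = (LINT y|lborel. f (x + y) * g y) + (LINT y|lborel. f (x - y) * g y)
      + \<i> * (LINT y|lborel. f (- x - y) * g y) - \<i> * (LINT y|lborel. f (- x + y) * g y)"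
    using I[of x 1] I[of x "-1"] I[of "-x" "-1"] I[of "-x" 1] by simp
  also have "\<dots> = (conv f (\<lambda>y. g (- y)) x + conv f g x)
      + \<i> * (conv (\<lambda>y. f (- y)) (\<lambda>y. g (- y)) x - conv (\<lambda>y. f (- y)) g x)"
    unfolding e by (simp add: algebra_simps)
  finally show ?thesis
    unfolding hf_conv_def \<kappa>_def by (simp only:)
qed

lemma hf_conv_add_left:
  assumes f: "continuous_on UNIV f" "\<And>x. norm (f x) \<le> B" and f': "continuous_on UNIV f'" "\<And>x. norm (f' x) \<le> B'"
    and g: "integrable lborel g"
  shows "hf_conv (\<lambda>x. f x + f' x) g x = hf_conv f g x + hf_conv f' g x"
proof -
  note gr = integrable_lborel_shift(4)[OF g]
  have add: "conv (\<lambda>x. a x + b x) k x = conv a k x + conv b k x"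
    if "continuous_on UNIV a" "\<And>x. norm (a x) \<le> B" "continuous_on UNIV b" "\<And>x. norm (b x) \<le> B'" "integrable lborel k" for a b k
    unfolding conv_def
    using integrable_bounded_mult[OF borel_measurable_continuous_onI[OF that(1)] that(2,5), of x]
      integrable_bounded_mult[OF borel_measurable_continuous_onI[OF that(3)] that(4,5), of x]
    by (simp add: distrib_right)
  have c: "continuous_on UNIV (\<lambda>x. f x + f' x)" by (intro continuous_intros f f')
  have b: "norm (f x + f' x) \<le> B + B'" for x by (intro norm_triangle_mono f f')
  note a = add[OF f f'] add[OF continuous_reflect[OF f(1)] _ continuous_reflect[OF f'(1)]]
  show ?thesis
    unfolding hf_conv_eq_conv[OF c b g] hf_conv_eq_conv[OF f g] hf_conv_eq_conv[OF f' g]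
    by (simp add: a f f' g gr algebra_simps)
qed

text \<open>
  The second argument matters only up to a null set, so it may be replaced by a Borel
  representative. Continuity of \<open>f\<close> serves to make the integrand measurable.
\<close>

lemma hf_conv_cong_AE:
  assumes c: "continuous_on UNIV f" and g: "integrable lebesgue g" "integrable lebesgue g0"
    and ae: "AE x in lebesgue. g x = g0 x"
  shows "hf_conv f g = hf_conv f g0"
proof
  fix x
  have [measurable]: "f \<in> borel_measurable borel" using c by (rule borel_measurable_continuous_onI)
  have m: "(\<lambda>y. f (x + y) + f (x - y) + \<i> * f (- x - y) - \<i> * f (- x + y)) \<in> borel_measurable lebesgue"
    by (rule measurable_completion) measurable
  have "(LINT y|lebesgue. g y * (f (x + y) + f (x - y) + \<i> * f (- x - y) - \<i> * f (- x + y)))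
      = (LINT y|lebesgue. g0 y * (f (x + y) + f (x - y) + \<i> * f (- x - y) - \<i> * f (- x + y)))"
  proof (rule integral_cong_AE)
    show "AE y in lebesgue. g y * (f (x + y) + f (x - y) + \<i> * f (- x - y) - \<i> * f (- x + y))
        = g0 y * (f (x + y) + f (x - y) + \<i> * f (- x - y) - \<i> * f (- x + y))"
      using ae by eventually_elim simp
  qed (intro borel_measurable_times m borel_measurable_integrable g)+
  then show "hf_conv f g x = hf_conv f g0 x" by (simp add: hf_conv_def)
qed

lemma
  assumes c: "continuous_on UNIV f" and b: "\<And>x. norm (f x) \<le> B" and g: "integrable lborel g"
  shows continuous_hf_conv: "continuous_on UNIV (hf_conv f g)"
    and bounded_hf_conv: "\<exists>C. \<forall>x. norm (hf_conv f g x) \<le> C"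
proof -
  note eq = hf_conv_eq_conv[OF c b g]
  note gr = integrable_lborel_shift(4)[OF g]
  note cr = continuous_reflect[OF c]
  show "continuous_on UNIV (hf_conv f g)"
    unfolding eq [abs_def]
    by (intro continuous_intros continuous_conv[OF c b] continuous_conv[OF cr b] g gr)
  let ?C = "B * (LINT y|lborel. norm (g y))"
  have r: "(LINT y|lborel. norm (g (- y))) = (LINT y|lborel. norm (g y))"
    using integral_lborel_shift(3)[of "\<lambda>y. norm (g y)"] by simp
  have bnd: "norm (conv f g x) \<le> ?C" "norm (conv f (\<lambda>y. g (- y)) x) \<le> ?C"
    "norm (conv (\<lambda>y. f (- y)) g x) \<le> ?C" "norm (conv (\<lambda>y. f (- y)) (\<lambda>y. g (- y)) x) \<le> ?C" for x
    using norm_conv_le[where f = f and B = B, OF b g, of x] norm_conv_le[where f = f and B = B, OF b gr, of x]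
      norm_conv_le[where f = "\<lambda>y. f (- y)" and B = B, OF b g, of x]
      norm_conv_le[where f = "\<lambda>y. f (- y)" and B = B, OF b gr, of x]
    by (simp_all only: r)
  have "norm (hf_conv f g x) \<le> norm \<kappa> * ((?C + ?C) + norm \<i> * (?C + ?C))" for x
    unfolding eq norm_mult[of \<kappa>]
    by (intro mult_left_mono norm_triangle_mono bnd order_trans[OF norm_mult_ineq]
        order_trans[OF norm_triangle_ineq4] add_mono norm_ge_zero)
  then show "\<exists>C. \<forall>x. norm (hf_conv f g x) \<le> C" by blast
qed

lemma
  assumes c: "continuous_on UNIV f" and b: "\<And>x. norm (f x) \<le> B" and f: "integrable lborel f"
    and g: "integrable lborel g"
  shows integrable_hf_conv: "integrable lborel (hf_conv f g)"
    and L1_norm_hf_conv_le: "L1_norm (hf_conv f g) \<le> sqrt (2 / pi) * L1_norm f * L1_norm g"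
    and ft_hf_conv: "ft (hf_conv f g) s = \<kappa> * ((ft f s * ft g (- s) + ft f s * ft g s)
      + \<i> * (ft f (- s) * ft g (- s) - ft f (- s) * ft g s))"
proof -
  note eq = hf_conv_eq_conv[OF c b g]
  note gr = integrable_lborel_shift(4)[OF g]
  note fr = integrable_lborel_shift(4)[OF f]
  note i = integrable_conv[OF f gr] integrable_conv[OF f g] integrable_conv[OF fr gr] integrable_conv[OF fr g]
  show int: "integrable lborel (hf_conv f g)" unfolding eq [abs_def] using i by auto
  let ?C = "(LINT x|lborel. norm (f x)) * (LINT x|lborel. norm (g x))"
  have r: "(LINT y|lborel. norm (g (- y))) = (LINT y|lborel. norm (g y))"
    "(LINT y|lborel. norm (f (- y))) = (LINT y|lborel. norm (f y))"
    using integral_lborel_shift(3)[of "\<lambda>y. norm (g y)"] integral_lborel_shift(3)[of "\<lambda>y. norm (f y)"] by simp_all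
  have "(LINT x|lborel. norm (hf_conv f g x)) \<le> (LINT x|lborel. norm \<kappa> *
      ((norm (conv f (\<lambda>y. g (- y)) x) + norm (conv f g x))
       + (norm (conv (\<lambda>y. f (- y)) (\<lambda>y. g (- y)) x) + norm (conv (\<lambda>y. f (- y)) g x))))"
  proof (rule integral_mono)
    show "norm (hf_conv f g x) \<le> norm \<kappa> *
      ((norm (conv f (\<lambda>y. g (- y)) x) + norm (conv f g x))
       + (norm (conv (\<lambda>y. f (- y)) (\<lambda>y. g (- y)) x) + norm (conv (\<lambda>y. f (- y)) g x)))" for x
      unfolding eq norm_mult[of \<kappa>]
      by (intro mult_left_mono norm_triangle_mono norm_triangle_ineq) (auto simp: norm_mult norm_triangle_ineq4)
  qed (use i int in auto)
  also have "\<dots> = norm \<kappa> *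
      (((LINT x|lborel. norm (conv f (\<lambda>y. g (- y)) x)) + (LINT x|lborel. norm (conv f g x)))
       + ((LINT x|lborel. norm (conv (\<lambda>y. f (- y)) (\<lambda>y. g (- y)) x)) + (LINT x|lborel. norm (conv (\<lambda>y. f (- y)) g x))))"
    using i by simp
  also have "\<dots> \<le> norm \<kappa> * ((?C + ?C) + (?C + ?C))"
    using L1_norm_conv_le[OF f gr] L1_norm_conv_le[OF f g] L1_norm_conv_le[OF fr gr] L1_norm_conv_le[OF fr g]
    unfolding r by (intro mult_left_mono add_mono) auto
  also have "norm \<kappa> * ((?C + ?C) + (?C + ?C)) = sqrt (2 / pi) * (LINT x|lborel. norm (f x)) * (LINT x|lborel. norm (g x))"
  proof -
    have "norm \<kappa> * ((?C + ?C) + (?C + ?C)) = (4 * norm \<kappa>) * ?C" by simp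
    then show ?thesis unfolding norm_\<kappa> by (simp only: mult.assoc)
  qed
  finally show "L1_norm (hf_conv f g) \<le> sqrt (2 / pi) * L1_norm f * L1_norm g"
    using L1_norm_eq_lborel int f g by simp
  show "ft (hf_conv f g) s = \<kappa> * ((ft f s * ft g (- s) + ft f s * ft g s)
      + \<i> * (ft f (- s) * ft g (- s) - ft f (- s) * ft g s))"
    unfolding eq [abs_def] ft_cmult
    using i by (simp add: ft_add ft_diff ft_cmult ft_conv[OF f gr] ft_conv[OF f g] ft_conv[OF fr gr] ft_conv[OF fr g] ft_reflect)
qed

text \<open>
  A multiple of the Hartley transform: \<open>cos t + sin t\<close> equals
  \<open>((1 + \<i>) * cis (- t) + (1 - \<i>) * cis t) / 2\<close>.
\<close>

definition hartley :: "(real \<Rightarrow> complex) \<Rightarrow> real \<Rightarrow> complex" where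
  "hartley f s = (1 + \<i>) * ft f s + (1 - \<i>) * ft f (- s)"

text \<open>
  The factorization that explains the convolution. In the transform of \<open>hf_conv f g\<close> the frequencies \<open>s\<close> and \<open>- s\<close>
  are mixed, and the coefficients \<open>1 + \<i>\<close> and \<open>1 - \<i>\<close> are those for which the terms with \<open>ft g (- s)\<close> cancel.
\<close>

lemma hartley_hf_conv:
  assumes c: "continuous_on UNIV f" and b: "\<And>x. norm (f x) \<le> B" and f: "integrable lborel f"
    and g: "integrable lborel g"
  shows "hartley (hf_conv f g) s = hartley f s * fourier g s"
proof -
  have "fourier g s = 2 * \<kappa> * ft g s" by (simp add: fourier_eq_ft[OF g] \<kappa>_def)
  then show ?thesis
    unfolding hartley_def ft_hf_conv[OF c b f g] by (simp add: algebra_simps)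
qed

text \<open>
  The values of \<open>ft\<close> at \<open>s\<close> and \<open>- s\<close> are recovered from those of \<open>hartley\<close> by a linear system of
  determinant \<open>4 * \<i>\<close>. Almost everywhere equality becomes equality by continuity.
\<close>

lemma hartley_inject:
  assumes f: "continuous_on UNIV f" "integrable lborel f" and g: "continuous_on UNIV g" "integrable lborel g"
    and eq: "\<And>s. hartley f s = hartley g s"
  shows "f x = g x"
proof -
  have z: "ft (\<lambda>x. f x - g x) s = 0" for s
  proof -
    let ?p = "ft f s - ft g s" and ?q = "ft f (- s) - ft g (- s)"
    have "(1 + \<i>) * ?p + (1 - \<i>) * ?q = 0" "(1 + \<i>) * ?q + (1 - \<i>) * ?p = 0"
      using eq[of s] eq[of "- s"] by (simp_all add: hartley_def algebra_simps)
    \<comment> \<open>Eliminate \<open>?q\<close> from the two equations.\<close>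
    then have "(1 + \<i>) * ((1 + \<i>) * ?p + (1 - \<i>) * ?q) - (1 - \<i>) * ((1 + \<i>) * ?q + (1 - \<i>) * ?p) = 0" by simp
    moreover have "(1 + \<i>) * ((1 + \<i>) * p + (1 - \<i>) * q) - (1 - \<i>) * ((1 + \<i>) * q + (1 - \<i>) * p) = 4 * \<i> * p" for p q
      by (simp add: algebra_simps)
    ultimately have "4 * \<i> * ?p = 0" by (simp only:)
    then show ?thesis using f g by (simp add: ft_diff)
  qed
  have "AE x in lborel. f x - g x = 0"
    by (rule ft_eq_0_imp_AE_0) (use z f g in auto)
  then have "AE x in lebesgue. x \<in> {x. f x - g x = 0}" by (simp add: AE_completion)
  moreover have "closed {x. f x - g x = 0}"
    by (intro closed_Collect_eq continuous_intros f g)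
  ultimately have "x \<in> {x. f x - g x = 0}" by (intro mem_closed_if_AE_lebesgue)
  then show ?thesis by simp
qed

lemma has_vector_derivative_conv:
  assumes d: "\<And>x. (f has_vector_derivative f' x) (at x)" and c: "continuous_on UNIV f'"
    and b: "\<And>x. norm (f x) \<le> B" "\<And>x. norm (f' x) \<le> B'" and g: "integrable lborel g"
  shows "(conv f g has_vector_derivative conv f' g x) (at x)"
  unfolding conv_def [abs_def]
proof (rule has_vector_derivative_integral[where w = "\<lambda>y. B' * norm (g y)"])
  have "continuous_on UNIV f"
    using d by (meson continuous_at_imp_continuous_on has_vector_derivative_continuous)
  then have m: "f \<in> borel_measurable borel" by (rule borel_measurable_continuous_onI)
  have m': "f' \<in> borel_measurable borel" using c by (rule borel_measurable_continuous_onI)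
  show "integrable lborel (\<lambda>y. f (x - y) * g y)" for x by (rule integrable_bounded_mult[OF m b(1) g])
  show "((\<lambda>s. f (s - y) * g y) has_vector_derivative f' (s - y) * g y) (at s)" for s y
  proof -
    have "((\<lambda>s. s - y) has_vector_derivative 1) (at s)" by (auto intro!: derivative_eq_intros)
    from vector_diff_chain_at[OF this d[of "s - y"]]
    have "((\<lambda>s. f (s - y)) has_vector_derivative f' (s - y)) (at s)" by (simp add: o_def)
    then show ?thesis by (rule has_vector_derivative_mult_left)
  qed
  show "(\<lambda>y. f' (s - y) * g y) \<in> borel_measurable lborel" for s
    using integrable_bounded_mult[OF m' b(2) g] by (rule borel_measurable_integrable)
  show "norm (f' (s - y) * g y) \<le> B' * norm (g y)" for s y
    by (simp add: norm_mult mult_right_mono b)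
qed (use g in auto)

text \<open>
  A reflection changes the sign of a first derivative, so the first derivative of \<open>hf_conv f g\<close> is not
  \<open>hf_conv f' g\<close>; after two derivatives the signs have cancelled.
\<close>

lemma has_vector_derivative2_hf_conv:
  assumes d: "\<And>x. (f has_vector_derivative f' x) (at x)" "\<And>x. (f' has_vector_derivative f'' x) (at x)"
    and c: "continuous_on UNIV f''" and b: "\<And>x. norm (f x) \<le> B" "\<And>x. norm (f' x) \<le> B" "\<And>x. norm (f'' x) \<le> B"
    and g: "integrable lborel g"
  obtains F' where "\<And>x. (hf_conv f g has_vector_derivative F' x) (at x)"
    "\<And>x. (F' has_vector_derivative hf_conv f'' g x) (at x)"
proof -
  have c0: "continuous_on UNIV f" "continuous_on UNIV f'"
    using d by (meson continuous_at_imp_continuous_on has_vector_derivative_continuous)+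
  note gr = integrable_lborel_shift(4)[OF g]
  have dr: "((\<lambda>x. f (- x)) has_vector_derivative - f' (- x)) (at x)"
    "((\<lambda>x. - f' (- x)) has_vector_derivative f'' (- x)) (at x)" for x
    using has_vector_derivative_reflect[OF d(1)] has_vector_derivative_minus[OF has_vector_derivative_reflect[OF d(2)]] by simp_all
  have cr: "continuous_on UNIV (\<lambda>x. - f' (- x))" "continuous_on UNIV (\<lambda>x. f'' (- x))"
    by (intro continuous_intros continuous_reflect c0 c)+
  note D1 = has_vector_derivative_conv[OF d(1) c0(2) b(1,2)]
    has_vector_derivative_conv[OF dr(1) cr(1), where B = B and B' = B]
  note D2 = has_vector_derivative_conv[OF d(2) c b(2,3)]
    has_vector_derivative_conv[OF dr(2) cr(2), where B = B and B' = B]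
  let ?F' = "\<lambda>x. \<kappa> * ((conv f' (\<lambda>y. g (- y)) x + conv f' g x)
    + \<i> * (conv (\<lambda>y. - f' (- y)) (\<lambda>y. g (- y)) x - conv (\<lambda>y. - f' (- y)) g x))"
  show ?thesis
  proof (rule that[of ?F'])
    show "(hf_conv f g has_vector_derivative ?F' x) (at x)" for x
      unfolding hf_conv_eq_conv[OF c0(1) b(1) g, abs_def]
      by (intro has_vector_derivative_mult_right has_vector_derivative_add has_vector_derivative_diff D1 g gr) (simp_all add: b)
    show "(?F' has_vector_derivative hf_conv f'' g x) (at x)" for x
      unfolding hf_conv_eq_conv[OF c b(3) g]
      by (intro has_vector_derivative_mult_right has_vector_derivative_add has_vector_derivative_diff D2 g gr) (simp_all add: b)
  qed
qed

text \<open>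
  For an even second argument the two imaginary terms cancel and the two others agree.
\<close>

lemma hf_conv_exp_eq_green:
  assumes c: "continuous_on UNIV u" and b: "\<And>x. norm (u x) \<le> B"
  shows "hf_conv u (\<lambda>t. complex_of_real (sqrt (pi / 2) * exp (- \<bar>t\<bar>))) x = green u x"
proof -
  define E where "E t = complex_of_real (sqrt (pi / 2) * exp (- \<bar>t\<bar>))" for t :: real
  have um [measurable]: "u \<in> borel_measurable borel" using c by (rule borel_measurable_continuous_onI)
  have E: "AE t in lborel. of_real (sqrt (pi / 2)) * (exp_right t + exp_left t) = E t"
    using AE_lborel_singleton[of "0::real"]
    by eventually_elim (auto simp: E_def exp_right_def exp_left_def indicator_def abs_real_def)
  have Em [measurable]: "E \<in> borel_measurable borel" unfolding E_def by measurable
  have Ei: "integrable lborel E"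
    by (rule integrable_cong_AE_imp[OF _ _ E]) (use exp_right_integrable exp_left_integrable in auto)
  have Er: "(\<lambda>y. E (- y)) = E" by (simp add: E_def fun_eq_iff)
  have "conv u E x = (LINT y|lborel. of_real (sqrt (pi / 2)) * (u (x - y) * exp_right y + u (x - y) * exp_left y))"
    unfolding conv_def
  proof (rule integral_cong_AE)
    show "AE y in lborel. u (x - y) * E y = of_real (sqrt (pi / 2)) * (u (x - y) * exp_right y + u (x - y) * exp_left y)"
      using E
    proof eventually_elim
      case (elim y)
      show ?case unfolding elim [symmetric] by (simp add: algebra_simps)
    qed
  qed measurable
  also have "\<dots> = of_real (sqrt (pi / 2)) * (conv u exp_right x + conv u exp_left x)"
    using integrable_bounded_mult[OF um b exp_right_integrable, of x] integrable_bounded_mult[OF um b exp_left_integrable, of x]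
    by (simp add: conv_def)
  finally have cvE: "conv u E x = of_real (sqrt (pi / 2)) * (2 * green u x)"
    by (simp add: green_def conv_commute[of u])
  have "sqrt (2 * pi) = 2 * sqrt (pi / 2)" by (simp add: real_sqrt_mult real_sqrt_divide field_simps)
  then have "\<kappa> * (2 * of_real (sqrt (pi / 2)) * 2) = 1"
    by (simp add: \<kappa>_def)
  moreover have "hf_conv u E x = \<kappa> * (2 * of_real (sqrt (pi / 2)) * 2) * green u x"
    unfolding hf_conv_eq_conv[OF c b Ei] Er cvE by simp
  ultimately show ?thesis by (simp add: E_def [abs_def])
qed


section \<open>The integro-differential equation\<close>

lemma D_eqI: "(f has_vector_derivative f' x) (at x) \<Longrightarrow> D f x = f' x"
  unfolding D_def by (rule vector_derivative_at)

lemma twice_differentiable_iff: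
  "twice_differentiable f \<longleftrightarrow>
    (\<forall>x. (f has_vector_derivative D f x) (at x)) \<and> (\<forall>x. (D f has_vector_derivative D (D f) x) (at x))"
  unfolding twice_differentiable_def D_def vector_derivative_works ..

lemma twice_differentiableI:
  assumes "\<And>x. (f has_vector_derivative f' x) (at x)" "\<And>x. (f' has_vector_derivative f'' x) (at x)"
  shows "twice_differentiable f" "D f = f'" "D (D f) = f''"
proof -
  show 1: "D f = f'" by (intro ext D_eqI assms)
  show 2: "D (D f) = f''" unfolding 1 by (intro ext D_eqI assms)
  show "twice_differentiable f" unfolding twice_differentiable_iff 2 unfolding 1 using assms by blast
qed

lemma bounded_of_tendsto_0:
  fixes f :: "real \<Rightarrow> complex"
  assumes c: "continuous_on UNIV f" and t: "(f \<longlongrightarrow> 0) at_infinity"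
  obtains B where "\<And>x. norm (f x) \<le> B"
proof -
  have "\<forall>\<^sub>F x in at_infinity. norm (f x) < 1"
    using order_tendstoD(2)[OF tendsto_norm_zero[OF t], of 1] by simp
  then obtain R where R: "\<And>x. R \<le> norm x \<Longrightarrow> norm (f x) < 1" by (auto simp: eventually_at_infinity)
  have "norm (f x) \<le> 1" if "\<bar>x\<bar> > R" for x using R[of x] that by simp
  from bounded_of_bounded_outside[OF c this] show ?thesis using that by blast
qed

lemma bounded_of_integrable_deriv:
  fixes f :: "real \<Rightarrow> complex"
  assumes d: "\<And>x. (f has_vector_derivative f' x) (at x)" and c: "continuous_on UNIV f'"
    and i: "integrable lborel f'"
  obtains B where "\<And>x. norm (f x) \<le> B"
proof -
  let ?I = "LINT x|lborel. norm (f' x)"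
  have le: "norm (f b - f a) \<le> ?I" if ab: "a \<le> b" for a b
  proof -
    have "f b - f a = (LINT x|lborel. indicator {a..b} x *\<^sub>R f' x)"
      by (rule sym, rule integral_FTC_atLeastAtMost[OF ab])
         (use d c in \<open>auto intro: has_vector_derivative_at_within continuous_on_subset\<close>)
    then have "norm (f b - f a) \<le> (LINT x|lborel. norm (indicator {a..b} x *\<^sub>R f' x))"
      by (simp only: integral_norm_bound)
    also have "\<dots> \<le> ?I"
      by (rule integral_mono') (use i in \<open>auto simp: indicator_def\<close>)
    finally show ?thesis .
  qed
  have "norm (f x) \<le> norm (f 0) + ?I" for x
  proof -
    have "norm (f x - f 0) \<le> ?I"
      using le[of 0 x] le[of x 0] by (cases "0 \<le> x") (auto simp: norm_minus_commute)
    then show ?thesis using norm_triangle_ineq[of "f x - f 0" "f 0"] by simp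
  qed
  then show ?thesis using that by blast
qed

lemma green_is_C2:
  assumes c: "continuous_on UNIV u" and u: "integrable lborel u"
  shows "C2 (green u)" "D (green u) = green' u" "D (D (green u)) = (\<lambda>x. green u x - u x)"
proof -
  note d = has_vector_derivative_green[OF c u] has_vector_derivative_green'[OF c u]
  have "continuous_on UNIV (green u)"
    using d(1) by (meson continuous_at_imp_continuous_on has_vector_derivative_continuous)
  then show "C2 (green u)" "D (green u) = green' u" "D (D (green u)) = (\<lambda>x. green u x - u x)"
    using twice_differentiableI[OF d] c by (auto simp: C2_def intro: continuous_on_diff)
qed

lemma hartley_green:
  assumes c: "continuous_on UNIV u" and u: "integrable lborel u"
  shows "of_real (1 + s\<^sup>2) * hartley (green u) s = hartley u s"
  using ft_green[OF c u, of s] ft_green[OF c u, of "- s"]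
  by (simp add: hartley_def distrib_left mult.left_commute[of "of_real _" "1 + \<i>"] mult.left_commute[of "of_real _" "1 - \<i>"]
      del: of_real_add)

text \<open>
  Wiener's lemma for \<open>g / sqrt (2 * pi)\<close>, the rescaling between \<open>ft\<close> and \<open>fourier\<close>.
\<close>

lemma ex_resolvent:
  assumes g: "integrable lebesgue g" and nz: "\<And>y. 1 + fourier g y \<noteq> 0"
  shows "\<exists>\<xi>. is_resolvent g \<xi>"
proof -
  obtain g0 where g0: "integrable lborel g0" and ae: "AE x in lebesgue. g x = g0 x"
    by (rule integrable_lebesgue_borel_representative[OF g])
  let ?r = "complex_of_real (sqrt (2 * pi))"
  have F: "fourier g s = ft (\<lambda>x. 1 / ?r * g0 x) s" for s
    unfolding ft_cmult
    using fourier_cong_AE[OF g integrable_lborel_imp_lebesgue[OF g0] ae] fourier_eq_ft[OF g0] by simp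
  have "integrable lborel (\<lambda>x. 1 / ?r * g0 x)" using g0 by (rule integrable_mult_right)
  then obtain \<eta> where \<eta>: "integrable lborel \<eta>" "\<And>s. ft \<eta> s = ft (\<lambda>x. 1 / ?r * g0 x) s / (1 + ft (\<lambda>x. 1 / ?r * g0 x) s)"
    by (rule wiener_inverse) (use nz in \<open>simp_all only: F not_False_eq_True\<close>)
  have i: "integrable lborel (\<lambda>x. ?r * \<eta> x)" using \<eta>(1) by (rule integrable_mult_right)
  have "fourier (\<lambda>x. ?r * \<eta> x) s = fourier g s / (1 + fourier g s)" for s
    unfolding fourier_eq_ft[OF i] ft_cmult F \<eta>(2) by simp
  then have "is_resolvent g (\<lambda>x. ?r * \<eta> x)"
    using integrable_lborel_imp_lebesgue[OF i] by (simp add: is_resolvent_def)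
  then show ?thesis by blast
qed

lemma resolvent_unique_AE:
  assumes "is_resolvent g \<xi>" "is_resolvent g \<xi>'"
  shows "AE t in lebesgue. \<xi> t = \<xi>' t"
proof -
  have i: "integrable lebesgue \<xi>" "integrable lebesgue \<xi>'"
    and eq: "\<And>s. fourier \<xi> s = fourier \<xi>' s"
    using assms by (simp_all add: is_resolvent_def)
  obtain a where a: "integrable lborel a" "AE x in lebesgue. \<xi> x = a x"
    by (rule integrable_lebesgue_borel_representative[OF i(1)])
  obtain b where b: "integrable lborel b" "AE x in lebesgue. \<xi>' x = b x"
    by (rule integrable_lebesgue_borel_representative[OF i(2)])
  have "fourier a s = fourier b s" for s
    using eq[of s] fourier_cong_AE[OF i(1) integrable_lborel_imp_lebesgue[OF a(1)] a(2)]
      fourier_cong_AE[OF i(2) integrable_lborel_imp_lebesgue[OF b(1)] b(2)] by simp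
  then have "ft (\<lambda>x. a x - b x) s = 0" for s
    using a(1) b(1) by (simp add: fourier_eq_ft ft_diff)
  then have "AE x in lborel. a x - b x = 0"
    by (intro ft_eq_0_imp_AE_0) (use a b in auto)
  then have "AE x in lebesgue. a x - b x = 0" by (rule AE_completion)
  with a(2) b(2) show ?thesis by eventually_elim simp
qed

text \<open>
  With \<open>u = hf_conv h \<xi>\<close>, the function \<open>green u\<close> solves the problem because \<open>u + hf_conv u g = hf_conv h g\<close>, an
  identity between transforms. Conversely, for a solution \<open>f\<close> the sum \<open>f + hf_conv f g\<close> is the bounded solution of
  \<open>w - w'' = hf_conv h g\<close>, which determines \<open>hartley f\<close>.
\<close>

lemma
  assumes g: "integrable lebesgue g" and nz: "\<And>y. 1 + fourier g y \<noteq> 0"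
    and hC: "continuous_on UNIV h" and hb: "\<And>x. norm (h x) \<le> B" and hi: "integrable lborel h"
    and \<xi>: "is_resolvent g \<xi>"
  shows is_solution_green: "is_solution g h (green (hf_conv h \<xi>))"
    and solution_eq_green: "is_solution g h f \<Longrightarrow> f x = green (hf_conv h \<xi>) x"
    and L1_norm_green_hf_conv: "L1_norm (green (hf_conv h \<xi>)) \<le> 2 * sqrt (2 / pi) * L1_norm h * L1_norm \<xi>"
    and green_eq_hf_conv: "green (hf_conv h \<xi>) x = hf_conv (hf_conv h \<xi>)
        (\<lambda>t. complex_of_real (sqrt (pi / 2) * exp (- \<bar>t\<bar>))) x"
proof -
  obtain g0 where g0: "integrable lborel g0" and gae: "AE x in lebesgue. g x = g0 x"
    by (rule integrable_lebesgue_borel_representative[OF g])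
  have \<xi>i: "integrable lebesgue \<xi>" using \<xi> by (simp add: is_resolvent_def)
  obtain \<xi>0 where \<xi>0: "integrable lborel \<xi>0" and \<xi>ae: "AE x in lebesgue. \<xi> x = \<xi>0 x"
    by (rule integrable_lebesgue_borel_representative[OF \<xi>i])
  note g0' = integrable_lborel_imp_lebesgue[OF g0] and \<xi>0' = integrable_lborel_imp_lebesgue[OF \<xi>0]
  have Fg: "fourier g0 s = fourier g s" for s using fourier_cong_AE[OF g g0' gae] by simp
  have F\<xi>: "fourier \<xi>0 s = fourier g s / (1 + fourier g s)" for s
    using fourier_cong_AE[OF \<xi>i \<xi>0' \<xi>ae] \<xi> by (simp add: is_resolvent_def)
  have hfg: "hf_conv f g = hf_conv f g0" if "continuous_on UNIV f" for f
    by (rule hf_conv_cong_AE[OF that g g0' gae])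
  define u where "u = hf_conv h \<xi>"
  have u_eq: "u = hf_conv h \<xi>0" unfolding u_def by (rule hf_conv_cong_AE[OF hC \<xi>i \<xi>0' \<xi>ae])
  have uC: "continuous_on UNIV u" unfolding u_eq by (rule continuous_hf_conv[OF hC hb \<xi>0])
  obtain Bu where ub: "\<And>x. norm (u x) \<le> Bu" using bounded_hf_conv[OF hC hb \<xi>0] u_eq by blast
  have ui: "integrable lborel u" unfolding u_eq by (rule integrable_hf_conv[OF hC hb hi \<xi>0])
  have hartley_u: "hartley u s = hartley h s * (fourier g s / (1 + fourier g s))" for s
    unfolding u_eq hartley_hf_conv[OF hC hb hi \<xi>0] F\<xi> ..
  define v where "v = hf_conv h g0"
  have vC: "continuous_on UNIV v" unfolding v_def by (rule continuous_hf_conv[OF hC hb g0])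
  have vi: "integrable lborel v" unfolding v_def by (rule integrable_hf_conv[OF hC hb hi g0])
  have hartley_v: "hartley v s = hartley h s * fourier g s" for s
    unfolding v_def hartley_hf_conv[OF hC hb hi g0] Fg ..
  have hartley_add: "hartley (\<lambda>x. a x + b x) s = hartley a s + hartley b s" if "integrable lborel a" "integrable lborel b" for a b s
    using that by (simp add: hartley_def ft_add algebra_simps)
  note dG = has_vector_derivative_green[OF uC ui] has_vector_derivative_green'[OF uC ui]
  have GC: "continuous_on UNIV (green u)"
    using dG by (meson continuous_at_imp_continuous_on has_vector_derivative_continuous)
  note Gi = integrable_green[OF ui]

  \<comment> \<open>The equation for \<open>\<xi>\<close> read on the transform side: \<open>1 + fourier g\<close> cancels the denominator.\<close>
  have u_v: "u x + hf_conv u g0 x = v x" for x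
  proof (rule hartley_inject)
    note i = integrable_hf_conv[OF uC ub ui g0]
    show "continuous_on UNIV (\<lambda>x. u x + hf_conv u g0 x)"
      by (intro continuous_intros uC continuous_hf_conv[OF uC ub g0])
    show "integrable lborel (\<lambda>x. u x + hf_conv u g0 x)" using ui i by simp
    show "hartley (\<lambda>x. u x + hf_conv u g0 x) s = hartley v s" for s
      unfolding hartley_add[OF ui i] hartley_hf_conv[OF uC ub ui g0] hartley_u hartley_v Fg
    proof -
      have "hartley h s * (fourier g s / (1 + fourier g s)) + hartley h s * (fourier g s / (1 + fourier g s)) * fourier g s
          = hartley h s * (fourier g s / (1 + fourier g s) * (1 + fourier g s))"
        by (simp only: distrib_left mult_1_right mult.assoc)
      also have "fourier g s / (1 + fourier g s) * (1 + fourier g s) = fourier g s"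
        using nz[of s] by (rule nonzero_eq_divide_eq[THEN iffD1]) simp
      finally show "hartley h s * (fourier g s / (1 + fourier g s)) + hartley h s * (fourier g s / (1 + fourier g s)) * fourier g s
          = hartley h s * fourier g s" .
    qed
  qed (fact vC vi)+

  show "is_solution g h (green (hf_conv h \<xi>))"
  proof -
    let ?f = "green u" and ?f'' = "\<lambda>x. green u x - u x"
    define C where "C = (LINT x|lborel. norm (u x)) + Bu"
    have Bu: "0 \<le> Bu" using order_trans[OF norm_ge_zero ub] .
    have b: "norm (?f x) \<le> C" "norm (green' u x) \<le> C" "norm (?f'' x) \<le> C" for x
      using norm_green_le[OF ui, of x] ub[of x] Bu norm_triangle_ineq4[of "green u x" "u x"]
      unfolding C_def by linarith+
    have f''C: "continuous_on UNIV ?f''" by (intro continuous_intros GC uC)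
    obtain F' where F': "\<And>x. (hf_conv ?f g0 has_vector_derivative F' x) (at x)"
      "\<And>x. (F' has_vector_derivative hf_conv ?f'' g0 x) (at x)"
      by (rule has_vector_derivative2_hf_conv[OF dG f''C b g0]) (rule that)
    note tw = twice_differentiableI[OF F']
    \<comment> \<open>Applying \<open>1 - d\<^sup>2/dx\<^sup>2\<close> to \<open>hf_conv (green u) g\<close> gives \<open>hf_conv u g\<close>.\<close>
    have lin: "hf_conv ?f g0 x - hf_conv ?f'' g0 x = hf_conv u g0 x" for x
    proof -
      have "hf_conv (\<lambda>x. ?f'' x + u x) g0 x = hf_conv ?f'' g0 x + hf_conv u g0 x"
        by (rule hf_conv_add_left[OF f''C b(3) uC ub g0])
      then show ?thesis by simp
    qed
    show ?thesis
      unfolding is_solution_def u_def [symmetric]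
    proof (intro conjI allI)
      show "C2 ?f" by (rule green_is_C2[OF uC ui])
      show "integrable lebesgue ?f" by (rule integrable_lborel_imp_lebesgue[OF Gi])
      show "twice_differentiable (hf_conv ?f g)" unfolding hfg[OF GC] by (rule tw)
      show "(?f \<longlongrightarrow> 0) at_infinity" by (rule green_tendsto_0[OF ui])
      show "(D ?f \<longlongrightarrow> 0) at_infinity" unfolding green_is_C2[OF uC ui] by (rule green'_tendsto_0[OF ui])
      show "?f x - D (D ?f) x + (hf_conv ?f g x - D (D (hf_conv ?f g)) x) = hf_conv h g x" for x
        unfolding hfg[OF GC] hfg[OF hC] tw(3) green_is_C2(3)[OF uC ui] lin v_def [symmetric]
        using u_v[of x] by simp
    qed
  qed

  show "f x = green (hf_conv h \<xi>) x" if sol: "is_solution g h f"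
    unfolding u_def [symmetric]
  proof (rule hartley_inject)
    have td: "twice_differentiable f" "twice_differentiable (hf_conv f g)" and fi': "integrable lebesgue f"
      and ft0: "(f \<longlongrightarrow> 0) at_infinity"
      and eq: "\<And>x. f x - D (D f) x + (hf_conv f g x - D (D (hf_conv f g)) x) = hf_conv h g x"
      using sol by (auto simp: is_solution_def C2_def)
    note df = td(1)[unfolded twice_differentiable_iff] td(2)[unfolded twice_differentiable_iff]
    show fC: "continuous_on UNIV f"
      using df(1) by (meson continuous_at_imp_continuous_on has_vector_derivative_continuous)
    show fi: "integrable lborel f" by (rule continuous_integrable_lborel[OF fC fi'])
    obtain Bf where fb: "\<And>x. norm (f x) \<le> Bf" by (rule bounded_of_tendsto_0[OF fC ft0]) (rule that)
    obtain Bk where kb: "\<And>x. norm (hf_conv f g0 x) \<le> Bk" using bounded_hf_conv[OF fC fb g0] by blast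
    note ki = integrable_hf_conv[OF fC fb fi g0]
    \<comment> \<open>The equation involves \<open>f\<close> and \<open>hf_conv f g\<close> only through their sum, which is bounded.\<close>
    have w: "f x + hf_conv f g0 x = green v x" for x
    proof (rule bounded_solution_eq_green)
      show "((\<lambda>x. f x + hf_conv f g0 x) has_vector_derivative D f x + D (hf_conv f g0) x) (at x)" for x
        using df unfolding hfg[OF fC] by (intro has_vector_derivative_add) auto
      show "((\<lambda>x. D f x + D (hf_conv f g0) x) has_vector_derivative D (D f) x + D (D (hf_conv f g0)) x) (at x)" for x
        using df unfolding hfg[OF fC] by (intro has_vector_derivative_add) auto
      show "f x + hf_conv f g0 x - (D (D f) x + D (D (hf_conv f g0)) x) = v x" for x
        using eq[of x] unfolding hfg[OF fC] hfg[OF hC] v_def by (simp add: algebra_simps)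
      show "norm (f x + hf_conv f g0 x) \<le> Bf + Bk" for x by (rule norm_triangle_mono[OF fb kb])
    qed (fact vC vi)+
    show "hartley f s = hartley (green u) s" for s
    proof -
      have "hartley f s + hartley f s * fourier g s = hartley (green v) s"
        using hartley_add[OF fi ki, of s] hartley_hf_conv[OF fC fb fi g0, of s] by (simp add: w Fg)
      then have "of_real (1 + s\<^sup>2) * (hartley f s * (1 + fourier g s)) = hartley h s * fourier g s"
        using hartley_green[OF vC vi, of s] hartley_v[of s] by (simp add: distrib_left)
      moreover have "of_real (1 + s\<^sup>2) * (hartley (green u) s * (1 + fourier g s)) = hartley h s * fourier g s"
        using hartley_green[OF uC ui, of s] hartley_u[of s] nz[of s] by (simp add: mult.assoc [symmetric])
      ultimately have "of_real (1 + s\<^sup>2) * (hartley f s * (1 + fourier g s)) = of_real (1 + s\<^sup>2) * (hartley (green u) s * (1 + fourier g s))"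
        by simp
      moreover have "1 + s\<^sup>2 \<noteq> 0" using zero_le_power2[of s] by linarith
      ultimately show ?thesis using nz[of s] by (simp only: mult_cancel_left mult_cancel_right of_real_eq_0_iff) simp
    qed
  qed (fact GC Gi)+

  have "L1_norm (green u) \<le> L1_norm u"
    using L1_norm_green_le[OF ui] by (simp add: L1_norm_eq_lborel Gi ui)
  also have "\<dots> \<le> sqrt (2 / pi) * L1_norm h * L1_norm \<xi>0"
    unfolding u_eq by (rule L1_norm_hf_conv_le[OF hC hb hi \<xi>0])
  also have "L1_norm \<xi>0 = L1_norm \<xi>" using L1_norm_cong_AE[OF \<xi>i \<xi>0' \<xi>ae] by simp
  also have "sqrt (2 / pi) * L1_norm h * L1_norm \<xi> \<le> 2 * sqrt (2 / pi) * L1_norm h * L1_norm \<xi>"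
  proof -
    have double: "x \<le> 2 * x" if "0 \<le> x" for x :: real using that by simp
    have "0 \<le> L1_norm f" for f by (simp add: L1_norm_def)
    then have "0 \<le> sqrt (2 / pi) * L1_norm h * L1_norm \<xi>" by (intro mult_nonneg_nonneg) auto
    then have "sqrt (2 / pi) * L1_norm h * L1_norm \<xi> \<le> 2 * (sqrt (2 / pi) * L1_norm h * L1_norm \<xi>)"
      by (rule double)
    then show ?thesis by (simp only: mult.assoc)
  qed
  finally show "L1_norm (green (hf_conv h \<xi>)) \<le> 2 * sqrt (2 / pi) * L1_norm h * L1_norm \<xi>"
    unfolding u_def .
  show "green (hf_conv h \<xi>) x = hf_conv (hf_conv h \<xi>) (\<lambda>t. complex_of_real (sqrt (pi / 2) * exp (- \<bar>t\<bar>))) x"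
    using hf_conv_exp_eq_green[OF uC ub, of x] by (simp only: u_def)
qed

theorem theorem4p5:
  fixes g h :: "real \<Rightarrow> complex"
  assumes "integrable lebesgue g"
    and "C2 h" and "integrable lebesgue h"
    and "integrable lebesgue (D h)" and "integrable lebesgue (D (D h))"
    and "\<And>y. 1 + fourier g y \<noteq> 0"
  shows "(\<exists>!f. is_solution g h f) \<and>
    (\<exists>\<xi>. is_resolvent g \<xi>) \<and>
    (\<forall>\<xi> \<xi>'. is_resolvent g \<xi> \<and> is_resolvent g \<xi>' \<longrightarrow> (AE t in lebesgue. \<xi> t = \<xi>' t)) \<and>
    (\<forall>f \<xi>. is_solution g h f \<and> is_resolvent g \<xi> \<longrightarrow>
       (\<forall>x. f x = hf_conv (hf_conv h \<xi>)
                    (\<lambda>t. complex_of_real (sqrt (pi / 2) * exp (- \<bar>t\<bar>))) x) \<and>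
       L1_norm f \<le> 2 * sqrt (2 / pi) * L1_norm h * L1_norm \<xi>)"
proof -
  have dh: "\<And>x. (h has_vector_derivative D h x) (at x)" "\<And>x. (D h has_vector_derivative D (D h) x) (at x)"
    using assms(2) by (auto simp: C2_def twice_differentiable_iff)
  have hC: "continuous_on UNIV h" "continuous_on UNIV (D h)"
    using dh by (meson continuous_at_imp_continuous_on has_vector_derivative_continuous)+
  have hi: "integrable lborel h" "integrable lborel (D h)"
    by (rule continuous_integrable_lborel; fact hC assms)+
  obtain B where hb: "\<And>x. norm (h x) \<le> B"
    by (rule bounded_of_integrable_deriv[OF dh(1) hC(2) hi(2)]) (rule that)
  note sol = is_solution_green[OF assms(1,6) hC(1) hb hi(1)]
  note eq = solution_eq_green[OF assms(1,6) hC(1) hb hi(1)]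
  note bnd = L1_norm_green_hf_conv[OF assms(1,6) hC(1) hb hi(1)]
  note rep = green_eq_hf_conv[OF assms(1,6) hC(1) hb hi(1)]
  obtain \<xi> where \<xi>: "is_resolvent g \<xi>" using ex_resolvent[OF assms(1,6)] by blast
  show ?thesis
  proof (intro conjI allI impI)
    show "\<exists>!f. is_solution g h f"
    proof (rule ex1I)
      show "is_solution g h (green (hf_conv h \<xi>))" by (rule sol[OF \<xi>])
      show "f = green (hf_conv h \<xi>)" if "is_solution g h f" for f
        using eq[OF \<xi> that] by (simp add: fun_eq_iff)
    qed
    show "\<exists>\<xi>. is_resolvent g \<xi>" using \<xi> by blast
    show "AE t in lebesgue. \<xi> t = \<xi>' t" if "is_resolvent g \<xi> \<and> is_resolvent g \<xi>'" for \<xi> \<xi>'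
      using that resolvent_unique_AE by blast
  next
    fix f \<xi> x
    assume a: "is_solution g h f \<and> is_resolvent g \<xi>"
    then have f: "f = green (hf_conv h \<xi>)" using eq by (simp add: fun_eq_iff)
    show "f x = hf_conv (hf_conv h \<xi>) (\<lambda>t. complex_of_real (sqrt (pi / 2) * exp (- \<bar>t\<bar>))) x"
      unfolding f using rep a by blast
    show "L1_norm f \<le> 2 * sqrt (2 / pi) * L1_norm h * L1_norm \<xi>"
      unfolding f using bnd a by blast
  qed
qed

end
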